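(* Let $\Bbbk$ be a field of characteristic different from $2$, let $d\ge 1$ and $n\geq 2$ be integers, and let $E=\Bbbk^d$ be equipped with a non-degenerate symmetric bilinear form $\langle -,-\rangle$. Then the scheme $X(d,n)$ is generically reduced.
   Context: Let $S=\Bbbk[x_{i,j} : 1\le i\le d,\ 1\le j\le n]$, and let $\mathbf{x}_1,\dots,\mathbf{x}_n$ be the columns of the generic $d\times n$ matrix $(x_{i,j})$. The form $\langle -,-\rangle$ is extended to column vectors over $S$ by $S$-bilinearity. Define $$I(d,n)=\big(\langle \mathbf{x}_j,\mathbf{x}_k\rangle : 1\le j<k\le n\big)\subseteq S,\qquad X(d,n)=\mathrm{Spec}(S/I(d,n)).$$ A scheme is generically reduced if it has a dense open subset on which it is reduced; for $X(d,n)$ this is equivalent to Serre's property $R_0$ for the ring $S/I(d,n)$. *)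

theory Defs
  imports
    "HOL-Library.Poly_Mapping"
    "HOL-Algebra.QuotRing"
    "HOL-Analysis.Abstract_Topology"
    "Jordan_Normal_Form.Matrix"
begin

section \<open>Bilinear forms on coordinate spaces\<close>

definition bilinear_form_on :: "nat \<Rightarrow> ('k::field vec \<Rightarrow> 'k vec \<Rightarrow> 'k) \<Rightarrow> bool" where
  "bilinear_form_on d B \<longleftrightarrow>
     (\<forall>u \<in> carrier_vec d. \<forall>v \<in> carrier_vec d. \<forall>w \<in> carrier_vec d. \<forall>c.
        B (u + v) w = B u w + B v w \<and> B (c \<cdot>\<^sub>v u) w = c * B u w \<and>
        B w (u + v) = B w u + B w v \<and> B w (c \<cdot>\<^sub>v u) = c * B w u)"

definition symmetric_form_on :: "nat \<Rightarrow> ('k::field vec \<Rightarrow> 'k vec \<Rightarrow> 'k) \<Rightarrow> bool" where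
  "symmetric_form_on d B \<longleftrightarrow> (\<forall>u \<in> carrier_vec d. \<forall>v \<in> carrier_vec d. B u v = B v u)"

definition nondegenerate_form_on :: "nat \<Rightarrow> ('k::field vec \<Rightarrow> 'k vec \<Rightarrow> 'k) \<Rightarrow> bool" where
  "nondegenerate_form_on d B \<longleftrightarrow>
     (\<forall>u \<in> carrier_vec d. (\<forall>v \<in> carrier_vec d. B u v = 0) \<longrightarrow> u = 0\<^sub>v d) \<and>
     (\<forall>v \<in> carrier_vec d. (\<forall>u \<in> carrier_vec d. B u v = 0) \<longrightarrow> v = 0\<^sub>v d)"


section \<open>Polynomial rings\<close>

text \<open>Monomials are finitely supported exponent functions, polynomials are finitely supported
  coefficient functions on monomials; addition and multiplication are those of
  \<^theory>\<open>HOL-Library.Poly_Mapping\<close>.\<close>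

type_synonym ('v, 'k) mpoly = "('v \<Rightarrow>\<^sub>0 nat) \<Rightarrow>\<^sub>0 'k"

definition mpoly_const :: "'k::zero \<Rightarrow> ('v, 'k) mpoly" where
  "mpoly_const c = Poly_Mapping.single 0 c"

definition mpoly_var :: "'v \<Rightarrow> ('v, 'k::zero_neq_one) mpoly" where
  "mpoly_var v = Poly_Mapping.single (Poly_Mapping.single v 1) 1"

text \<open>\<open>mpoly_ring V\<close> is the subring of polynomials involving only variables from \<open>V\<close>.\<close>

definition mpoly_ring :: "'v set \<Rightarrow> ('v, 'k::comm_ring_1) mpoly ring" where
  "mpoly_ring V = \<lparr>carrier = {p. \<forall>m \<in> Poly_Mapping.keys p. Poly_Mapping.keys m \<subseteq> V},
     monoid.mult = (*), one = 1, zero = 0, add = (+)\<rparr>"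

lemma cring_mpoly_ring: "cring (mpoly_ring V :: ('v, 'k::comm_ring_1) mpoly ring)"
proof -
  let ?C = "{p :: ('v, 'k) mpoly. \<forall>m \<in> Poly_Mapping.keys p. Poly_Mapping.keys m \<subseteq> V}"
  have add: "p + q \<in> ?C" if "p \<in> ?C" "q \<in> ?C" for p q
    using that Poly_Mapping.keys_add[of p q] by (simp only: mem_Collect_eq) blast
  have neg: "- p \<in> ?C" if "p \<in> ?C" for p
    using that by simp
  have mult: "p * q \<in> ?C" if p: "p \<in> ?C" and q: "q \<in> ?C" for p q
  proof (simp only: mem_Collect_eq, intro ballI)
    fix m assume "m \<in> Poly_Mapping.keys (p * q)"
    then have "m \<in> {a + b | a b. a \<in> Poly_Mapping.keys p \<and> b \<in> Poly_Mapping.keys q}"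
      by (rule subsetD[OF Poly_Mapping.keys_mult])
    then obtain a b where ab: "a \<in> Poly_Mapping.keys p" "b \<in> Poly_Mapping.keys q" "m = a + b"
      by (simp only: mem_Collect_eq) (elim exE conjE, rule that)
    have "Poly_Mapping.keys a \<subseteq> V" "Poly_Mapping.keys b \<subseteq> V"
      using p q ab(1,2) by (simp_all only: mem_Collect_eq)
    then show "Poly_Mapping.keys m \<subseteq> V"
      using Poly_Mapping.keys_add[of a b] unfolding ab(3) by (meson le_sup_iff order_trans Un_least)
  qed
  have zero: "0 \<in> ?C" and one: "1 \<in> ?C" by simp_all
  show ?thesis
  proof (rule cringI)
    show "abelian_group (mpoly_ring V :: ('v, 'k) mpoly ring)"
      unfolding mpoly_ring_def
    proof (rule abelian_groupI, unfold ring.simps partial_object.simps monoid.simps)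
      show "\<exists>q\<in>?C. q + p = 0" if "p \<in> ?C" for p
        by (rule bexI[OF _ neg[OF that]]) (rule left_minus)
    qed (fact add zero | rule add.assoc add.commute add_0_left)+
    show "Group.comm_monoid (mpoly_ring V :: ('v, 'k) mpoly ring)"
      unfolding mpoly_ring_def
      by (rule comm_monoidI, unfold ring.simps partial_object.simps monoid.simps)
        (fact mult one | rule mult.assoc mult.commute mult_1_left)+
    show "(x \<oplus>\<^bsub>mpoly_ring V\<^esub> y) \<otimes>\<^bsub>mpoly_ring V\<^esub> z
        = x \<otimes>\<^bsub>mpoly_ring V\<^esub> z \<oplus>\<^bsub>mpoly_ring V\<^esub> y \<otimes>\<^bsub>mpoly_ring V\<^esub> z"
      for x y z :: "('v, 'k) mpoly"
      by (simp add: mpoly_ring_def distrib_right)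
  qed
qed


section \<open>Affine schemes\<close>

subsection \<open>Localization\<close>

text \<open>The fraction \<open>a/s\<close>, as the class of pairs \<open>(b, t)\<close> with \<open>u (a t - b s) = 0\<close> for some
  \<open>u\<close> in \<open>M\<close>.\<close>

definition fraction :: "('a, 'b) ring_scheme \<Rightarrow> 'a set \<Rightarrow> 'a \<Rightarrow> 'a \<Rightarrow> ('a \<times> 'a) set" where
  "fraction R M a s = {(b, t). b \<in> carrier R \<and> t \<in> M \<and>
     (\<exists>u \<in> M. u \<otimes>\<^bsub>R\<^esub> ((a \<otimes>\<^bsub>R\<^esub> t) \<ominus>\<^bsub>R\<^esub> (b \<otimes>\<^bsub>R\<^esub> s)) = \<zero>\<^bsub>R\<^esub>)}"

text \<open>The ring of fractions of a commutative ring \<open>R\<close>, for a submonoid \<open>M\<close> of its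
  multiplicative monoid.\<close>

definition localization :: "('a, 'b) ring_scheme \<Rightarrow> 'a set \<Rightarrow> ('a \<times> 'a) set ring" where
  "localization R M = \<lparr>
     carrier = {fraction R M a s | a s. a \<in> carrier R \<and> s \<in> M},
     monoid.mult = (\<lambda>X Y. \<Union>(a, s) \<in> X. \<Union>(b, t) \<in> Y. fraction R M (a \<otimes>\<^bsub>R\<^esub> b) (s \<otimes>\<^bsub>R\<^esub> t)),
     one = fraction R M \<one>\<^bsub>R\<^esub> \<one>\<^bsub>R\<^esub>,
     zero = fraction R M \<zero>\<^bsub>R\<^esub> \<one>\<^bsub>R\<^esub>,
     add = (\<lambda>X Y. \<Union>(a, s) \<in> X. \<Union>(b, t) \<in> Y.
       fraction R M ((a \<otimes>\<^bsub>R\<^esub> t) \<oplus>\<^bsub>R\<^esub> (b \<otimes>\<^bsub>R\<^esub> s)) (s \<otimes>\<^bsub>R\<^esub> t))\<rparr>"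

subsection \<open>The Zariski topology on the prime spectrum\<close>

definition Spec :: "('a, 'b) ring_scheme \<Rightarrow> 'a set set" where
  "Spec R = {P. primeideal P R}"

definition vanishing_locus :: "('a, 'b) ring_scheme \<Rightarrow> 'a set \<Rightarrow> 'a set set" where
  "vanishing_locus R E = {P \<in> Spec R. E \<subseteq> P}"

definition zariski :: "('a, 'b) ring_scheme \<Rightarrow> 'a set topology" where
  "zariski R = topology (\<lambda>U. \<exists>E \<subseteq> carrier R. U = Spec R - vanishing_locus R E)"

lemma openin_zariski:
  "openin (zariski R) U \<longleftrightarrow> (\<exists>E \<subseteq> carrier R. U = Spec R - vanishing_locus R E)"
proof -
  have "istopology (\<lambda>U. \<exists>E \<subseteq> carrier R. U = Spec R - vanishing_locus R E)"
    unfolding istopology_def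
  proof (intro conjI allI impI)
    fix S T
    assume "\<exists>E \<subseteq> carrier R. S = Spec R - vanishing_locus R E"
      and "\<exists>E \<subseteq> carrier R. T = Spec R - vanishing_locus R E"
    then obtain E F where E: "E \<subseteq> carrier R" "S = Spec R - vanishing_locus R E"
      and F: "F \<subseteq> carrier R" "T = Spec R - vanishing_locus R F" by blast
    show "\<exists>G \<subseteq> carrier R. S \<inter> T = Spec R - vanishing_locus R G"
    proof (cases "Spec R = {}")
      case True
      then show ?thesis using E F by auto
    next
      case False
      then obtain P0 where P0: "primeideal P0 R" by (auto simp: Spec_def)
      interpret P0: primeideal P0 R by (fact P0)
      let ?G = "{e \<otimes>\<^bsub>R\<^esub> f | e f. e \<in> E \<and> f \<in> F}"
      have mem: "?G \<subseteq> P \<longleftrightarrow> E \<subseteq> P \<or> F \<subseteq> P" if P: "primeideal P R" for P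
      proof -
        interpret P: primeideal P R by (fact P)
        show ?thesis
        proof
          assume G: "?G \<subseteq> P"
          show "E \<subseteq> P \<or> F \<subseteq> P"
          proof (rule ccontr)
            assume "\<not> (E \<subseteq> P \<or> F \<subseteq> P)"
            then obtain e f where ef: "e \<in> E" "e \<notin> P" "f \<in> F" "f \<notin> P" by blast
            then have "e \<otimes>\<^bsub>R\<^esub> f \<in> P" using G by blast
            then show False using P.I_prime[of e f] ef E F by blast
          qed
        next
          assume "E \<subseteq> P \<or> F \<subseteq> P"
          then show "?G \<subseteq> P" using E F P.I_l_closed P.I_r_closed by blast
        qed
      qed
      have "?G \<subseteq> carrier R" using E F by auto
      moreover have "S \<inter> T = Spec R - vanishing_locus R ?G"
        using mem unfolding E(2) F(2) vanishing_locus_def Spec_def by blast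
      ultimately show ?thesis by blast
    qed
  next
    fix \<U>
    assume "\<forall>U \<in> \<U>. \<exists>E \<subseteq> carrier R. U = Spec R - vanishing_locus R E"
    then obtain f where f: "\<And>U. U \<in> \<U> \<Longrightarrow> f U \<subseteq> carrier R"
      "\<And>U. U \<in> \<U> \<Longrightarrow> U = Spec R - vanishing_locus R (f U)" by metis
    have "\<Union>\<U> = (\<Union>U\<in>\<U>. Spec R - vanishing_locus R (f U))" using f(2) by auto
    also have "\<dots> = Spec R - vanishing_locus R (\<Union>U\<in>\<U>. f U)"
      unfolding vanishing_locus_def by blast
    finally show "\<exists>E \<subseteq> carrier R. \<Union>\<U> = Spec R - vanishing_locus R E"
      using f(1) by (intro exI[of _ "\<Union>U\<in>\<U>. f U"]) blast
  qed
  then show ?thesis by (simp add: zariski_def)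
qed

lemma topspace_zariski: "topspace (zariski R) = Spec R"
proof -
  have "openin (zariski R) (Spec R)"
  proof (cases "Spec R = {}")
    case True
    then show ?thesis unfolding openin_zariski by auto
  next
    case False
    then obtain P0 where P0: "primeideal P0 R" by (auto simp: Spec_def)
    interpret P0: primeideal P0 R by (fact P0)
    have "\<one>\<^bsub>R\<^esub> \<notin> P" if "primeideal P R" for P
      using that ideal.one_imp_carrier[OF primeideal.axioms(1)[OF that]]
      primeideal.I_notcarr[OF that] by auto
    then have "Spec R = Spec R - vanishing_locus R {\<one>\<^bsub>R\<^esub>}"
      by (auto simp: vanishing_locus_def Spec_def)
    then show ?thesis unfolding openin_zariski by blast
  qed
  moreover have "topspace (zariski R) \<subseteq> Spec R"
    using openin_topspace[of "zariski R"] unfolding openin_zariski by blast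
  ultimately show ?thesis by (blast dest: openin_subset)
qed

subsection \<open>Reducedness\<close>

definition reduced_ring :: "('a, 'b) ring_scheme \<Rightarrow> bool" where
  "reduced_ring R \<longleftrightarrow>
     (\<forall>x \<in> carrier R. \<forall>k::nat. x [^]\<^bsub>R\<^esub> k = \<zero>\<^bsub>R\<^esub> \<longrightarrow> x = \<zero>\<^bsub>R\<^esub>)"

text \<open>The stalk of the structure sheaf of \<open>Spec R\<close> at the point \<open>P\<close>.\<close>

definition Spec_stalk :: "('a, 'b) ring_scheme \<Rightarrow> 'a set \<Rightarrow> ('a \<times> 'a) set ring" where
  "Spec_stalk R P = localization R (carrier R - P)"

text \<open>A scheme is reduced if all its local rings are; for an open subscheme \<open>U\<close> these are the
  stalks at the points of \<open>U\<close>.\<close>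

definition Spec_reduced_on :: "('a, 'b) ring_scheme \<Rightarrow> 'a set set \<Rightarrow> bool" where
  "Spec_reduced_on R U \<longleftrightarrow> (\<forall>P \<in> U. reduced_ring (Spec_stalk R P))"

definition Spec_generically_reduced :: "('a, 'b) ring_scheme \<Rightarrow> bool" where
  "Spec_generically_reduced R \<longleftrightarrow>
     (\<exists>U. openin (zariski R) U \<and> Abstract_Topology.closure_of (zariski R) U = topspace (zariski R) \<and>
       Spec_reduced_on R U)"


section \<open>The scheme of pairwise orthogonal vectors\<close>

text \<open>Rows and columns are indexed from 0.\<close>

definition orth_poly_ring :: "nat \<Rightarrow> nat \<Rightarrow> (nat \<times> nat, 'k::field) mpoly ring" where
  "orth_poly_ring d n = mpoly_ring ({..<d} \<times> {..<n})"

definition generic_matrix :: "nat \<Rightarrow> nat \<Rightarrow> (nat \<times> nat, 'k::field) mpoly mat" where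
  "generic_matrix d n = mat d n mpoly_var"

text \<open>The extension of \<open>B\<close> by bilinearity to vectors of polynomials.\<close>

definition extend_form ::
  "nat \<Rightarrow> ('k::field vec \<Rightarrow> 'k vec \<Rightarrow> 'k) \<Rightarrow> ('v, 'k) mpoly vec \<Rightarrow> ('v, 'k) mpoly vec \<Rightarrow> ('v, 'k) mpoly"
  where
  "extend_form d B u v =
     (\<Sum>i<d. \<Sum>j<d. mpoly_const (B (unit_vec d i) (unit_vec d j)) * (u $ i) * (v $ j))"

definition orth_ideal ::
  "nat \<Rightarrow> nat \<Rightarrow> ('k::field vec \<Rightarrow> 'k vec \<Rightarrow> 'k) \<Rightarrow> (nat \<times> nat, 'k) mpoly set" where
  "orth_ideal d n B = Idl\<^bsub>orth_poly_ring d n\<^esub>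
     {extend_form d B (col (generic_matrix d n) j) (col (generic_matrix d n) k) | j k. j < k \<and> k < n}"

definition orth_coordinate_ring ::
  "nat \<Rightarrow> nat \<Rightarrow> ('k::field vec \<Rightarrow> 'k vec \<Rightarrow> 'k) \<Rightarrow> (nat \<times> nat, 'k) mpoly set ring" where
  "orth_coordinate_ring d n B = orth_poly_ring d n Quot orth_ideal d n B"

end

theory Submission
  imports Defs "HOL-Library.Product_Lexorder" "HOL-Computational_Algebra.Polynomial"
    "HOL-Computational_Algebra.Fraction_Field"
begin

text \<open>It suffices to find, for every minimal prime, a neighbourhood on which all stalks are reduced.
  At the generic point of a component, let \<open>JN\<close> index the non-isotropic columns; the other columns
  span a totally isotropic space, with a basis indexed by \<open>JB\<close> and the remaining columns, indexed by
  \<open>JD\<close>, depending on it with coefficients \<open>c j i\<close>. Minimality of the prime forbids deformations that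
  make an isotropic column non-isotropic. Hence the isotropic columns span a Lagrangian subspace of
  the orthogonal complement of the columns in \<open>JN\<close>, and the vectors of products \<open>c j i * c k i\<close>,
  for distinct \<open>j\<close> and \<open>k\<close> in \<open>JD\<close>, span the space of all vectors indexed by \<open>i \<in> JB\<close>. By
  Nakayama's lemma the columns in \<open>JB\<close> are then isotropic, and those in \<open>JD\<close> depend on them, as
  identities on a whole Zariski neighbourhood. At every point of this neighbourhood, after extension
  of the scalars to the residue field, the scheme is locally a retract of an affine space, hence
  reduced; reducedness descends along the extension of scalars.\<close>

section \<open>Symmetric bilinear forms given by Gram matrices\<close>

text \<open>A retract of an affine space is reduced for a direct reason: a homomorphism from the
  polynomials to a field that kills the relations and agrees with the inclusion modulo them sends a
  nilpotent class to zero, so that class was zero already. Building it requires vectors that are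
  exactly orthogonal in the local ring of the affine space, obtained by correcting the coordinate
  vectors along a dual system. This dual system has to be isotropic on the nose and not only modulo
  the relations. Over the ground field it need not exist (the form may be anisotropic there); over
  the residue field of the point it can be taken with constant coefficients, which is why scalars
  are extended. The ban on deformations comes from lines: a line through the generic point that
  stays in the scheme defines a prime inside the minimal one, hence equal to it, so whatever
  vanishes at the point vanishes on the line. Characteristic different from 2 enters through
  polarization and through halving Gram matrices.\<close>

definition bform :: "nat \<Rightarrow> (nat \<Rightarrow> nat \<Rightarrow> 'a::comm_ring_1) \<Rightarrow> (nat \<Rightarrow> 'a) \<Rightarrow> (nat \<Rightarrow> 'a) \<Rightarrow> 'a" where
  "bform d \<beta> u v = (\<Sum>i<d. \<Sum>j<d. \<beta> i j * u i * v j)"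

lemma bform_add_left: "bform d \<beta> (\<lambda>i. u i + v i) w = bform d \<beta> u w + bform d \<beta> v w"
  by (simp add: bform_def algebra_simps sum.distrib)

lemma bform_add_right: "bform d \<beta> w (\<lambda>i. u i + v i) = bform d \<beta> w u + bform d \<beta> w v"
  by (simp add: bform_def algebra_simps sum.distrib)

lemma bform_diff_left: "bform d \<beta> (\<lambda>i. u i - v i) w = bform d \<beta> u w - bform d \<beta> v w"
  by (simp add: bform_def algebra_simps sum_subtractf)

lemma bform_diff_right: "bform d \<beta> w (\<lambda>i. u i - v i) = bform d \<beta> w u - bform d \<beta> w v"
  by (simp add: bform_def algebra_simps sum_subtractf)

lemma bform_scale_left: "bform d \<beta> (\<lambda>i. c * u i) w = c * bform d \<beta> u w"
  by (simp add: bform_def algebra_simps sum_distrib_left)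

lemma bform_scale_right: "bform d \<beta> w (\<lambda>i. c * u i) = c * bform d \<beta> w u"
  by (simp add: bform_def algebra_simps sum_distrib_left)

lemma bform_scale_left': "bform d \<beta> (\<lambda>i. u i * c) w = bform d \<beta> u w * c"
  by (simp add: bform_def algebra_simps sum_distrib_left)

lemma bform_scale_right': "bform d \<beta> w (\<lambda>i. u i * c) = bform d \<beta> w u * c"
  by (simp add: bform_def algebra_simps sum_distrib_left)

lemma bform_zero_left: "bform d \<beta> (\<lambda>i. 0) w = 0"
  by (simp add: bform_def)

lemma bform_zero_right: "bform d \<beta> w (\<lambda>i. 0) = 0"
  by (simp add: bform_def)

lemma bform_sum_left: "bform d \<beta> (\<lambda>i. \<Sum>l\<in>T. f l i) w = (\<Sum>l\<in>T. bform d \<beta> (f l) w)"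
  by (induction T rule: infinite_finite_induct) (simp_all add: bform_zero_left bform_add_left)

lemma bform_sum_right: "bform d \<beta> w (\<lambda>i. \<Sum>l\<in>T. f l i) = (\<Sum>l\<in>T. bform d \<beta> w (f l))"
  by (induction T rule: infinite_finite_induct) (simp_all add: bform_zero_right bform_add_right)

lemmas bform_linear = bform_add_left bform_add_right bform_diff_left bform_diff_right
  bform_scale_left bform_scale_right bform_scale_left' bform_scale_right'
  bform_sum_left bform_sum_right bform_zero_left bform_zero_right

text \<open>Vectors are total functions of which only the values below \<open>d\<close> matter; the
  linearity rules then need no carrier conditions, and this rule forgets the irrelevant
  values.\<close>

lemma bform_cong:
  assumes "\<And>i. i < d \<Longrightarrow> u i = u' i" "\<And>i. i < d \<Longrightarrow> v i = v' i"
  shows "bform d \<beta> u v = bform d \<beta> u' v'"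
  using assms by (simp add: bform_def)

text \<open>Nondegeneracy is recorded by a right inverse \<open>\<gamma>\<close> of the Gram matrix.
  As an equation it survives every ring homomorphism, so it passes to residue fields and to scalar
  extensions.\<close>

locale sym_form =
  fixes d :: nat and \<beta> \<gamma> :: "nat \<Rightarrow> nat \<Rightarrow> 'a::comm_ring_1"
  assumes sym: "i < d \<Longrightarrow> j < d \<Longrightarrow> \<beta> i j = \<beta> j i"
    and inverse: "i < d \<Longrightarrow> l < d \<Longrightarrow> (\<Sum>j<d. \<beta> i j * \<gamma> j l) = (if i = l then 1 else 0)"
begin

abbreviation b where "b \<equiv> bform d \<beta>"

lemma b_commute: "b u v = b v u"
  unfolding bform_def
  by (subst sum.swap) (auto intro!: sum.cong simp: sym algebra_simps)

text \<open>The columns of \<open>\<gamma>\<close> form the basis dual to the unit vectors. This is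
  how nondegeneracy is used: a vector orthogonal to everything vanishes, and a nonzero coordinate
  gives a nonzero pairing.\<close>

lemma b_dual_basis:
  assumes "l < d"
  shows "b u (\<lambda>j. \<gamma> j l) = u l"
proof -
  have "b u (\<lambda>j. \<gamma> j l) = (\<Sum>i<d. u i * (\<Sum>j<d. \<beta> i j * \<gamma> j l))"
    by (simp add: bform_def sum_distrib_left algebra_simps)
  also have "\<dots> = (\<Sum>i<d. u i * (if i = l then 1 else 0))"
    using assms by (intro sum.cong) (simp_all add: inverse)
  also have "\<dots> = u l"
    using assms by (simp add: if_distrib sum.delta cong: if_cong)
  finally show ?thesis .
qed

end

section \<open>Linear algebra over a field\<close>

lemma mult_delta_left: "(if P then x else 0) * c = (if P then x * c else (0::'a::mult_zero))"
  and mult_delta_right: "c * (if P then x else 0) = (if P then c * x else (0::'a::mult_zero))"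
  by simp_all

text \<open>Duality for a subspace \<open>M\<close>, by induction on \<open>T\<close> instead of
  dimension counting. If unit vectors for \<open>T\<close> are found but none for the new index
  \<open>a\<close>, then on \<open>M\<close> the coordinate \<open>a\<close> is a fixed combination
  of the others, and this combination is a nonzero functional that annihilates
  \<open>M\<close>.\<close>

lemma unit_vectors_in_span:
  fixes M :: "('i \<Rightarrow> 'a::field) set"
  assumes "finite T"
    and add: "\<And>u v. u \<in> M \<Longrightarrow> v \<in> M \<Longrightarrow> (\<lambda>i. u i + v i) \<in> M"
    and scale: "\<And>c u. u \<in> M \<Longrightarrow> (\<lambda>i. c * u i) \<in> M"
    and zero: "(\<lambda>i. 0) \<in> M"
    and ann: "\<And>h. (\<forall>u\<in>M. (\<Sum>i\<in>T. h i * u i) = 0) \<Longrightarrow> \<forall>i\<in>T. h i = 0"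
  shows "\<forall>i\<in>T. \<exists>u\<in>M. \<forall>l\<in>T. u l = (if l = i then 1 else 0)"
  using assms(1) ann
proof (induction T rule: finite_induct)
  case empty
  then show ?case by simp
next
  case (insert a T)
  have sum: "(\<lambda>i. \<Sum>l\<in>A. f l i) \<in> M" if "\<And>l. l \<in> A \<Longrightarrow> f l \<in> M" for A and f :: "'i \<Rightarrow> 'i \<Rightarrow> 'a"
    using that by (induction A rule: infinite_finite_induct) (auto simp: zero intro!: add)
  have "\<forall>i\<in>T. \<exists>u\<in>M. \<forall>l\<in>T. u l = (if l = i then 1 else 0)"
  proof (rule insert.IH)
    fix h assume h: "\<forall>u\<in>M. (\<Sum>i\<in>T. h i * u i) = 0"
    define h' where "h' = h(a := 0)"
    have "(\<Sum>i\<in>insert a T. h' i * u i) = (\<Sum>i\<in>T. h i * u i)" for u :: "'i \<Rightarrow> 'a"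
      using insert.hyps by (auto simp: h'_def intro!: sum.cong)
    with h have "\<forall>i\<in>insert a T. h' i = 0" by (intro insert.prems) simp
    then show "\<forall>i\<in>T. h i = 0" using insert.hyps by (auto simp: h'_def split: if_splits)
  qed
  then obtain e where e: "\<And>i. i \<in> T \<Longrightarrow> e i \<in> M"
    "\<And>i l. i \<in> T \<Longrightarrow> l \<in> T \<Longrightarrow> e i l = (if l = i then 1 else 0)" by metis
  \<comment> \<open>Gaussian elimination: \<open>r u\<close> clears the coordinates of
    \<open>u\<close> in \<open>T\<close>, so only its value at \<open>a\<close> is left to
    examine.\<close>
  define r where "r = (\<lambda>u l. u l + (- 1) * (\<Sum>i\<in>T. u i * e i l))"
  have rM: "r u \<in> M" if "u \<in> M" for u
    unfolding r_def by (intro add scale sum that e(1))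
  have rT: "r u l = 0" if "l \<in> T" for u l
    using that insert.hyps by (simp add: r_def e(2) if_distrib sum.delta cong: if_cong)
  have "\<exists>u\<in>M. r u a \<noteq> 0"
  proof (rule ccontr)
    assume "\<not> ?thesis"
    then have 0: "u a = (\<Sum>i\<in>T. u i * e i a)" if "u \<in> M" for u using that by (simp add: r_def)
    define h where "h = (\<lambda>i. if i = a then 1 else - e i a)"
    have "(\<Sum>i\<in>insert a T. h i * u i) = 0" if "u \<in> M" for u
    proof -
      have "(\<Sum>i\<in>insert a T. h i * u i) = u a + (\<Sum>i\<in>T. h i * u i)"
        using insert.hyps by (simp add: h_def)
      also have "(\<Sum>i\<in>T. h i * u i) = - (\<Sum>i\<in>T. u i * e i a)"
        using insert.hyps by (auto simp: h_def sum_negf[symmetric] intro!: sum.cong)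
      finally show ?thesis using 0[OF that] by simp
    qed
    then have "\<forall>i\<in>insert a T. h i = 0" by (intro insert.prems) simp
    then show False by (simp add: h_def)
  qed
  then obtain u0 where u0: "u0 \<in> M" "r u0 a \<noteq> 0" by blast
  define w where "w = (\<lambda>l. inverse (r u0 a) * r u0 l)"
  have w: "w \<in> M" "w a = 1" "\<And>l. l \<in> T \<Longrightarrow> w l = 0"
    using u0 by (auto simp: w_def rT intro: scale rM)
  show ?case
  proof
    fix i assume i: "i \<in> insert a T"
    show "\<exists>u\<in>M. \<forall>l\<in>insert a T. u l = (if l = i then 1 else 0)"
    proof (cases "i = a")
      case True
      then show ?thesis using w insert.hyps by (intro bexI[of _ w]) auto
    next
      case False
      with i have "i \<in> T" by simp
      then have "(\<lambda>l. e i l + (- e i a) * w l) \<in> M"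
        using w e by (intro add scale) auto
      then show ?thesis
        by (rule rev_bexI) (use \<open>i \<in> T\<close> w e False in auto)
    qed
  qed
qed

text \<open>Independent rows force the column space, here \<open>range f\<close>, to contain every
  unit vector; \<open>P l\<close> is a preimage of the unit vector \<open>l\<close>. Hence
  \<open>P\<close> is the transpose of the usual right inverse.\<close>

lemma matrix_right_inverse:
  fixes N :: "'i \<Rightarrow> 'j \<Rightarrow> 'a::field"
  assumes "finite T" "finite S"
    and ann: "\<And>h. (\<And>k. k \<in> S \<Longrightarrow> (\<Sum>i\<in>T. h i * N i k) = 0) \<Longrightarrow> \<forall>i\<in>T. h i = 0"
  shows "\<exists>P. \<forall>l\<in>T. \<forall>i\<in>T. (\<Sum>k\<in>S. N i k * P l k) = (if i = l then 1 else 0)"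
proof -
  define f where "f = (\<lambda>p i. \<Sum>k\<in>S. N i k * p k)"
  have "\<forall>l\<in>T. \<exists>u\<in>range f. \<forall>i\<in>T. u i = (if i = l then 1 else 0)"
  proof (rule unit_vectors_in_span[OF assms(1)])
    fix u v assume "u \<in> range f" "v \<in> range f"
    then obtain p q where "u = f p" "v = f q" by blast
    then have "(\<lambda>i. u i + v i) = f (\<lambda>k. p k + q k)"
      by (simp add: f_def distrib_left sum.distrib)
    then show "(\<lambda>i. u i + v i) \<in> range f" by simp
  next
    fix c u assume "u \<in> range f"
    then obtain p where "u = f p" by blast
    then have "(\<lambda>i. c * u i) = f (\<lambda>k. c * p k)"
      by (simp add: f_def sum_distrib_left mult_ac)
    then show "(\<lambda>i. c * u i) \<in> range f" by simp
  next
    have "(\<lambda>i. 0) = f (\<lambda>k. 0)" by (simp add: f_def)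
    then show "(\<lambda>i. 0) \<in> range f" by simp
  next
    fix h assume h: "\<forall>u\<in>range f. (\<Sum>i\<in>T. h i * u i) = 0"
    have "(\<Sum>i\<in>T. h i * N i l) = 0" if "l \<in> S" for l
    proof -
      have "(\<Sum>i\<in>T. h i * f (\<lambda>k. if k = l then 1 else 0) i) = 0" using h by blast
      then show ?thesis using that assms(2) by (simp add: f_def mult_delta_right sum.delta)
    qed
    then show "\<forall>i\<in>T. h i = 0" by (rule ann)
  qed
  then have "\<forall>l\<in>T. \<exists>p. \<forall>i\<in>T. (\<Sum>k\<in>S. N i k * p k) = (if i = l then 1 else 0)"
    by (auto simp: f_def)
  then show ?thesis by (rule bchoice)
qed

context
  fixes d :: nat and \<beta> \<gamma> :: "nat \<Rightarrow> nat \<Rightarrow> 'a::field"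
  assumes form: "sym_form d \<beta> \<gamma>"
begin

interpretation sym_form d \<beta> \<gamma> by (fact form)

text \<open>The vector \<open>u\<close> measures how far \<open>y a\<close> is from the combination
  predicted by the dual system. Its coordinate \<open>i0\<close> is nonzero, so it pairs
  nontrivially with column \<open>i0\<close> of \<open>\<gamma>\<close>; made orthogonal to the
  \<open>y i\<close> and rescaled, that column becomes the new dual vector.\<close>

lemma dual_system_insert:
  assumes T: "finite T" "a \<notin> T"
    and z: "\<And>i l. i \<in> T \<Longrightarrow> l \<in> T \<Longrightarrow> b (y i) (z l) = (if i = l then 1 else 0)"
    and ne: "i0 < d" "y a i0 \<noteq> (\<Sum>l\<in>T. b (y a) (z l) * y l i0)"
  shows "\<exists>z'. \<forall>i\<in>insert a T. \<forall>l\<in>insert a T. b (y i) (z' l) = (if i = l then 1 else 0)"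
proof -
  define u where "u = (\<lambda>i. y a i - (\<Sum>l\<in>T. b (y a) (z l) * y l i))"
  define w where "w = (\<lambda>j. \<gamma> j i0)"
  have uw: "b u w \<noteq> 0"
    unfolding w_def b_dual_basis[OF ne(1)] using ne(2) by (simp add: u_def)
  define w' where "w' = (\<lambda>j. w j - (\<Sum>l\<in>T. b (y l) w * z l j))"
  have yw: "b (y i) w' = 0" if "i \<in> T" for i
    using that T by (simp add: w'_def bform_linear z if_distrib sum.delta cong: if_cong)
  have aw: "b (y a) w' = b u w"
    by (simp add: w'_def u_def bform_linear mult.commute)
  define za where "za = (\<lambda>j. inverse (b u w) * w' j)"
  define z' where "z' = (\<lambda>l. if l = a then za else (\<lambda>j. z l j - b (y a) (z l) * za j))"
  have za: "b (y a) za = 1" "\<And>i. i \<in> T \<Longrightarrow> b (y i) za = 0"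
    using uw by (simp_all add: za_def bform_linear aw yw)
  have "b (y i) (z' l) = (if i = l then 1 else 0)" if "i \<in> insert a T" "l \<in> insert a T" for i l
  proof (cases "l = a")
    case True
    then show ?thesis using that za T by (auto simp: z'_def)
  next
    case False
    then show ?thesis using that za T z by (auto simp: z'_def bform_linear)
  qed
  then show ?thesis by blast
qed

end

section \<open>Local subrings of a field\<close>

text \<open>A local ring as a subset of a field. By \<open>inverse_closed\<close> the elements with
  nonzero residue are units, so the maximal ideal consists of the elements of \<open>A\<close> with
  residue zero. Outside \<open>A\<close> nothing is said about \<open>res\<close>.\<close>

locale local_subring =
  fixes A :: "'f::field set" and res :: "'f \<Rightarrow> 'l::field"
  assumes one_closed: "1 \<in> A"
    and add_closed: "x \<in> A \<Longrightarrow> y \<in> A \<Longrightarrow> x + y \<in> A"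
    and mult_closed: "x \<in> A \<Longrightarrow> y \<in> A \<Longrightarrow> x * y \<in> A"
    and uminus_closed: "x \<in> A \<Longrightarrow> - x \<in> A"
    and inverse_closed: "x \<in> A \<Longrightarrow> res x \<noteq> 0 \<Longrightarrow> inverse x \<in> A"
    and res_one: "res 1 = 1"
    and res_add: "x \<in> A \<Longrightarrow> y \<in> A \<Longrightarrow> res (x + y) = res x + res y"
    and res_mult: "x \<in> A \<Longrightarrow> y \<in> A \<Longrightarrow> res (x * y) = res x * res y"
begin

lemma zero_closed: "0 \<in> A"
  using add_closed[OF one_closed uminus_closed[OF one_closed]] by simp

lemma diff_closed: "x \<in> A \<Longrightarrow> y \<in> A \<Longrightarrow> x - y \<in> A"
  using add_closed[of x "- y"] uminus_closed[of y] by simp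

lemma sum_closed: "(\<And>i. i \<in> I \<Longrightarrow> f i \<in> A) \<Longrightarrow> sum f I \<in> A"
  by (induction I rule: infinite_finite_induct) (auto simp: zero_closed add_closed)

lemma res_zero: "res 0 = 0"
  using res_add[OF zero_closed zero_closed] by (metis add_cancel_right_right add_0_right)

lemma res_uminus: "x \<in> A \<Longrightarrow> res (- x) = - res x"
  using res_add[of x "- x"] uminus_closed[of x] by (simp add: res_zero add_eq_0_iff)

lemma res_diff: "x \<in> A \<Longrightarrow> y \<in> A \<Longrightarrow> res (x - y) = res x - res y"
  using res_add[of x "- y"] uminus_closed[of y] by (simp add: res_uminus)

lemma res_sum: "(\<And>i. i \<in> I \<Longrightarrow> f i \<in> A) \<Longrightarrow> res (sum f I) = (\<Sum>i\<in>I. res (f i))"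
  by (induction I rule: infinite_finite_induct) (auto simp: res_zero res_add sum_closed)

lemma res_inverse:
  assumes "x \<in> A" "res x \<noteq> 0"
  shows "res (inverse x) = inverse (res x)"
proof -
  have "x \<noteq> 0" using assms(2) res_zero by auto
  then have "res x * res (inverse x) = 1"
    using assms by (simp flip: res_mult add: inverse_closed res_one)
  then show ?thesis using assms(2) by (simp add: field_simps)
qed

lemmas closed = zero_closed one_closed add_closed mult_closed uminus_closed diff_closed sum_closed
lemmas res_simps = res_zero res_one res_add res_mult res_uminus res_diff res_sum

text \<open>Submodules of the whole field and not only ideals inside \<open>A\<close>: Nakayama's
  lemma is also applied with \<open>{0}\<close> and with \<open>A\<close> itself, to elements not
  yet known to lie in \<open>A\<close>.\<close>

definition submodule :: "'f set \<Rightarrow> bool" where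
  "submodule K \<longleftrightarrow> 0 \<in> K \<and> (\<forall>x\<in>K. \<forall>y\<in>K. x + y \<in> K) \<and> (\<forall>a\<in>A. \<forall>x\<in>K. a * x \<in> K)"

lemma submodule_zero: "submodule K \<Longrightarrow> 0 \<in> K"
  and submodule_add: "submodule K \<Longrightarrow> x \<in> K \<Longrightarrow> y \<in> K \<Longrightarrow> x + y \<in> K"
  and submodule_mult: "submodule K \<Longrightarrow> a \<in> A \<Longrightarrow> x \<in> K \<Longrightarrow> a * x \<in> K"
  and submodule_mult': "submodule K \<Longrightarrow> a \<in> A \<Longrightarrow> x \<in> K \<Longrightarrow> x * a \<in> K"
  unfolding submodule_def by (auto simp: mult.commute)

lemma submodule_uminus: "submodule K \<Longrightarrow> x \<in> K \<Longrightarrow> - x \<in> K"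
  using submodule_mult[of K "- 1" x] uminus_closed[OF one_closed] by simp

lemma submodule_diff: "submodule K \<Longrightarrow> x \<in> K \<Longrightarrow> y \<in> K \<Longrightarrow> x - y \<in> K"
  using submodule_add[of K x "- y"] submodule_uminus[of K y] by simp

lemma submodule_sum: "submodule K \<Longrightarrow> (\<And>i. i \<in> I \<Longrightarrow> f i \<in> K) \<Longrightarrow> sum f I \<in> K"
  by (induction I rule: infinite_finite_induct) (auto simp: submodule_zero submodule_add)

lemmas submodule_closed = submodule_zero submodule_add submodule_mult submodule_mult'
  submodule_uminus submodule_diff submodule_sum

lemma submodule_A: "submodule A"
  by (simp add: submodule_def closed)

lemma submodule_trivial: "submodule {0}"
  by (simp add: submodule_def)

text \<open>Elimination of one unknown at a time, without determinants: \<open>1 - m a a\<close> has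
  residue 1 and is a unit, so the relation for \<open>a\<close> can be solved for
  \<open>u a\<close>. Substitution changes the other coefficients only by products of elements of
  residue zero.\<close>

lemma nakayama:
  assumes "finite I" and K: "submodule K"
    and "\<And>i j. i \<in> I \<Longrightarrow> j \<in> I \<Longrightarrow> m i j \<in> A \<and> res (m i j) = 0"
    and "\<And>i. i \<in> I \<Longrightarrow> u i - (\<Sum>j\<in>I. m i j * u j) \<in> K"
  shows "\<forall>i\<in>I. u i \<in> K"
  using assms(1,3,4)
proof (induction I arbitrary: m rule: finite_induct)
  case empty
  then show ?case by simp
next
  case (insert a I)
  note mA = insert.prems(1)[THEN conjunct1] and mres = insert.prems(1)[THEN conjunct2]
  define e where "e = 1 - m a a"
  have e: "e \<in> A" "res e = 1"
    by (simp_all add: e_def closed res_simps mA mres)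
  then have e': "inverse e \<in> A" "e \<noteq> 0" by (auto intro: inverse_closed simp: res_zero)
  define k where "k = u a - (\<Sum>j\<in>insert a I. m a j * u j)"
  have k: "k \<in> K" using insert.prems(2)[of a] by (simp add: k_def)
  have ua: "u a = inverse e * (k + (\<Sum>j\<in>I. m a j * u j))"
    using e' insert.hyps by (simp add: k_def e_def field_simps)
  define m' where "m' = (\<lambda>i j. m i j + m i a * inverse e * m a j)"
  have "\<forall>i\<in>I. u i \<in> K"
  proof (rule insert.IH[of m'])
    show "m' i j \<in> A \<and> res (m' i j) = 0" if "i \<in> I" "j \<in> I" for i j
      using that e' by (simp add: m'_def closed res_simps mA mres)
    fix i assume i: "i \<in> I"
    have "u a - inverse e * k = (\<Sum>j\<in>I. inverse e * m a j * u j)"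
      by (subst ua) (simp add: algebra_simps sum_distrib_left)
    then have "m i a * (u a - inverse e * k) = (\<Sum>j\<in>I. m i a * inverse e * m a j * u j)"
      by (simp add: sum_distrib_left mult.assoc)
    then have eq: "u i - (\<Sum>j\<in>I. m' i j * u j)
        = u i - (\<Sum>j\<in>insert a I. m i j * u j) + m i a * inverse e * k"
      using insert.hyps by (simp add: m'_def algebra_simps sum.distrib)
    have "u i - (\<Sum>j\<in>insert a I. m i j * u j) + m i a * inverse e * k \<in> K"
      using i k e' by (intro submodule_add[OF K] submodule_mult[OF K] insert.prems(2))
        (auto simp: closed mA)
    then show "u i - (\<Sum>j\<in>I. m' i j * u j) \<in> K" by (simp only: eq)
  qed
  moreover from this have "u a \<in> K"
    unfolding ua using k e' by (intro submodule_closed[OF K]) (auto simp: mA)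
  ultimately show ?case by simp
qed

text \<open>Nakayama's lemma is used twice. With \<open>{0}\<close> it shows that the rows of
  \<open>N\<close> are independent over the field, which gives an inverse with entries in the field;
  with \<open>A\<close> it shows that these entries lie in \<open>A\<close>.\<close>

lemma nakayama_inverse:
  assumes T: "finite T"
    and N: "\<And>i k. i \<in> T \<Longrightarrow> k \<in> T \<Longrightarrow> N i k \<in> A \<and> res (N i k) = (if i = k then 1 else 0)"
  obtains P where "\<And>l k. l \<in> T \<Longrightarrow> k \<in> T \<Longrightarrow> P l k \<in> A"
    "\<And>i l. i \<in> T \<Longrightarrow> l \<in> T \<Longrightarrow> (\<Sum>k\<in>T. N i k * P l k) = (if i = l then 1 else 0)"
proof -
  note NA = N[THEN conjunct1] and Nres = N[THEN conjunct2]
  have "\<exists>P. \<forall>l\<in>T. \<forall>i\<in>T. (\<Sum>k\<in>T. N i k * P l k) = (if i = l then 1 else 0)"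
  proof (rule matrix_right_inverse[OF T T])
    fix h assume hN: "\<And>k. k \<in> T \<Longrightarrow> (\<Sum>i\<in>T. h i * N i k) = 0"
    define m where "m = (\<lambda>l i. (if i = l then 1 else 0) - N i l)"
    have "\<forall>l\<in>T. h l \<in> {0}"
    proof (rule nakayama[OF T submodule_trivial, of m])
      show "m i j \<in> A \<and> res (m i j) = 0" if "i \<in> T" "j \<in> T" for i j
        using that by (auto simp: m_def closed res_simps NA Nres)
      fix l assume l: "l \<in> T"
      have "(\<Sum>j\<in>T. m l j * h j) = (\<Sum>j\<in>T. (if j = l then h j else 0)) - (\<Sum>j\<in>T. h j * N j l)"
        unfolding sum_subtractf[symmetric] by (intro sum.cong) (auto simp: m_def algebra_simps)
      then show "h l - (\<Sum>j\<in>T. m l j * h j) \<in> {0}"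
        using l T by (simp add: hN sum.delta)
    qed
    then show "\<forall>i\<in>T. h i = 0" by simp
  qed
  then obtain P where P: "\<And>i l. i \<in> T \<Longrightarrow> l \<in> T \<Longrightarrow> (\<Sum>k\<in>T. N i k * P l k) = (if i = l then 1 else 0)"
    by blast
  define m where "m = (\<lambda>i l. (if i = l then 1 else 0) - N i l)"
  have "\<forall>k\<in>T. P l k \<in> A" if l: "l \<in> T" for l
  proof (rule nakayama[OF T submodule_A, of m])
    show "m i j \<in> A \<and> res (m i j) = 0" if "i \<in> T" "j \<in> T" for i j
      using that by (auto simp: m_def closed res_simps NA Nres)
    fix i assume i: "i \<in> T"
    have "(\<Sum>k\<in>T. m i k * P l k) = (\<Sum>k\<in>T. (if i = k then P l k else 0)) - (\<Sum>k\<in>T. N i k * P l k)"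
      unfolding sum_subtractf[symmetric] by (intro sum.cong) (auto simp: m_def algebra_simps)
    then show "P l i - (\<Sum>k\<in>T. m i k * P l k) \<in> A"
      using i l T by (simp add: P sum.delta' closed)
  qed
  with P that show ?thesis by blast
qed

end

section \<open>Bilinear forms over a local ring\<close>

locale local_subring_form = local_subring A res + sym_form d \<beta> \<gamma>
  for A :: "'f::field set" and res :: "'f \<Rightarrow> 'l::field" and d :: nat and \<beta> \<gamma> :: "nat \<Rightarrow> nat \<Rightarrow> 'f" +
  assumes form_closed: "i < d \<Longrightarrow> j < d \<Longrightarrow> \<beta> i j \<in> A"
begin

definition vec_in :: "'f set \<Rightarrow> (nat \<Rightarrow> 'f) \<Rightarrow> bool" where
  "vec_in K v \<longleftrightarrow> (\<forall>i<d. v i \<in> K)"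

lemma b_closed: "vec_in A u \<Longrightarrow> vec_in A v \<Longrightarrow> b u v \<in> A"
  unfolding bform_def vec_in_def by (intro closed form_closed) auto

lemma b_submodule:
  assumes "submodule K" "vec_in K u" "vec_in A v"
  shows "b u v \<in> K" "b v u \<in> K"
proof -
  show "b u v \<in> K" unfolding bform_def using assms
    by (intro submodule_sum submodule_mult' submodule_mult) (auto simp: vec_in_def form_closed)
  then show "b v u \<in> K" by (simp only: b_commute)
qed

lemma res_b:
  assumes "vec_in A u" "vec_in A v"
  shows "res (b u v) = bform d (\<lambda>i j. res (\<beta> i j)) (\<lambda>i. res (u i)) (\<lambda>i. res (v i))"
proof -
  have "res (\<Sum>j<d. \<beta> i j * u i * v j) = (\<Sum>j<d. res (\<beta> i j) * res (u i) * res (v j))"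
    if "i < d" for i
    using assms that unfolding vec_in_def
    by (subst res_sum) (auto simp: closed form_closed res_mult)
  moreover have "(\<Sum>j<d. \<beta> i j * u i * v j) \<in> A" if "i < d" for i
    using assms that unfolding vec_in_def by (intro closed form_closed) auto
  ultimately show ?thesis unfolding bform_def by (subst res_sum) auto
qed

lemma b_cong_submodule:
  assumes K: "submodule K" and "vec_in A u" "vec_in A v" "vec_in A u'" "vec_in A v'"
    and "vec_in K (\<lambda>i. u' i - u i)" "vec_in K (\<lambda>i. v' i - v i)"
  shows "b u' v' - b u v \<in> K"
proof -
  have "b u' v' - b u v = b (\<lambda>i. u' i - u i) v' + b u (\<lambda>i. v' i - v i)"
    by (simp add: bform_linear)
  also have "\<dots> \<in> K"
    using assms by (intro submodule_add[OF K] b_submodule[OF K])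
  finally show ?thesis .
qed

lemma b_expand: "b v w = (\<Sum>e<d. v e * b (\<lambda>i. if i = e then 1 else 0) w)"
proof -
  have "b v w = b (\<lambda>i. \<Sum>e<d. v e * (if i = e then 1 else 0)) w"
    by (intro bform_cong) (simp_all add: if_distrib sum.delta' cong: if_cong)
  then show ?thesis by (simp add: bform_linear)
qed

text \<open>The pairing matrix is the identity in the residue field, so
  \<open>nakayama_inverse\<close> inverts it over \<open>A\<close>. The coefficients
  \<open>P\<close> are exposed because it matters later that the new vectors are combinations of the
  old ones: total isotropy is inherited, and residues can be computed.\<close>

lemma biorthogonalize:
  assumes T: "finite T" and y: "\<And>i. i \<in> T \<Longrightarrow> vec_in A (y i)" and z: "\<And>i. i \<in> T \<Longrightarrow> vec_in A (z i)"
    and res: "\<And>i l. i \<in> T \<Longrightarrow> l \<in> T \<Longrightarrow> res (b (y i) (z l)) = (if i = l then 1 else 0)"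
  shows "\<exists>P. (\<forall>l\<in>T. \<forall>k\<in>T. P l k \<in> A) \<and>
    (\<forall>i\<in>T. \<forall>l\<in>T. b (y i) (\<lambda>e. \<Sum>k\<in>T. P l k * z k e) = (if i = l then 1 else 0))"
proof -
  obtain P where P: "\<And>l k. l \<in> T \<Longrightarrow> k \<in> T \<Longrightarrow> P l k \<in> A"
    "\<And>i l. i \<in> T \<Longrightarrow> l \<in> T \<Longrightarrow> (\<Sum>k\<in>T. b (y i) (z k) * P l k) = (if i = l then 1 else 0)"
    using y z by (rule_tac nakayama_inverse[OF T, of "\<lambda>i k. b (y i) (z k)"]) (auto intro: b_closed simp: res)
  then show ?thesis
    by (intro exI[of _ P]) (simp add: bform_linear mult.commute)
qed

end

text \<open>In the applications \<open>A\<close> is the local ring of an affine space at a point of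
  the scheme and \<open>J\<close> is the ideal of the scheme in it. A congruence modulo
  \<open>J\<close> is an equation on the scheme near the point.\<close>

locale local_pair = local_subring_form A res d \<beta> \<gamma>
  for A :: "'f::field set" and res :: "'f \<Rightarrow> 'l::field" and d :: nat and \<beta> \<gamma> :: "nat \<Rightarrow> nat \<Rightarrow> 'f" +
  fixes J :: "'f set"
  assumes J_sub: "J \<subseteq> A" and J_submodule: "submodule J" and res_J: "x \<in> J \<Longrightarrow> res x = 0"
begin

lemma J_A: "x \<in> J \<Longrightarrow> x \<in> A"
  using J_sub by blast

lemmas J_closed = submodule_closed[OF J_submodule]

text \<open>In the residue field every vector is recovered from its products with the \<open>X j\<close> and \<open>Z i\<close>.
  Over \<open>A\<close> this holds up to a matrix with entries in the maximal ideal, which Nakayama's lemma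
  absorbs.\<close>

lemma pseudo_orthogonal_expansion:
  fixes X Z :: "nat \<Rightarrow> nat \<Rightarrow> 'f"
  defines "x \<equiv> \<lambda>j i. res (X j i)" and "z \<equiv> \<lambda>j i. res (Z j i)"
    and "bl \<equiv> bform d (\<lambda>i j. res (\<beta> i j))"
  assumes fin: "finite JN" "finite JB"
    and X: "\<And>j. j \<in> JN \<union> JB \<Longrightarrow> vec_in A (X j)" and Z: "\<And>j. j \<in> JB \<Longrightarrow> vec_in A (Z j)"
    and q0: "\<And>j. j \<in> JN \<Longrightarrow> res (b (X j) (X j)) \<noteq> 0"
    and complete: "\<And>v a. a < d \<Longrightarrow> v a = (\<Sum>j\<in>JN. bl v (x j) / bl (x j) (x j) * x j a)
        + (\<Sum>i\<in>JB. bl v (z i) * x i a) + (\<Sum>i\<in>JB. bl v (x i) * z i a)"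
    and K: "submodule K" and u: "\<And>j. j \<in> JN \<union> JB \<Longrightarrow> b u (X j) \<in> K"
    and u': "\<And>i. i \<in> JB \<Longrightarrow> b u (Z i) \<in> K"
  shows "vec_in K u"
proof -
  define q where "q = (\<lambda>j. inverse (b (X j) (X j)))"
  have q: "q j \<in> A" "res (q j) = inverse (bl (x j) (x j))" if "j \<in> JN" for j
    using that X q0 by (simp_all add: q_def inverse_closed b_closed res_inverse)
      (simp add: res_b bl_def x_def)
  \<comment> \<open>The expansion formula \<open>complete\<close>, lifted to \<open>A\<close>. The
    entries of \<open>\<Phi> u\<close> lie in \<open>K\<close> because they only involve the
    pairings of \<open>u\<close> that are assumed to lie there.\<close>
  define \<Phi> where "\<Phi> = (\<lambda>v a. (\<Sum>j\<in>JN. b v (X j) * q j * X j a)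
    + (\<Sum>i\<in>JB. b v (Z i) * X i a) + (\<Sum>i\<in>JB. b v (X i) * Z i a))"
  define E where "E = (\<lambda>(e::nat) (i::nat). if i = e then 1 else 0 :: 'f)"
  have E: "vec_in A (E e)" for e by (simp add: vec_in_def E_def closed)
  have \<Phi>_E: "\<Phi> u a = (\<Sum>e<d. u e * \<Phi> (E e) a)" for a
    unfolding \<Phi>_def E_def b_expand[of u]
    by (simp add: sum_distrib_left sum_distrib_right distrib_left sum.distrib sum.swap[of _ _ "{..<d}"] mult.assoc)
  \<comment> \<open>The matrix of the identity minus \<open>\<Phi>\<close>; its residue vanishes by
    \<open>complete\<close>, and \<open>u\<close> minus its image under \<open>m\<close> is
    \<open>\<Phi> u\<close>.\<close>
  define m where "m = (\<lambda>a e. E e a - \<Phi> (E e) a)"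
  have Xa: "X j a \<in> A" if "j \<in> JN \<union> JB" "a < d" for j a using X that by (simp add: vec_in_def)
  have Za: "Z j a \<in> A" if "j \<in> JB" "a < d" for j a using Z that by (simp add: vec_in_def)
  have \<Phi>A: "\<Phi> (E e) a \<in> A" if "a < d" for e a
    unfolding \<Phi>_def using that X Z q(1) E by (intro closed b_closed Xa Za) auto
  have m: "m a e \<in> A \<and> res (m a e) = 0" if "a < d" "e < d" for a e
  proof -
    have EA: "E e a \<in> A" using E that by (simp add: vec_in_def)
    have c: "b (E e) (X j) * q j * X j a \<in> A" if "j \<in> JN" for j
      using that \<open>a < d\<close> X q(1) E by (intro closed b_closed Xa) auto
    have c': "b (E e) (Z i) * X i a \<in> A" "b (E e) (X i) * Z i a \<in> A" if "i \<in> JB" for i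
      using that \<open>a < d\<close> X Z E by (auto intro!: closed b_closed Xa Za)
    have r: "res (b (E e) (X j) * q j * X j a) = bl (\<lambda>i. res (E e i)) (x j) / bl (x j) (x j) * x j a"
      if "j \<in> JN" for j
      using that \<open>a < d\<close> X q E Xa[of j a] unfolding bl_def x_def
      by (simp add: res_mult closed b_closed res_b divide_inverse)
    have r': "res (b (E e) (Z i) * X i a) = bl (\<lambda>i. res (E e i)) (z i) * x i a"
      "res (b (E e) (X i) * Z i a) = bl (\<lambda>i. res (E e i)) (x i) * z i a" if "i \<in> JB" for i
      using that \<open>a < d\<close> X Z E Xa[of i a] Za[of i a] unfolding bl_def x_def z_def
      by (simp_all add: res_mult closed b_closed res_b)
    have "res (\<Phi> (E e) a) = res (E e a)"
      unfolding \<Phi>_def complete[OF \<open>a < d\<close>, of "\<lambda>i. res (E e i)"]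
      by (simp add: res_add res_sum closed c c' r r')
    then show ?thesis using EA \<Phi>A[OF \<open>a < d\<close>, of e] by (simp add: m_def closed res_diff)
  qed
  have "\<forall>a\<in>{..<d}. u a \<in> K"
  proof (rule nakayama[OF _ K, of _ m])
    fix a assume a: "a \<in> {..<d}"
    have "(\<Sum>e<d. m a e * u e) = (\<Sum>e<d. E e a * u e) - (\<Sum>e<d. u e * \<Phi> (E e) a)"
      by (simp add: m_def algebra_simps sum_subtractf)
    also have "\<dots> = u a - \<Phi> u a"
      using a by (simp add: \<Phi>_E E_def if_distrib if_distribR sum.delta cong: if_cong)
    finally have "u a - (\<Sum>e<d. m a e * u e) = \<Phi> u a" by simp
    also have "\<dots> \<in> K"
      unfolding \<Phi>_def using a u u' q(1)
      by (intro submodule_add[OF K] submodule_sum[OF K] submodule_mult'[OF K] Xa Za) auto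
    finally show "u a - (\<Sum>e<d. m a e * u e) \<in> K" .
  qed (use m in auto)
  then show ?thesis by (simp add: vec_in_def)
qed

text \<open>Let \<open>h i = b (X i) (X i)\<close>. The expansion lemma gives \<open>X j = (\<Sum>i\<in>JB. C j i * X i)\<close> modulo the
  ideal of the \<open>h i\<close>, and then \<open>b (X j) (X k) = - (\<Sum>i\<in>JB. C j i * C k i * h i)\<close> modulo its square.
  By the rank hypothesis each \<open>h i\<close> lies in the square, so all of them vanish by Nakayama's lemma.\<close>

lemma isotropic_rigidity:
  fixes X Z :: "nat \<Rightarrow> nat \<Rightarrow> 'f"
  defines "x \<equiv> \<lambda>j i. res (X j i)" and "z \<equiv> \<lambda>j i. res (Z j i)"
    and "bl \<equiv> bform d (\<lambda>i j. res (\<beta> i j))"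
    and "C \<equiv> \<lambda>j i. b (X j) (Z i)"
  assumes fin: "finite JN" "finite JB" "finite JD"
    and disj: "JN \<inter> JB = {}" "JN \<inter> JD = {}" "JB \<inter> JD = {}"
    and surj: "\<And>y. \<exists>a\<in>A. res a = y"
    and X: "\<And>j. j \<in> JN \<union> JB \<union> JD \<Longrightarrow> vec_in A (X j)" and Z: "\<And>j. j \<in> JB \<Longrightarrow> vec_in A (Z j)"
    and orth: "\<And>j k. j \<in> JN \<union> JB \<union> JD \<Longrightarrow> k \<in> JN \<union> JB \<union> JD \<Longrightarrow> j \<noteq> k \<Longrightarrow> b (X j) (X k) \<in> J"
    and q0: "\<And>j. j \<in> JN \<Longrightarrow> res (b (X j) (X j)) \<noteq> 0"
    and q1: "\<And>j. j \<in> JB \<Longrightarrow> res (b (X j) (X j)) = 0"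
    and biorth: "\<And>i l. i \<in> JB \<Longrightarrow> l \<in> JB \<Longrightarrow> b (X i) (Z l) = (if i = l then 1 else 0)"
    and complete: "\<And>v a. a < d \<Longrightarrow> v a = (\<Sum>j\<in>JN. bl v (x j) / bl (x j) (x j) * x j a)
        + (\<Sum>i\<in>JB. bl v (z i) * x i a) + (\<Sum>i\<in>JB. bl v (x i) * z i a)"
    and rank: "\<And>i. i \<in> JB \<Longrightarrow> \<exists>D. \<forall>l\<in>JB.
        (\<Sum>j\<in>JD. \<Sum>k\<in>JD - {j}. D j k * (res (C j l) * res (C k l))) = (if l = i then 1 else 0)"
  shows "\<forall>i\<in>JB. b (X i) (X i) \<in> J"
    and "\<forall>j\<in>JD. vec_in J (\<lambda>a. X j a - (\<Sum>i\<in>JB. C j i * X i a))"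
proof -
  define h where "h = (\<lambda>i. b (X i) (X i))"
  have hA: "h i \<in> A" "res (h i) = 0" if "i \<in> JB" for i
    using that X q1 by (simp_all add: h_def b_closed)
  have CA: "C j i \<in> A" if "j \<in> JD" "i \<in> JB" for j i
    using that X Z by (simp add: C_def b_closed)
  \<comment> \<open>\<open>gen A\<close>, called \<open>K\<close> below, is the ideal generated by
    \<open>J\<close> and the \<open>h l\<close>; \<open>gen M\<close> allows only coefficients from
    the maximal ideal \<open>M\<close>. Since \<open>K\<close> lies in \<open>M\<close>, products of
    two elements of \<open>K\<close> lie in \<open>gen M\<close>, the form in which Nakayama's lemma
    can use them.\<close>
  define gen where "gen = (\<lambda>S. {y. \<exists>c. (\<forall>l\<in>JB. c l \<in> S) \<and> y - (\<Sum>l\<in>JB. c l * h l) \<in> J})"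
  have gen_submodule: "submodule (gen S)" if S: "submodule S" for S
    unfolding submodule_def
  proof (intro conjI ballI)
    show "0 \<in> gen S"
      unfolding gen_def using S by (auto intro!: exI[of _ "\<lambda>_. 0"] submodule_zero simp: J_closed)
  next
    fix y y' assume "y \<in> gen S" "y' \<in> gen S"
    then obtain c c' where c: "\<forall>l\<in>JB. c l \<in> S" "y - (\<Sum>l\<in>JB. c l * h l) \<in> J"
      and c': "\<forall>l\<in>JB. c' l \<in> S" "y' - (\<Sum>l\<in>JB. c' l * h l) \<in> J"
      by (auto simp: gen_def)
    have "y + y' - (\<Sum>l\<in>JB. (c l + c' l) * h l)
        = (y - (\<Sum>l\<in>JB. c l * h l)) + (y' - (\<Sum>l\<in>JB. c' l * h l))"
      by (simp add: algebra_simps sum.distrib)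
    then have "y + y' - (\<Sum>l\<in>JB. (c l + c' l) * h l) \<in> J"
      using J_closed(2)[OF c(2) c'(2)] by (simp only:)
    then show "y + y' \<in> gen S"
      unfolding gen_def using c c' S by (auto intro!: exI[of _ "\<lambda>l. c l + c' l"] submodule_add)
  next
    fix a y assume a: "a \<in> A" and "y \<in> gen S"
    then obtain c where c: "\<forall>l\<in>JB. c l \<in> S" "y - (\<Sum>l\<in>JB. c l * h l) \<in> J"
      by (auto simp: gen_def)
    have "a * y - (\<Sum>l\<in>JB. (a * c l) * h l) = a * (y - (\<Sum>l\<in>JB. c l * h l))"
      by (simp add: algebra_simps sum_distrib_left)
    then have "a * y - (\<Sum>l\<in>JB. (a * c l) * h l) \<in> J" using c a by (simp only: J_closed)
    then show "a * y \<in> gen S"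
      unfolding gen_def using c a S by (auto intro!: exI[of _ "\<lambda>l. a * c l"] submodule_mult)
  qed
  define M where "M = {y\<in>A. res y = 0}"
  have M: "submodule M" unfolding submodule_def M_def by (simp add: closed res_simps)
  define K where "K = gen A"
  have K: "submodule K" unfolding K_def by (rule gen_submodule[OF submodule_A])
  have gM: "submodule (gen M)" by (rule gen_submodule[OF M])
  have J_gen: "y \<in> gen S" if "y \<in> J" "submodule S" for y S
    unfolding gen_def using that by (auto intro!: exI[of _ "\<lambda>_. 0"] submodule_zero)
  have hK: "c * h i \<in> gen S" if "i \<in> JB" "c \<in> S" "submodule S" for c i S
    unfolding gen_def using that fin
    by (auto intro!: exI[of _ "\<lambda>l. if l = i then c else 0"] submodule_zero
        simp: if_distribR if_distrib sum.delta J_closed cong: if_cong)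
  have KM: "K \<subseteq> M"
  proof
    fix y assume "y \<in> K"
    then obtain c where c: "\<forall>l\<in>JB. c l \<in> A" "y - (\<Sum>l\<in>JB. c l * h l) \<in> J"
      by (auto simp: K_def gen_def)
    have "(\<Sum>l\<in>JB. c l * h l) \<in> M"
      using c hA by (intro submodule_sum[OF M] submodule_mult[OF M]) (auto simp: M_def)
    moreover have "y - (\<Sum>l\<in>JB. c l * h l) \<in> M" using c J_A res_J by (auto simp: M_def)
    ultimately have "(y - (\<Sum>l\<in>JB. c l * h l)) + (\<Sum>l\<in>JB. c l * h l) \<in> M"
      using submodule_add[OF M] by blast
    then show "y \<in> M" by simp
  qed
  have KK: "y * y' \<in> gen M" if "y \<in> K" "y' \<in> K" for y y'
  proof -
    have y': "y' \<in> A" "res y' = 0" using KM that by (auto simp: M_def)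
    obtain c where c: "\<forall>l\<in>JB. c l \<in> A" "y - (\<Sum>l\<in>JB. c l * h l) \<in> J"
      using \<open>y \<in> K\<close> by (auto simp: K_def gen_def)
    have "y * y' - (\<Sum>l\<in>JB. (c l * y') * h l) = (y - (\<Sum>l\<in>JB. c l * h l)) * y'"
      by (simp add: algebra_simps sum_distrib_left)
    then have "y * y' - (\<Sum>l\<in>JB. (c l * y') * h l) \<in> J" using c y' by (simp only: J_closed)
    then show ?thesis
      unfolding gen_def using c y'
      by (auto intro!: exI[of _ "\<lambda>l. c l * y'"] simp: M_def closed res_simps)
  qed
  define u where "u = (\<lambda>j a. X j a - (\<Sum>i\<in>JB. C j i * X i a))"
  have bX: "b (X i) (X l) - (if i = l then h i else 0) \<in> J"
    if "i \<in> JN \<union> JB \<union> JD" "l \<in> JN \<union> JB \<union> JD" for i l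
    using that orth[of i l] by (auto simp: h_def J_closed)
  \<comment> \<open>The case \<open>l = j\<close> must be left out, because nothing is known about
    \<open>b (X j) (X j)\<close> for \<open>j\<close> in \<open>JD\<close>. Otherwise orthogonality
    removes all terms except the one with \<open>i = l\<close>.\<close>
  have bu: "b (u j) (X l) - (if l \<in> JB then - C j l * h l else 0) \<in> J"
    if j: "j \<in> JD" and l: "l \<in> JN \<union> JB \<union> (JD - {j})" for j l
  proof -
    have "(\<Sum>i\<in>JB. C j i * (b (X i) (X l) - (if i = l then h i else 0))) \<in> J"
      using j l by (intro J_closed bX CA) auto
    moreover have "b (X j) (X l) \<in> J" using j l disj by (intro orth) auto
    ultimately have "b (X j) (X l) - (\<Sum>i\<in>JB. C j i * (b (X i) (X l) - (if i = l then h i else 0))) \<in> J"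
      using J_closed(6) by blast
    moreover have "b (u j) (X l) = b (X j) (X l) - (\<Sum>i\<in>JB. C j i * b (X i) (X l))"
      by (simp add: u_def bform_linear)
    moreover have "(\<Sum>i\<in>JB. C j i * (if i = l then h i else 0)) = (if l \<in> JB then C j l * h l else 0)"
      using fin by (simp add: mult_delta_right sum.delta)
    ultimately show ?thesis by (simp add: right_diff_distrib sum_subtractf diff_diff_eq2 diff_add_eq split: if_splits)
  qed
  have buK: "b (u j) (X l) \<in> K" if "j \<in> JD" "l \<in> JN \<union> JB" for j l
  proof -
    have "(b (u j) (X l) - (if l \<in> JB then - C j l * h l else 0)) + (if l \<in> JB then - C j l * h l else 0) \<in> K"
      using that unfolding K_def
      by (intro submodule_add[OF gen_submodule[OF submodule_A]] J_gen[OF bu submodule_A])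
        (auto intro!: hK submodule_A closed CA submodule_zero[OF gen_submodule[OF submodule_A]]
          submodule_uminus[OF gen_submodule[OF submodule_A]])
    then show ?thesis by simp
  qed
  have uK: "vec_in K (u j)" if j: "j \<in> JD" for j
  proof (rule pseudo_orthogonal_expansion[where JN = JN and JB = JB and X = X and Z = Z])
    show "b (u j) (Z i) \<in> K" if "i \<in> JB" for i
    proof -
      have "b (u j) (Z i) = C j i - (\<Sum>l\<in>JB. C j l * b (X l) (Z i))"
        by (simp add: u_def bform_linear C_def)
      also have "(\<Sum>l\<in>JB. C j l * b (X l) (Z i)) = (\<Sum>l\<in>JB. C j l * (if l = i then 1 else 0))"
        using that by (intro sum.cong) (simp_all add: biorth)
      also have "\<dots> = C j i" using that fin by (simp add: mult_delta_right sum.delta)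
      finally show ?thesis by (simp add: submodule_zero[OF K])
    qed
  qed (use fin X Z q0 complete K buK j in \<open>auto simp: x_def z_def bl_def\<close>)
  \<comment> \<open>\<open>b (u j) (u k)\<close> lies in \<open>gen M\<close>, being a combination
    of products of two elements of \<open>K\<close>. In the expansion of its second argument
    \<open>b (u j) (X k)\<close> is zero modulo \<open>J\<close> and each
    \<open>b (u j) (X i)\<close> is \<open>- C j i * h i\<close>, which leaves the quadratic
    expression.\<close>
  have quad: "(\<Sum>i\<in>JB. C j i * C k i * h i) \<in> gen M" if j: "j \<in> JD" and k: "k \<in> JD" "k \<noteq> j" for j k
  proof -
    have uu: "b (u j) (u k) \<in> gen M"
      unfolding bform_def
    proof (intro submodule_sum[OF gM])
      fix i l assume "i \<in> {..<d}" "l \<in> {..<d}"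
      then have "\<beta> i l * (u j i * u k l) \<in> gen M"
        using uK j k by (intro submodule_mult[OF gM] KK form_closed) (auto simp: vec_in_def)
      then show "\<beta> i l * u j i * u k l \<in> gen M" by (simp add: mult.assoc)
    qed
    have ukX: "b (u j) (X k) \<in> J" using bu[of j k] j k disj by (auto split: if_splits)
    have s: "(\<Sum>i\<in>JB. C k i * (b (u j) (X i) - (- C j i * h i))) \<in> J"
      by (intro J_closed(7) J_closed(3)) (use bu[OF j] CA k in force)+
    have "(\<Sum>i\<in>JB. C j i * C k i * h i) =
        b (u j) (u k) - b (u j) (X k) + (\<Sum>i\<in>JB. C k i * (b (u j) (X i) - (- C j i * h i)))"
    proof -
      have "b (u j) (u k) = b (u j) (X k) - (\<Sum>i\<in>JB. C k i * b (u j) (X i))"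
        by (simp add: u_def[of] bform_linear(4) bform_sum_right bform_scale_right)
      then show ?thesis by (simp add: algebra_simps sum.distrib)
    qed
    also have "\<dots> \<in> gen M"
      by (intro submodule_add[OF gM] submodule_diff[OF gM] J_gen[OF ukX M] J_gen[OF s M] uu)
    finally show ?thesis .
  qed
  have "h i \<in> gen M" if i: "i \<in> JB" for i
  proof -
    obtain D where D: "\<forall>l\<in>JB. (\<Sum>j\<in>JD. \<Sum>k\<in>JD - {j}. D j k * (res (C j l) * res (C k l)))
        = (if l = i then 1 else 0)" using rank[OF i] by blast
    obtain g where g: "\<And>y. g y \<in> A" "\<And>y. res (g y) = y"
      using surj by metis
    define D' where "D' = (\<lambda>j k. g (D j k))"
    have D': "D' j k \<in> A" "res (D' j k) = D j k" for j k by (simp_all add: D'_def g)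
    \<comment> \<open>With lifted coefficients the identity of \<open>rank\<close> holds over
      \<open>A\<close> up to the error \<open>e\<close>. The error has residue zero, so
      \<open>e l * h l\<close> lies in \<open>gen M\<close> as well.\<close>
    define e where "e = (\<lambda>l. (if l = i then 1 else 0) - (\<Sum>j\<in>JD. \<Sum>k\<in>JD - {j}. D' j k * (C j l * C k l)))"
    have DC: "D' j k * (C j l * C k l) \<in> A" if "j \<in> JD" "k \<in> JD" "l \<in> JB" for j k l
      using that D' CA by (intro closed) auto
    have e: "e l \<in> M" if l: "l \<in> JB" for l
    proof -
      have "res (\<Sum>k\<in>JD - {j}. D' j k * (C j l * C k l)) = (\<Sum>k\<in>JD - {j}. D j k * (res (C j l) * res (C k l)))"
        if "j \<in> JD" for j
        using that l by (subst res_sum) (auto simp: DC res_mult closed D' CA)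
      moreover have "(\<Sum>k\<in>JD - {j}. D' j k * (C j l * C k l)) \<in> A" if "j \<in> JD" for j
        using that l by (intro closed DC) auto
      ultimately have "res (\<Sum>j\<in>JD. \<Sum>k\<in>JD - {j}. D' j k * (C j l * C k l)) = (if l = i then 1 else 0)"
        using D l by (simp add: res_sum)
      moreover have "(\<Sum>j\<in>JD. \<Sum>k\<in>JD - {j}. D' j k * (C j l * C k l)) \<in> A"
        using l by (intro sum_closed DC) auto
      ultimately
      show ?thesis by (simp add: M_def e_def closed res_diff res_one res_zero)
    qed
    have "(\<Sum>j\<in>JD. \<Sum>k\<in>JD - {j}. D' j k * (\<Sum>l\<in>JB. C j l * C k l * h l)) + (\<Sum>l\<in>JB. e l * h l) \<in> gen M"
      using e by (intro submodule_add[OF gM] submodule_sum[OF gM] submodule_mult[OF gM] quad hK M D') auto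
    moreover have "(\<Sum>j\<in>JD. \<Sum>k\<in>JD - {j}. D' j k * (\<Sum>l\<in>JB. C j l * C k l * h l))
        = (\<Sum>l\<in>JB. (\<Sum>j\<in>JD. \<Sum>k\<in>JD - {j}. D' j k * (C j l * C k l)) * h l)"
      by (simp add: sum_distrib_left sum_distrib_right sum.swap[of _ JB] mult.assoc)
    moreover have "(\<Sum>l\<in>JB. (if l = i then 1 else 0) * h l) = h i"
      using i fin by (simp add: mult_delta_left sum.delta)
    ultimately show ?thesis by (simp add: e_def left_diff_distrib sum_subtractf)
  qed
  then obtain c where c: "\<And>i l. i \<in> JB \<Longrightarrow> l \<in> JB \<Longrightarrow> c i l \<in> M"
    "\<And>i. i \<in> JB \<Longrightarrow> h i - (\<Sum>l\<in>JB. c i l * h l) \<in> J"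
    unfolding gen_def by simp metis
  have hJ: "\<forall>i\<in>JB. h i \<in> J"
    by (rule nakayama[OF fin(2) J_submodule, of c]) (use c in \<open>auto simp: M_def\<close>)
  then show "\<forall>i\<in>JB. b (X i) (X i) \<in> J" by (simp add: h_def)
  have "K \<subseteq> J"
  proof
    fix y assume "y \<in> K"
    then obtain c where c: "\<forall>l\<in>JB. c l \<in> A" "y - (\<Sum>l\<in>JB. c l * h l) \<in> J"
      by (auto simp: K_def gen_def)
    have "(y - (\<Sum>l\<in>JB. c l * h l)) + (\<Sum>l\<in>JB. c l * h l) \<in> J"
      using c hJ by (intro J_closed(2)[OF c(2)] J_closed(7) J_closed(3)) auto
    then show "y \<in> J" by simp
  qed
  with uK show "\<forall>j\<in>JD. vec_in J (\<lambda>a. X j a - (\<Sum>i\<in>JB. C j i * X i a))"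
    by (auto simp: vec_in_def u_def)
qed

text \<open>The divisors \<open>q j\<close> are units because their residues are those of
  \<open>b (Y j) (Y j)\<close>. The projection coefficients lie in \<open>J\<close>, so the vectors
  move only within \<open>J\<close>. The last conclusion reflects that the new vectors are
  combinations of the old ones: orthogonality to the isotropic vectors, arranged beforehand, is not
  lost.\<close>

lemma gram_schmidt:
  assumes "finite I"
    and "\<And>j. j \<in> I \<Longrightarrow> vec_in A (Y j)" "\<And>j. j \<in> I \<Longrightarrow> res (b (Y j) (Y j)) \<noteq> 0"
    and "\<And>j k. j \<in> I \<Longrightarrow> k \<in> I \<Longrightarrow> j \<noteq> k \<Longrightarrow> b (Y j) (Y k) \<in> J"
  shows "\<exists>Y'. (\<forall>j\<in>I. vec_in A (Y' j) \<and> vec_in J (\<lambda>i. Y' j i - Y j i))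
    \<and> (\<forall>j\<in>I. \<forall>k\<in>I. j \<noteq> k \<longrightarrow> b (Y' j) (Y' k) = 0)
    \<and> (\<forall>w. (\<forall>j\<in>I. b w (Y j) = 0) \<longrightarrow> (\<forall>j\<in>I. b w (Y' j) = 0))"
  using assms
proof (induction I rule: finite_induct)
  case empty
  then show ?case by simp
next
  case (insert a I)
  have "\<exists>Y'. (\<forall>j\<in>I. vec_in A (Y' j) \<and> vec_in J (\<lambda>i. Y' j i - Y j i))
    \<and> (\<forall>j\<in>I. \<forall>k\<in>I. j \<noteq> k \<longrightarrow> b (Y' j) (Y' k) = 0)
    \<and> (\<forall>w. (\<forall>j\<in>I. b w (Y j) = 0) \<longrightarrow> (\<forall>j\<in>I. b w (Y' j) = 0))"
    by (rule insert.IH) (use insert.prems in simp_all)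
  then obtain Y' where 1: "\<forall>j\<in>I. vec_in A (Y' j) \<and> vec_in J (\<lambda>i. Y' j i - Y j i)"
    and 2: "\<forall>j\<in>I. \<forall>k\<in>I. j \<noteq> k \<longrightarrow> b (Y' j) (Y' k) = 0"
    and 3: "\<forall>w. (\<forall>j\<in>I. b w (Y j) = 0) \<longrightarrow> (\<forall>j\<in>I. b w (Y' j) = 0)"
    by (elim exE conjE)
  have Y': "vec_in A (Y' j)" "vec_in J (\<lambda>i. Y' j i - Y j i)" if "j \<in> I" for j
    using 1 that by simp_all
  have orth: "b (Y' j) (Y' k) = 0" if "j \<in> I" "k \<in> I" "j \<noteq> k" for j k
    using 2 that by simp
  have perp: "b w (Y' j) = 0" if "\<forall>j\<in>I. b w (Y j) = 0" "j \<in> I" for w j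
    using 3[rule_format, of w j] that by simp
  have J0: "vec_in J (\<lambda>i. v i - v i)" for v by (simp add: vec_in_def J_closed)
  define q where "q = (\<lambda>j. b (Y' j) (Y' j))"
  have q: "q j \<noteq> 0" "inverse (q j) \<in> A" if j: "j \<in> I" for j
  proof -
    have "q j - b (Y j) (Y j) \<in> J"
      unfolding q_def using j Y' insert.prems by (intro b_cong_submodule[OF J_submodule]) auto
    then have "res (q j - b (Y j) (Y j)) = 0" by (rule res_J)
    moreover have "q j \<in> A" "b (Y j) (Y j) \<in> A"
      using j Y' insert.prems by (auto simp: q_def intro: b_closed)
    ultimately have "res (q j) \<noteq> 0" using j insert.prems(2)[of j] by (simp add: res_diff)
    then show "q j \<noteq> 0" "inverse (q j) \<in> A"
      using \<open>q j \<in> A\<close> by (auto simp: res_zero inverse_closed)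
  qed
  define c where "c = (\<lambda>j. b (Y a) (Y' j) * inverse (q j))"
  have c: "c j \<in> J" if j: "j \<in> I" for j
  proof -
    have "b (Y a) (Y' j) - b (Y a) (Y j) \<in> J"
      using j Y' J0 insert.prems by (intro b_cong_submodule[OF J_submodule]) auto
    moreover have "b (Y a) (Y j) \<in> J" using j insert.hyps insert.prems by auto
    ultimately have "b (Y a) (Y' j) - b (Y a) (Y j) + b (Y a) (Y j) \<in> J" by (rule J_closed(2))
    then show ?thesis using q j by (simp add: c_def J_closed)
  qed
  define ya where "ya = (\<lambda>i. Y a i - (\<Sum>j\<in>I. c j * Y' j i))"
  have yaA: "vec_in A ya"
    unfolding ya_def vec_in_def
  proof (intro allI impI closed)
    show "Y a i \<in> A" if "i < d" for i using insert.prems(1)[of a] that by (simp add: vec_in_def)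
    show "c j \<in> A" "Y' j i \<in> A" if "i < d" "j \<in> I" for i j
      using c[THEN J_A] Y'(1) that by (simp_all add: vec_in_def)
  qed
  have yaJ: "vec_in J (\<lambda>i. ya i - Y a i)"
  proof -
    have "(\<Sum>j\<in>I. c j * Y' j i) \<in> J" if "i < d" for i
      using Y'(1) c that by (intro J_closed(7,4)) (auto simp: vec_in_def)
    then show ?thesis by (simp add: ya_def vec_in_def J_closed(5))
  qed
  have ya0: "b ya (Y' k) = 0" if k: "k \<in> I" for k
  proof -
    have "(\<Sum>j\<in>I. c j * b (Y' j) (Y' k)) = (\<Sum>j\<in>I. if j = k then c k * q k else 0)"
      using k orth by (intro sum.cong) (auto simp: q_def)
    also have "\<dots> = b (Y a) (Y' k)" using k insert.hyps q by (simp add: sum.delta c_def)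
    finally show ?thesis by (simp add: ya_def bform_linear)
  qed
  have waya: "b w ya = 0" if "\<And>j. j \<in> insert a I \<Longrightarrow> b w (Y j) = 0" for w
    using that perp[of w] by (simp add: ya_def bform_linear)
  show ?case
  proof (intro exI[of _ "Y'(a := ya)"] conjI ballI allI impI)
    fix j assume "j \<in> insert a I"
    then show "vec_in A ((Y'(a := ya)) j)" "vec_in J (\<lambda>i. (Y'(a := ya)) j i - Y j i)"
      using yaA yaJ Y' by auto
  next
    fix j k assume "j \<in> insert a I" "k \<in> insert a I" "j \<noteq> k"
    then show "b ((Y'(a := ya)) j) ((Y'(a := ya)) k) = 0"
      using ya0[of j] ya0[of k] orth[of j k] insert.hyps b_commute[of "Y' j" ya] by auto
  next
    fix w j assume "\<forall>j\<in>insert a I. b w (Y j) = 0" "j \<in> insert a I"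
    then show "b w ((Y'(a := ya)) j) = 0" using waya[of w] perp[of w] by auto
  qed
qed

text \<open>The retraction of a neighbourhood onto the scheme of orthogonal vectors: the isotropic
  vectors \<open>X i\<close>, \<open>i \<in> JB\<close>, are made exactly isotropic and orthogonal by moving them along the
  isotropic dual system \<open>Z\<close>, then the vectors in \<open>JN\<close> are projected to their orthogonal complement
  and orthogonalized by Gram-Schmidt, and those in \<open>JD\<close> are recomputed from their coefficients.\<close>

lemma orthogonal_retraction:
  assumes fin: "finite JN" "finite JB" "finite JD"
    and disj: "JN \<inter> JB = {}" "JN \<inter> JD = {}" "JB \<inter> JD = {}"
    and two: "(2::'l) \<noteq> 0"
    and X: "\<And>j. j \<in> JN \<union> JB \<union> JD \<Longrightarrow> vec_in A (X j)" and Z: "\<And>j. j \<in> JB \<Longrightarrow> vec_in A (Z j)"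
    and orth: "\<And>j k. j \<in> JN \<union> JB \<union> JD \<Longrightarrow> k \<in> JN \<union> JB \<union> JD \<Longrightarrow> j \<noteq> k \<Longrightarrow> b (X j) (X k) \<in> J"
    and q0: "\<And>j. j \<in> JN \<Longrightarrow> res (b (X j) (X j)) \<noteq> 0"
    and q1: "\<And>j. j \<in> JB \<Longrightarrow> b (X j) (X j) \<in> J"
    and biorth: "\<And>i l. i \<in> JB \<Longrightarrow> l \<in> JB \<Longrightarrow> b (X i) (Z l) = (if i = l then 1 else 0)"
    and iso: "\<And>i l. i \<in> JB \<Longrightarrow> l \<in> JB \<Longrightarrow> b (Z i) (Z l) = 0"
    and C: "\<And>j i. j \<in> JD \<Longrightarrow> i \<in> JB \<Longrightarrow> C j i \<in> A"
    and dep: "\<And>j. j \<in> JD \<Longrightarrow> vec_in J (\<lambda>a. X j a - (\<Sum>i\<in>JB. C j i * X i a))"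
  shows "\<exists>X'. (\<forall>j\<in>JN \<union> JB \<union> JD. vec_in J (\<lambda>i. X' j i - X j i))
    \<and> (\<forall>j\<in>JN \<union> JB \<union> JD. \<forall>k\<in>JN \<union> JB \<union> JD. j \<noteq> k \<longrightarrow> b (X' j) (X' k) = 0)"
proof -
  have J0: "vec_in J (\<lambda>i. v i - v i)" for v by (simp add: vec_in_def J_closed)
  define hf where "hf = inverse (2::'f)"
  have two': "(2::'f) \<in> A" "res 2 = 2"
    using closed(3)[OF one_closed one_closed] res_add[OF one_closed one_closed]
    by (simp_all add: res_one)
  have hf: "hf \<in> A" "2 * hf = 1"
  proof -
    show "hf \<in> A" unfolding hf_def by (rule inverse_closed) (simp_all add: two two' del: inverse_eq_divide)
    show "2 * hf = 1" using two two' by (auto simp: hf_def res_zero)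
  qed
  have bXX: "b (X i) (X l) \<in> J" if "i \<in> JB" "l \<in> JB" for i l
    using that orth[of i l] q1 by (cases "i = l") auto
  \<comment> \<open>Since the \<open>Z l\<close> are exactly isotropic, the correction contributes
    no quadratic term to \<open>b (W i) (W k)\<close>. The two linear terms each remove half of
    \<open>b (X i) (X k)\<close>, so one step reaches exact isotropy.\<close>
  define W where "W = (\<lambda>i a. X i a - (\<Sum>l\<in>JB. (hf * b (X i) (X l)) * Z l a))"
  have WJ: "vec_in J (\<lambda>a. W i a - X i a)" if "i \<in> JB" for i
  proof -
    have "(\<Sum>l\<in>JB. (hf * b (X i) (X l)) * Z l a) \<in> J" if "a < d" for a
      using Z bXX hf \<open>i \<in> JB\<close> that by (intro J_closed(7) J_closed(4)[OF _ J_closed(3)]) (auto simp: vec_in_def)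
    then show ?thesis by (simp add: W_def vec_in_def J_closed(5))
  qed
  have vecA: "vec_in A v" if "vec_in J (\<lambda>a. v a - w a)" "vec_in A w" for v w
    unfolding vec_in_def
  proof (intro allI impI)
    fix a assume "a < d"
    with that have "v a - w a \<in> J" "w a \<in> A" by (simp_all add: vec_in_def)
    then have "(v a - w a) + w a \<in> A" using add_closed J_A by blast
    then show "v a \<in> A" by simp
  qed
  have WA: "vec_in A (W i)" if "i \<in> JB" for i using that WJ X by (rule_tac vecA[of _ "X i"]) auto
  have WZ: "b (W i) (Z l) = (if i = l then 1 else 0)" if "i \<in> JB" "l \<in> JB" for i l
    using that by (simp add: W_def bform_linear biorth iso)
  have XZ: "(\<Sum>l\<in>JB. f l * b (X i) (Z l)) = f i" if "i \<in> JB" for i f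
  proof -
    have "(\<Sum>l\<in>JB. f l * b (X i) (Z l)) = (\<Sum>l\<in>JB. if l = i then f i else 0)"
      using that by (intro sum.cong) (auto simp: biorth)
    then show ?thesis using that fin by (simp add: sum.delta)
  qed
  have WW: "b (W i) (W k) = 0" if "i \<in> JB" "k \<in> JB" for i k
  proof -
    have "b (W i) (W k) = b (W i) (X k) - (\<Sum>l\<in>JB. (hf * b (X k) (X l)) * b (W i) (Z l))"
      by (subst W_def[THEN fun_cong, of k]) (simp only: bform_linear)
    also have "(\<Sum>l\<in>JB. (hf * b (X k) (X l)) * b (W i) (Z l)) = hf * b (X k) (X i)"
      using XZ[OF that(1), of "\<lambda>l. hf * b (X k) (X l)"] that by (simp add: WZ biorth)
    also have "b (W i) (X k) = b (X i) (X k) - hf * b (X i) (X k)"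
      using XZ[OF that(2), of "\<lambda>l. hf * b (X i) (X l)"]
      by (simp add: W_def bform_linear b_commute[of "Z _"])
    also have "b (X i) (X k) - hf * b (X i) (X k) - hf * b (X k) (X i) = (1 - 2 * hf) * b (X i) (X k)"
      by (simp add: b_commute[of "X k"] algebra_simps)
    finally show ?thesis by (simp add: hf)
  qed
  have WX: "b (W i) (X j) \<in> J" if "i \<in> JB" "j \<in> JN" for i j
  proof -
    have "b (W i) (X j) - b (X i) (X j) \<in> J"
      using that WJ WA X J0 by (intro b_cong_submodule[OF J_submodule]) auto
    moreover have "b (X i) (X j) \<in> J" using that disj by (intro orth) auto
    ultimately have "b (W i) (X j) - b (X i) (X j) + b (X i) (X j) \<in> J" by (rule J_closed(2))
    then show ?thesis by simp
  qed
  \<comment> \<open>By the duality \<open>WZ\<close> this correction makes \<open>Y j\<close>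
    exactly orthogonal to every \<open>W i\<close>.\<close>
  define Y where "Y = (\<lambda>j a. X j a - (\<Sum>i\<in>JB. b (W i) (X j) * Z i a))"
  have YJ: "vec_in J (\<lambda>a. Y j a - X j a)" if "j \<in> JN" for j
  proof -
    have "(\<Sum>i\<in>JB. b (W i) (X j) * Z i a) \<in> J" if "a < d" for a
      using Z WX \<open>j \<in> JN\<close> that by (intro J_closed(7,4)) (auto simp: vec_in_def)
    then show ?thesis by (simp add: Y_def vec_in_def J_closed(5))
  qed
  have YA: "vec_in A (Y j)" if "j \<in> JN" for j using that YJ X by (rule_tac vecA[of _ "X j"]) auto
  have WY: "b (W i) (Y j) = 0" if "i \<in> JB" "j \<in> JN" for i j
  proof -
    have "(\<Sum>l\<in>JB. b (W l) (X j) * b (W i) (Z l)) = (\<Sum>l\<in>JB. if l = i then b (W i) (X j) else 0)"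
      using that by (intro sum.cong) (auto simp: WZ)
    then show ?thesis using that fin by (simp add: Y_def bform_linear sum.delta)
  qed
  have YY: "b (Y j) (Y k) - b (X j) (X k) \<in> J" if "j \<in> JN" "k \<in> JN" for j k
    using that YJ YA X by (intro b_cong_submodule[OF J_submodule]) auto
  have "\<exists>Y'. (\<forall>j\<in>JN. vec_in A (Y' j) \<and> vec_in J (\<lambda>i. Y' j i - Y j i))
    \<and> (\<forall>j\<in>JN. \<forall>k\<in>JN. j \<noteq> k \<longrightarrow> b (Y' j) (Y' k) = 0)
    \<and> (\<forall>w. (\<forall>j\<in>JN. b w (Y j) = 0) \<longrightarrow> (\<forall>j\<in>JN. b w (Y' j) = 0))"
  proof (rule gram_schmidt[OF fin(1) YA])
    show "res (b (Y j) (Y j)) \<noteq> 0" if "j \<in> JN" for j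
    proof -
      have "res (b (Y j) (Y j) - b (X j) (X j)) = 0" using YY[OF that that] by (rule res_J)
      then show ?thesis using q0[OF that] that X YA by (simp add: res_diff b_closed)
    qed
    show "b (Y j) (Y k) \<in> J" if "j \<in> JN" "k \<in> JN" "j \<noteq> k" for j k
      using J_closed(2)[OF YY[OF that(1,2)] orth[of j k]] that by simp
  qed
  then obtain Y' where 1: "\<forall>j\<in>JN. vec_in A (Y' j) \<and> vec_in J (\<lambda>i. Y' j i - Y j i)"
    and 2: "\<forall>j\<in>JN. \<forall>k\<in>JN. j \<noteq> k \<longrightarrow> b (Y' j) (Y' k) = 0"
    and 3: "\<forall>w. (\<forall>j\<in>JN. b w (Y j) = 0) \<longrightarrow> (\<forall>j\<in>JN. b w (Y' j) = 0)"
    by (elim exE conjE)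
  have Y': "vec_in J (\<lambda>i. Y' j i - Y j i)" if "j \<in> JN" for j
    using 1 that by simp
  have Y'Y': "b (Y' j) (Y' k) = 0" if "j \<in> JN" "k \<in> JN" "j \<noteq> k" for j k
    using 2 that by simp
  have perp: "b w (Y' j) = 0" if "\<forall>j\<in>JN. b w (Y j) = 0" "j \<in> JN" for w j
    using 3[rule_format, of w j] that by simp
  have WY': "b (W i) (Y' j) = 0" if "i \<in> JB" "j \<in> JN" for i j
    by (rule perp) (use that WY in simp_all)
  define V where "V = (\<lambda>j a. \<Sum>i\<in>JB. C j i * W i a)"
  define X' where "X' = (\<lambda>j. if j \<in> JN then Y' j else if j \<in> JB then W j else V j)"
  have X'N: "X' j = Y' j" if "j \<in> JN" for j using that by (simp add: X'_def)
  have X'B: "X' j = W j" if "j \<in> JB" for j using that disj by (auto simp: X'_def)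
  have X'D: "X' j = V j" if "j \<in> JD" for j using that disj by (auto simp: X'_def)
  have Wperp: "b (W i) (X' j) = 0" if "i \<in> JB" "j \<in> JN \<union> JB \<union> JD" for i j
    using that by (auto simp: X'N X'B X'D WY' WW V_def bform_linear)
  have Vperp: "b (V k) (X' j) = 0" if "k \<in> JD" "j \<in> JN \<union> JB \<union> JD" for k j
    using that Wperp by (simp add: V_def bform_linear)
  have "vec_in J (\<lambda>a. X' j a - X j a)" if j: "j \<in> JN \<union> JB \<union> JD" for j
  proof -
    have trans: "vec_in J (\<lambda>a. u a - w a)"
      if "vec_in J (\<lambda>a. u a - v a)" "vec_in J (\<lambda>a. v a - w a)" for u v w
      unfolding vec_in_def
    proof (intro allI impI)
      fix a assume "a < d"
      with that have "(u a - v a) + (v a - w a) \<in> J" by (intro J_closed(2)) (simp_all add: vec_in_def)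
      then show "u a - w a \<in> J" by simp
    qed
    consider "j \<in> JN" | "j \<in> JB" | "j \<in> JD" using j by blast
    then show ?thesis
    proof cases
      case 1
      then show ?thesis using trans[OF Y' YJ] by (simp add: X'N)
    next
      case 2
      then show ?thesis using WJ by (simp add: X'B)
    next
      case 3
      have "V j a - X j a \<in> J" if "a < d" for a
      proof -
        have "(\<Sum>i\<in>JB. C j i * (W i a - X i a)) - (X j a - (\<Sum>i\<in>JB. C j i * X i a)) \<in> J"
        proof (rule J_closed(6)[OF J_closed(7)[OF J_closed(3)]])
          show "C j i \<in> A" "W i a - X i a \<in> J" if "i \<in> JB" for i
            using C[OF 3] WJ that \<open>a < d\<close> by (auto simp: vec_in_def)
          show "X j a - (\<Sum>i\<in>JB. C j i * X i a) \<in> J" using dep[OF 3] that by (simp add: vec_in_def)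
        qed
        then show ?thesis by (simp add: V_def right_diff_distrib sum_subtractf)
      qed
      then show ?thesis using 3 by (simp add: X'D vec_in_def)
    qed
  qed
  moreover have "b (X' j) (X' k) = 0"
    if jk: "j \<in> JN \<union> JB \<union> JD" "k \<in> JN \<union> JB \<union> JD" "j \<noteq> k" for j k
  proof -
    consider "j \<in> JN" "k \<in> JN" | "j \<in> JB \<union> JD" | "k \<in> JB \<union> JD" using jk by blast
    then show ?thesis
    proof cases
      case 1
      then show ?thesis using jk Y'Y' by (simp add: X'N)
    next
      case 2
      then show ?thesis using Wperp[of j k] Vperp[of j k] jk X'B X'D by auto
    next
      case 3
      then show ?thesis using Wperp[of k j] Vperp[of k j] jk X'B X'D b_commute[of "X' j"] by auto
    qed
  qed
  ultimately show ?thesis by blast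
qed

end

section \<open>Rigid configurations of orthogonal vectors\<close>

text \<open>Subtracting half the Gram matrix of \<open>z0\<close> along the \<open>x i\<close> makes
  the dual system isotropic, and the pairings with the \<open>x i\<close> stay the same because
  these are mutually orthogonal and isotropic. The explicit shape of \<open>z\<close> allows its
  pairings with further vectors to be computed.\<close>

lemma isotropic_dual:
  fixes \<beta> \<gamma> :: "nat \<Rightarrow> nat \<Rightarrow> 'l::field"
  assumes form: "sym_form d \<beta> \<gamma>" and two: "(2::'l) \<noteq> 0" and T: "finite T"
    and xx: "\<And>i k. i \<in> T \<Longrightarrow> k \<in> T \<Longrightarrow> bform d \<beta> (x i) (x k) = 0"
    and xz: "\<And>i k. i \<in> T \<Longrightarrow> k \<in> T \<Longrightarrow> bform d \<beta> (x i) (z0 k) = (if i = k then 1 else 0)"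
  obtains g z where "\<And>l. z l = (\<lambda>a. z0 l a - (\<Sum>i\<in>T. g l i * x i a))"
    "\<And>i k. i \<in> T \<Longrightarrow> k \<in> T \<Longrightarrow> bform d \<beta> (x i) (z k) = (if i = k then 1 else 0)"
    "\<And>i k. i \<in> T \<Longrightarrow> k \<in> T \<Longrightarrow> bform d \<beta> (z i) (z k) = 0"
proof -
  interpret sym_form d \<beta> \<gamma> by (fact form)
  define g where "g = (\<lambda>l i. b (z0 l) (z0 i) / 2)"
  have g: "g k l = g l k" "g l k + g l k = b (z0 l) (z0 k)" for l k
    using two by (simp_all add: g_def b_commute[of "z0 k" "z0 l"] field_simps)
  define z where "z = (\<lambda>l a. z0 l a - (\<Sum>i\<in>T. g l i * x i a))"
  have delta: "(\<Sum>i\<in>T. f i * (if i = k then 1 else 0)) = f k" if "k \<in> T" for f :: "_ \<Rightarrow> 'l" and k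
    using that T by (simp add: mult_delta_right sum.delta)
  have xz': "b (x i) (z k) = (if i = k then 1 else 0)" if "i \<in> T" "k \<in> T" for i k
    using that xx by (simp add: z_def bform_linear xz)
  have zz: "b (z l) (z k) = 0" if "l \<in> T" "k \<in> T" for l k
  proof -
    have "b (z l) (z k) = b (z l) (z0 k) - (\<Sum>i\<in>T. g k i * b (z l) (x i))"
      by (subst z_def[THEN fun_cong, of k]) (simp only: bform_linear)
    moreover have "(\<Sum>i\<in>T. g k i * b (z l) (x i)) = (\<Sum>i\<in>T. g k i * (if i = l then 1 else 0))"
      using that by (intro sum.cong) (auto simp: xz' b_commute[of "z l"])
    moreover have "b (z l) (z0 k) = b (z0 l) (z0 k) - (\<Sum>i\<in>T. g l i * b (x i) (z0 k))"
      by (simp add: z_def bform_linear)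
    moreover have "(\<Sum>i\<in>T. g l i * b (x i) (z0 k)) = (\<Sum>i\<in>T. g l i * (if i = k then 1 else 0))"
      using that by (intro sum.cong) (auto simp: xz)
    ultimately show ?thesis using that g(1)[of k l] by (simp add: delta flip: g(2))
  qed
  have "z l = (\<lambda>a. z0 l a - (\<Sum>i\<in>T. g l i * x i a))" for l by (simp add: z_def)
  then show ?thesis by (rule that) (simp_all add: xz' zz)
qed

context
  fixes d :: nat and \<beta> \<gamma> :: "nat \<Rightarrow> nat \<Rightarrow> 'l::field"
  assumes form: "sym_form d \<beta> \<gamma>" and two: "(2::'l) \<noteq> 0"
begin

interpretation sym_form d \<beta> \<gamma> by (fact form)

text \<open>The hypothesis \<open>rigid\<close> says that along a line \<open>x + \<epsilon> w\<close> of pairwise orthogonal families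
  isotropic members stay isotropic.\<close>

lemma rigid_configuration:
  fixes x :: "nat \<Rightarrow> nat \<Rightarrow> 'l"
  assumes fin: "finite N"
    and orth: "\<And>j k. j \<in> N \<Longrightarrow> k \<in> N \<Longrightarrow> j \<noteq> k \<Longrightarrow> b (x j) (x k) = 0"
    and rigid: "\<And>w i. (\<And>j k. j \<in> N \<Longrightarrow> k \<in> N \<Longrightarrow> j \<noteq> k \<Longrightarrow>
        b (x j) (w k) + b (w j) (x k) = 0 \<and> b (w j) (w k) = 0) \<Longrightarrow>
      i \<in> N \<Longrightarrow> b (x i) (x i) = 0 \<Longrightarrow> b (x i) (w i) = 0 \<and> b (w i) (w i) = 0"
  obtains JN JB JD z where "JN \<union> JB \<union> JD = N" "JN \<inter> JB = {}" "JN \<inter> JD = {}" "JB \<inter> JD = {}"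
    "\<And>j. j \<in> JN \<Longrightarrow> b (x j) (x j) \<noteq> 0" "\<And>j. j \<in> JB \<Longrightarrow> b (x j) (x j) = 0"
    "\<And>i l. i \<in> JB \<Longrightarrow> l \<in> JB \<Longrightarrow> b (x i) (z l) = (if i = l then 1 else 0)"
    "\<And>v a. JB \<union> JD \<noteq> {} \<Longrightarrow> a < d \<Longrightarrow> v a = (\<Sum>j\<in>JN. b v (x j) / b (x j) (x j) * x j a)
        + (\<Sum>i\<in>JB. b v (z i) * x i a) + (\<Sum>i\<in>JB. b v (x i) * z i a)"
    "\<And>i. i \<in> JB \<Longrightarrow> \<exists>D. \<forall>l\<in>JB.
        (\<Sum>j\<in>JD. \<Sum>k\<in>JD - {j}. D j k * (b (x j) (z l) * b (x k) (z l))) = (if l = i then 1 else 0)"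
proof -
  define q where "q = (\<lambda>j. b (x j) (x j))"
  define JN where "JN = {j\<in>N. q j \<noteq> 0}"
  define I where "I = {j\<in>N. q j = 0}"
  have NI: "JN \<inter> I = {}" "JN \<union> I = N" by (auto simp: JN_def I_def)
  have finI: "finite JN" "finite I" using fin by (simp_all add: JN_def I_def)
  have II: "b (x j) (x k) = 0" if "j \<in> I" "k \<in> I" for j k
    using that orth[of j k] by (cases "j = k") (auto simp: I_def q_def)
  have IN: "b (x j) (x k) = 0" "b (x k) (x j) = 0" if "j \<in> I" "k \<in> JN" for j k
    using that orth[of j k] orth[of k j] by (auto simp: I_def JN_def)
  have NN: "b (x j) (x k) = (if j = k then q j else 0)" if "j \<in> JN" "k \<in> JN" for j k
    using that orth[of j k] by (auto simp: JN_def q_def)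
  \<comment> \<open>A maximal independent set \<open>T\<close> of isotropic vectors is chosen,
    independence being expressed by the existence of a dual system.\<close>
  define dual where "dual = (\<lambda>T z. \<forall>i\<in>T. \<forall>l\<in>T. b (x i) (z l) = (if i = l then 1 else 0))"
  define TT where "TT = {T. T \<subseteq> I \<and> (\<exists>z. dual T z)}"
  have "finite TT" using finI by (simp add: TT_def)
  moreover have "TT \<noteq> {}" by (auto simp: TT_def dual_def intro!: exI[of _ "{}"])
  ultimately have "\<exists>T\<in>TT. \<forall>T'\<in>TT. T \<subseteq> T' \<longrightarrow> T = T'" by (rule finite_has_maximal)
  then obtain T where T: "T \<in> TT" and max: "\<And>T'. T' \<in> TT \<Longrightarrow> T \<subseteq> T' \<Longrightarrow> T = T'" by blast
  have TI: "T \<subseteq> I" using T by (simp add: TT_def)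
  obtain z0 where z0: "dual T z0" using T by (auto simp: TT_def)
  have finT: "finite T" using TI finI finite_subset by blast
  define JD where "JD = I - T"
  have dep0: "x j a = (\<Sum>l\<in>T. b (x j) (z0 l) * x l a)" if "j \<in> JD" "a < d" for j a
  proof (rule ccontr)
    assume ne: "\<not> ?thesis"
    have "\<exists>z'. dual (insert j T) z'"
      unfolding dual_def
    proof (rule dual_system_insert[OF form finT, of j x z0 a])
      show "b (x i) (z0 l) = (if i = l then 1 else 0)" if "i \<in> T" "l \<in> T" for i l
        using z0 that by (simp add: dual_def)
    qed (use that ne in \<open>auto simp: JD_def\<close>)
    then have "insert j T \<in> TT" using that TI by (auto simp: TT_def JD_def)
    then have "T = insert j T" by (rule max) blast
    then show False using that by (auto simp: JD_def)
  qed
  have delta: "(\<Sum>i\<in>S. f i * (if i = k then g i else 0)) = (if k \<in> S then f k * g k else 0)"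
    "(\<Sum>i\<in>S. f i * (if k = i then g i else 0)) = (if k \<in> S then f k * g k else 0)"
    if "finite S" for S k and f g :: "nat \<Rightarrow> 'l"
    using that by (simp_all add: mult_delta_right sum.delta sum.delta')
  define p where "p = (\<lambda>v j. b v (x j) / q j)"
  have pq: "p v j * q j = b v (x j)" if "j \<in> JN" for v j
    using that by (simp add: p_def JN_def)
  have pN: "(\<Sum>j\<in>JN. p v j * b (x j) (x k)) = b v (x k)" if "k \<in> JN" for v k
  proof -
    have "(\<Sum>j\<in>JN. p v j * b (x j) (x k)) = (\<Sum>j\<in>JN. p v j * (if j = k then q j else 0))"
      using that by (intro sum.cong) (simp_all add: NN)
    then show ?thesis using that finI by (simp add: delta pq)
  qed
  \<comment> \<open>Removing the components along \<open>JN\<close> makes the dual system orthogonal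
    to the non-isotropic vectors and keeps its pairings with the isotropic ones.\<close>
  define z1 where "z1 = (\<lambda>l a. z0 l a - (\<Sum>j\<in>JN. p (z0 l) j * x j a))"
  have z1I: "b (x i) (z1 l) = b (x i) (z0 l)" if "i \<in> I" for i l
    using that IN by (simp add: z1_def bform_linear)
  have z1N: "b (z1 l) (x k) = 0" if "k \<in> JN" for k l
    using pN[OF that] by (simp add: z1_def bform_linear)
  obtain g z where z: "\<And>l. z l = (\<lambda>a. z1 l a - (\<Sum>i\<in>T. g l i * x i a))"
    and zT: "\<And>i l. i \<in> T \<Longrightarrow> l \<in> T \<Longrightarrow> b (x i) (z l) = (if i = l then 1 else 0)"
    and zz: "\<And>l k. l \<in> T \<Longrightarrow> k \<in> T \<Longrightarrow> b (z l) (z k) = 0"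
  proof (rule isotropic_dual[OF form two finT, of x z1])
    show "b (x i) (x k) = 0" if "i \<in> T" "k \<in> T" for i k using that TI by (intro II) auto
    show "b (x i) (z1 k) = (if i = k then 1 else 0)" if "i \<in> T" "k \<in> T" for i k
      using that TI z0 by (auto simp: z1I dual_def)
  qed blast
  have zT': "b (z l) (x i) = (if i = l then 1 else 0)" if "i \<in> T" "l \<in> T" for i l
    using zT[OF that] by (simp only: b_commute[of "z l" "x i"])
  have zI: "b (x i) (z l) = b (x i) (z0 l)" if "i \<in> I" for i l
  proof -
    have "(\<Sum>k\<in>T. g l k * b (x i) (x k)) = 0"
      using that TI II by (intro sum.neutral) auto
    then show ?thesis using that by (simp add: z bform_linear z1I)
  qed
  have zN: "b (x k) (z l) = 0" "b (z l) (x k) = 0" if "k \<in> JN" for k l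
  proof -
    have "(\<Sum>i\<in>T. g l i * b (x i) (x k)) = 0"
      using that TI IN by (intro sum.neutral) auto
    then show "b (z l) (x k) = 0" using that by (simp add: z bform_linear z1N)
    then show "b (x k) (z l) = 0" by (simp only: b_commute)
  qed
  define c where "c = (\<lambda>j l. b (x j) (z l))"
  have dep: "x j a = (\<Sum>l\<in>T. c j l * x l a)" if "j \<in> I" "a < d" for j a
  proof (cases "j \<in> T")
    case True
    then have "(\<Sum>l\<in>T. c j l * x l a) = (\<Sum>l\<in>T. x l a * (if j = l then 1 else 0))"
      by (intro sum.cong) (auto simp: c_def zT)
    then show ?thesis using True finT by (simp add: delta)
  next
    case False
    then show ?thesis using dep0[of j a] that zI[of j] by (simp add: c_def JD_def)
  qed
  \<comment> \<open>\<open>P\<close> projects to the orthogonal complement of all the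
    \<open>x j\<close> and \<open>z i\<close>. The claim \<open>complete\<close> below says that
    this complement is zero.\<close>
  define P where "P = (\<lambda>v a. v a - ((\<Sum>j\<in>JN. p v j * x j a)
        + (\<Sum>i\<in>T. b v (z i) * x i a) + (\<Sum>i\<in>T. b v (x i) * z i a)))"
  have PN: "b (P v) (x k) = 0" if k: "k \<in> JN" for v k
  proof -
    have "(\<Sum>i\<in>T. b v (z i) * b (x i) (x k)) = 0"
      using k TI IN by (intro sum.neutral) auto
    then show ?thesis using zN[OF k] pN[OF k] by (simp add: P_def bform_linear)
  qed
  have PT: "b (P v) (x k) = 0" if k: "k \<in> T" for v k
  proof -
    have "(\<Sum>j\<in>JN. p v j * b (x j) (x k)) = 0"
      using k TI IN by (intro sum.neutral) auto
    moreover have "(\<Sum>i\<in>T. b v (z i) * b (x i) (x k)) = 0"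
      using k TI II by (intro sum.neutral) auto
    moreover have "(\<Sum>i\<in>T. b v (x i) * b (z i) (x k)) = (\<Sum>i\<in>T. b v (x i) * (if k = i then 1 else 0))"
      using k by (intro sum.cong) (auto simp: zT')
    moreover have "\<dots> = b v (x k)" using k finT by (simp add: delta)
    ultimately show ?thesis by (simp add: P_def bform_linear)
  qed
  have Pz: "b (P v) (z k) = 0" if k: "k \<in> T" for v k
  proof -
    have "(\<Sum>i\<in>T. b v (z i) * b (x i) (z k)) = (\<Sum>i\<in>T. b v (z i) * (if i = k then 1 else 0))"
      using k by (intro sum.cong) (auto simp: zT)
    moreover have "\<dots> = b v (z k)" using k finT by (simp add: delta)
    moreover have "(\<Sum>i\<in>T. b v (x i) * b (z i) (z k)) = 0"
      using k by (intro sum.neutral) (auto simp: zz)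
    ultimately show ?thesis using k zN by (simp add: P_def bform_linear)
  qed
  have Px: "b (P v) (x k) = 0" if k: "k \<in> N" for v k
  proof (cases "k \<in> JN")
    case False
    then have "k \<in> I" using k NI by blast
    then have "b (P v) (x k) = b (P v) (\<lambda>a. \<Sum>l\<in>T. c k l * x l a)"
      by (intro bform_cong) (auto simp flip: dep)
    then show ?thesis by (simp add: bform_linear PT)
  qed (rule PN)
  have PP: "b (P v) (P w) = b (P v) w" for v w
    by (subst P_def[THEN fun_cong, of w]) (simp only: bform_linear, simp add: PN PT Pz)
  have complete: "P v a = 0" if "T \<union> JD \<noteq> {}" "a < d" for v a
  proof -
    have "I \<noteq> {}" using that(1) TI by (auto simp: JD_def)
    then obtain i where i: "i \<in> I" by blast
    have Pq: "b (P v) (P v) = 0" for v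
    proof -
      \<comment> \<open>Moving the single isotropic vector \<open>x i\<close> in the direction
        \<open>P v\<close> keeps the family orthogonal, because \<open>P v\<close> is orthogonal to
        every \<open>x k\<close>; rigidity makes \<open>P v\<close> isotropic. Polarization then
        kills the form on the image of \<open>P\<close>. The existence of an isotropic
        \<open>x i\<close> is what the condition \<open>T \<union> JD \<noteq> {}\<close>
        provides.\<close>
      define w where "w = (\<lambda>j a. if j = i then P v a else 0)"
      have wi: "w i = P v" by (simp add: w_def)
      have w0: "w j = (\<lambda>a. 0)" if "j \<noteq> i" for j using that by (simp add: w_def)
      have "b (x i) (w i) = 0 \<and> b (w i) (w i) = 0"
      proof (rule rigid)
        fix j k assume "j \<in> N" "k \<in> N" "j \<noteq> k"
        then show "b (x j) (w k) + b (w j) (x k) = 0 \<and> b (w j) (w k) = 0"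
          using Px b_commute[of "x j" "P v"] by (cases "j = i"; cases "k = i") (auto simp: wi w0 bform_linear)
      qed (use i in \<open>auto simp: I_def q_def\<close>)
      then show ?thesis by (simp add: wi)
    qed
    have "b (P v) w = 0" for w
    proof -
      have "P (\<lambda>a. v a + w a) = (\<lambda>a. P v a + P w a)"
        by (rule ext) (simp add: P_def p_def bform_linear add_divide_distrib distrib_right sum.distrib)
      then have "b (P v) (P w) + b (P w) (P v) = 0"
        using Pq[of "\<lambda>a. v a + w a"] Pq[of v] Pq[of w] by (simp add: bform_linear)
      then have "2 * b (P v) (P w) = 0" by (simp only: b_commute[of "P w" "P v"] mult_2)
      then show ?thesis using two by (simp add: PP)
    qed
    then show ?thesis using b_dual_basis[OF that(2), of "P v"] by simp
  qed
  define S where "S = Sigma JD (\<lambda>j. JD - {j})"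
  have finS: "finite JD" "finite S" using finI by (simp_all add: JD_def S_def)
  have "\<exists>D. \<forall>i\<in>T. \<forall>l\<in>T. (\<Sum>w\<in>S. c (fst w) l * c (snd w) l * D i w) = (if l = i then 1 else 0)"
  proof (rule matrix_right_inverse[OF finT finS(2)])
    fix h assume h: "\<And>w. w \<in> S \<Longrightarrow> (\<Sum>i\<in>T. h i * (c (fst w) i * c (snd w) i)) = 0"
    define H where "H = (\<lambda>j k. \<Sum>i\<in>T. h i * (c j i * c k i))"
    have H0: "H j k = 0" if "j \<in> JD" "k \<in> JD" "j \<noteq> k" for j k
      using h[of "(j, k)"] that by (simp add: H_def S_def)
    \<comment> \<open>A functional \<open>h\<close> that annihilates all products gives a
      deformation of the \<open>x j\<close> along the \<open>z i\<close>, with sign plus on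
      \<open>T\<close> and minus on \<open>JD\<close>. The linear term
      \<open>(s k + s j) * H j k\<close> cancels between \<open>T\<close> and \<open>JD\<close>; for
      two distinct indices in \<open>T\<close>, or two in \<open>JD\<close>, or an index in
      \<open>JN\<close>, \<open>H j k\<close> itself is zero. As \<open>b (x i) (w i)\<close> equals
      \<open>h i\<close> on \<open>T\<close>, rigidity gives \<open>h i = 0\<close>.\<close>
    define s where "s = (\<lambda>j. if j \<in> T then 1 else if j \<in> JD then - 1 else 0 :: 'l)"
    define w where "w = (\<lambda>j a. s j * (\<Sum>i\<in>T. h i * c j i * z i a))"
    have xw: "b (x j) (w k) = s k * H j k" "b (w k) (x j) = s k * H j k" for j k
    proof -
      show "b (x j) (w k) = s k * H j k"
        by (simp add: w_def bform_linear H_def c_def sum_distrib_left mult_ac)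
      then show "b (w k) (x j) = s k * H j k" by (simp add: b_commute)
    qed
    have ww: "b (w j) (w k) = 0" for j k
      using zz by (simp add: w_def bform_linear)
    have Hsym: "H j k = H k j" for j k by (simp add: H_def mult_ac)
    have HN: "H j k = 0" if "j \<in> JN \<or> k \<in> JN" for j k
      using that zN by (auto simp: H_def c_def)
    have HT: "H j k = 0" if "j \<in> T" "k \<in> T" "j \<noteq> k" for j k
      unfolding H_def using that by (intro sum.neutral) (auto simp: c_def zT)
    have wi: "b (x i) (w i) = 0 \<and> b (w i) (w i) = 0" if "i \<in> T" for i
    proof (rule rigid)
      fix j k assume jk: "j \<in> N" "k \<in> N" "j \<noteq> k"
      have "(s k + s j) * H j k = 0"
      proof (cases "j \<in> JN \<or> k \<in> JN")
        case True
        then show ?thesis by (simp add: HN)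
      next
        case False
        then have "j \<in> T \<or> j \<in> JD" "k \<in> T \<or> k \<in> JD" using jk NI by (auto simp: JD_def)
        then show ?thesis using jk H0[of j k] HT[of j k] by (auto simp: s_def JD_def)
      qed
      then show "b (x j) (w k) + b (w j) (x k) = 0 \<and> b (w j) (w k) = 0"
        by (simp add: xw ww Hsym[of k j] distrib_right)
    qed (use that TI in \<open>auto simp: I_def q_def\<close>)
    show "\<forall>i\<in>T. h i = 0"
    proof
      fix i assume i: "i \<in> T"
      have "H i i = (\<Sum>l\<in>T. h l * (if i = l then 1 else 0))"
        unfolding H_def using i by (intro sum.cong) (auto simp: c_def zT)
      then show "h i = 0" using wi[OF i] i finT by (simp add: xw s_def delta)
    qed
  qed
  then obtain D where D: "\<And>i l. i \<in> T \<Longrightarrow> l \<in> T \<Longrightarrow>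
      (\<Sum>w\<in>S. c (fst w) l * c (snd w) l * D i w) = (if l = i then 1 else 0)"
    by blast
  show ?thesis
  proof (rule that[of JN T JD z])
    show "JN \<union> T \<union> JD = N" "JN \<inter> T = {}" "JN \<inter> JD = {}" "T \<inter> JD = {}"
      using NI TI by (auto simp: JD_def)
    show "b (x j) (x j) \<noteq> 0" if "j \<in> JN" for j using that by (simp add: JN_def q_def)
    show "b (x j) (x j) = 0" if "j \<in> T" for j using that TI by (auto simp: I_def q_def)
    show "v a = (\<Sum>j\<in>JN. b v (x j) / b (x j) (x j) * x j a)
        + (\<Sum>i\<in>T. b v (z i) * x i a) + (\<Sum>i\<in>T. b v (x i) * z i a)" if "T \<union> JD \<noteq> {}" "a < d" for v a
      using complete[OF that, of v] by (simp add: P_def p_def q_def)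
    show "\<exists>D. \<forall>l\<in>T. (\<Sum>j\<in>JD. \<Sum>k\<in>JD - {j}. D j k * (b (x j) (z l) * b (x k) (z l)))
        = (if l = i then 1 else 0)" if "i \<in> T" for i
      using D[OF that] finS
      by (intro exI[of _ "\<lambda>j k. D i (j, k)"])
        (simp add: S_def c_def sum.Sigma case_prod_unfold mult.commute)
  qed (rule zT)
qed

end

section \<open>Evaluation of polynomials\<close>

lemma comm_ring_homI:
  fixes h :: "'a::comm_ring_1 \<Rightarrow> 'b::comm_ring_1"
  assumes "h 1 = 1" "\<And>x y. h (x + y) = h x + h y" "\<And>x y. h (x * y) = h x * h y"
  shows "comm_ring_hom h"
proof -
  have "h 0 = 0" using assms(2)[of 0 0] by simp
  with assms show ?thesis by unfold_locales auto
qed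

lemma comm_ring_hom_comp:
  assumes "comm_ring_hom f" "comm_ring_hom g"
  shows "comm_ring_hom (\<lambda>x. f (g x))"
proof -
  interpret f: comm_ring_hom f by fact
  interpret g: comm_ring_hom g by fact
  show ?thesis by (rule comm_ring_homI) (simp_all add: f.hom_add f.hom_mult g.hom_add g.hom_mult)
qed

lemma comm_ring_hom_id: "comm_ring_hom (\<lambda>x. x)"
  by (rule comm_ring_homI) simp_all

lemma comm_ring_hom_const: "comm_ring_hom (mpoly_const :: 'k::comm_ring_1 \<Rightarrow> ('v, 'k) mpoly)"
  by (rule comm_ring_homI) (simp_all add: mpoly_const_def single_add mult_single)

lemma mpoly_sum_monomials:
  assumes "finite K" "Poly_Mapping.keys p \<subseteq> K"
  shows "p = (\<Sum>m\<in>K. Poly_Mapping.single m (Poly_Mapping.lookup p m))"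
proof (rule poly_mapping_eqI)
  fix m
  show "Poly_Mapping.lookup p m
      = Poly_Mapping.lookup (\<Sum>m\<in>K. Poly_Mapping.single m (Poly_Mapping.lookup p m)) m"
    using assms by (auto simp: lookup_sum lookup_single when_def in_keys_iff sum.delta)
qed

lemma mpoly_monom_induct [case_names add monom]:
  assumes "\<And>p q. P p \<Longrightarrow> P q \<Longrightarrow> P (p + q)"
    and "\<And>m c. P (Poly_Mapping.single m c)"
  shows "P (p :: ('v, 'k::comm_ring_1) mpoly)"
proof -
  have "P (\<Sum>m\<in>K. Poly_Mapping.single m (Poly_Mapping.lookup p m))" if "finite K" for K
    using that
  proof (induction K rule: finite_induct)
    case empty
    then show ?case using assms(2)[of 0 0] by simp
  qed (simp add: assms)
  note * = this
  show ?thesis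
    by (subst mpoly_sum_monomials[of "Poly_Mapping.keys p" p]) (simp_all only: finite_keys order_refl *)
qed

lemma mpoly_induct [case_names const var add mult]:
  assumes c: "\<And>c. P (mpoly_const c)" and v: "\<And>v. P (mpoly_var v)"
    and a: "\<And>p q. P p \<Longrightarrow> P q \<Longrightarrow> P (p + q)"
    and m: "\<And>p q. P p \<Longrightarrow> P q \<Longrightarrow> P (p * q)"
  shows "P (p :: ('v, 'k::comm_ring_1) mpoly)"
proof -
  have vk: "P (Poly_Mapping.single (Poly_Mapping.single v k) 1)" for v :: 'v and k :: nat
  proof (induction k)
    case 0
    then show ?case using c[of 1] by (simp add: mpoly_const_def)
  next
    case (Suc k)
    have "Poly_Mapping.single (Poly_Mapping.single v (Suc k)) (1::'k)
        = mpoly_var v * Poly_Mapping.single (Poly_Mapping.single v k) 1"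
      by (simp add: mpoly_var_def mult_single single_add[symmetric])
    then show ?case using m[OF v Suc] by simp
  qed
  have "P (Poly_Mapping.single (\<Sum>v\<in>V. Poly_Mapping.single v (Poly_Mapping.lookup e v)) 1)"
    if "finite V" for V and e :: "'v \<Rightarrow>\<^sub>0 nat"
    using that
  proof (induction V rule: finite_induct)
    case empty
    then show ?case using c[of 1] by (simp add: mpoly_const_def)
  next
    case (insert v V)
    have "Poly_Mapping.single (\<Sum>v\<in>insert v V. Poly_Mapping.single v (Poly_Mapping.lookup e v)) (1::'k)
        = Poly_Mapping.single (Poly_Mapping.single v (Poly_Mapping.lookup e v)) 1
          * Poly_Mapping.single (\<Sum>v\<in>V. Poly_Mapping.single v (Poly_Mapping.lookup e v)) 1"
      using insert.hyps by (simp add: mult_single)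
    then show ?case using m[OF vk insert.IH] by simp
  qed
  note * = this
  have mono: "P (Poly_Mapping.single e 1)" for e
    by (subst mpoly_sum_monomials[of "Poly_Mapping.keys e" e]) (simp_all only: finite_keys order_refl *)
  have "P (Poly_Mapping.single e c)" for e c
    using m[OF assms(1)[of c] mono[of e]] by (simp add: mpoly_const_def mult_single)
  then show ?thesis by (induction p rule: mpoly_monom_induct) (auto intro: a)
qed

lemma mpoly_hom_eqI:
  fixes f g :: "('v, 'k::comm_ring_1) mpoly \<Rightarrow> 'b::comm_ring_1"
  assumes "comm_ring_hom f" "comm_ring_hom g"
    and "\<And>c. f (mpoly_const c) = g (mpoly_const c)" "\<And>v. f (mpoly_var v) = g (mpoly_var v)"
  shows "f p = g p"
proof -
  interpret f: comm_ring_hom f by fact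
  interpret g: comm_ring_hom g by fact
  show ?thesis
    by (induction p rule: mpoly_induct)
      (simp_all add: assms f.hom_add f.hom_mult g.hom_add g.hom_mult)
qed

definition monomial_eval :: "('v \<Rightarrow> 'b::comm_ring_1) \<Rightarrow> ('v \<Rightarrow>\<^sub>0 nat) \<Rightarrow> 'b" where
  "monomial_eval x m = (\<Prod>v\<in>Poly_Mapping.keys m. x v ^ Poly_Mapping.lookup m v)"

definition mpoly_eval :: "('k::comm_ring_1 \<Rightarrow> 'b::comm_ring_1) \<Rightarrow> ('v \<Rightarrow> 'b) \<Rightarrow> ('v, 'k) mpoly \<Rightarrow> 'b" where
  "mpoly_eval \<iota> x p = (\<Sum>m\<in>Poly_Mapping.keys p. \<iota> (Poly_Mapping.lookup p m) * monomial_eval x m)"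

lemma monomial_eval_superset:
  assumes "finite K" "Poly_Mapping.keys m \<subseteq> K"
  shows "monomial_eval x m = (\<Prod>v\<in>K. x v ^ Poly_Mapping.lookup m v)"
  unfolding monomial_eval_def using assms
  by (intro prod.mono_neutral_left) (auto simp: in_keys_iff)

lemma monomial_eval_add: "monomial_eval x (m + m') = monomial_eval x m * monomial_eval x m'"
proof -
  let ?K = "Poly_Mapping.keys m \<union> Poly_Mapping.keys m'"
  have "monomial_eval x (m + m') = (\<Prod>v\<in>?K. x v ^ Poly_Mapping.lookup (m + m') v)"
    using Poly_Mapping.keys_add[of m m'] by (intro monomial_eval_superset) auto
  also have "\<dots> = (\<Prod>v\<in>?K. x v ^ Poly_Mapping.lookup m v) * (\<Prod>v\<in>?K. x v ^ Poly_Mapping.lookup m' v)"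
    by (simp add: lookup_add power_add prod.distrib)
  also have "\<dots> = monomial_eval x m * monomial_eval x m'"
    by (simp add: monomial_eval_superset[of ?K])
  finally show ?thesis .
qed

context
  fixes \<iota> :: "'k::comm_ring_1 \<Rightarrow> 'b::comm_ring_1"
  assumes \<iota>: "comm_ring_hom \<iota>"
begin

interpretation \<iota>: comm_ring_hom \<iota> by (fact \<iota>)

lemma mpoly_eval_superset:
  assumes "finite K" "Poly_Mapping.keys p \<subseteq> K"
  shows "mpoly_eval \<iota> x p = (\<Sum>m\<in>K. \<iota> (Poly_Mapping.lookup p m) * monomial_eval x m)"
  unfolding mpoly_eval_def using assms
  by (intro sum.mono_neutral_left) (auto simp: in_keys_iff)

lemma mpoly_eval_add: "mpoly_eval \<iota> x (p + q) = mpoly_eval \<iota> x p + mpoly_eval \<iota> x q"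
proof -
  let ?K = "Poly_Mapping.keys p \<union> Poly_Mapping.keys q"
  have "mpoly_eval \<iota> x (p + q) = (\<Sum>m\<in>?K. \<iota> (Poly_Mapping.lookup (p + q) m) * monomial_eval x m)"
    using Poly_Mapping.keys_add[of p q] by (intro mpoly_eval_superset) auto
  also have "\<dots> = mpoly_eval \<iota> x p + mpoly_eval \<iota> x q"
    by (simp add: mpoly_eval_superset[of ?K] lookup_add \<iota>.hom_add distrib_right sum.distrib)
  finally show ?thesis .
qed

lemma mpoly_eval_single: "mpoly_eval \<iota> x (Poly_Mapping.single m c) = \<iota> c * monomial_eval x m"
  by (subst mpoly_eval_superset[of "{m}"]) auto

lemma mpoly_eval_const: "mpoly_eval \<iota> x (mpoly_const c) = \<iota> c"
  by (simp add: mpoly_const_def mpoly_eval_single monomial_eval_def)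

lemma mpoly_eval_var: "mpoly_eval \<iota> x (mpoly_var v) = x v"
  by (simp add: mpoly_var_def mpoly_eval_single monomial_eval_def)

lemma mpoly_eval_hom: "comm_ring_hom (mpoly_eval \<iota> x)"
proof (rule comm_ring_homI)
  show "mpoly_eval \<iota> x 1 = 1"
    using mpoly_eval_const[of x 1] by (simp add: mpoly_const_def)
  fix p q :: "('a, 'k) mpoly"
  show "mpoly_eval \<iota> x (p + q) = mpoly_eval \<iota> x p + mpoly_eval \<iota> x q" by (rule mpoly_eval_add)
  show "mpoly_eval \<iota> x (p * q) = mpoly_eval \<iota> x p * mpoly_eval \<iota> x q"
  proof (induction p rule: mpoly_monom_induct)
    case (monom m c)
    show ?case
      by (induction q rule: mpoly_monom_induct)
        (simp_all add: distrib_left distrib_right mpoly_eval_add mult_single mpoly_eval_single monomial_eval_add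
          \<iota>.hom_mult mult_ac)
  qed (simp add: distrib_right mpoly_eval_add)
qed

end

lemma mpoly_eval_unique:
  assumes "comm_ring_hom h"
  shows "h p = mpoly_eval (\<lambda>c. h (mpoly_const c)) (\<lambda>v. h (mpoly_var v)) p"
proof -
  have c: "comm_ring_hom (\<lambda>c. h (mpoly_const c))"
    by (rule comm_ring_hom_comp[OF assms comm_ring_hom_const])
  show ?thesis
    by (rule mpoly_hom_eqI[OF assms mpoly_eval_hom[OF c]])
      (simp_all add: mpoly_eval_const[OF c] mpoly_eval_var[OF c])
qed

section \<open>Prime ideals and localization in the fraction field\<close>

text \<open>Ideals of a ring that is a whole type, so that type-class algebra is available. The
  locale \<open>presentation\<close> connects them with the record-based rings of the
  statement.\<close>

definition is_ideal :: "'a::comm_ring_1 set \<Rightarrow> bool" where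
  "is_ideal I \<longleftrightarrow> 0 \<in> I \<and> (\<forall>a\<in>I. \<forall>b\<in>I. a + b \<in> I) \<and> (\<forall>a. \<forall>b\<in>I. a * b \<in> I)"

definition is_prime :: "'a::comm_ring_1 set \<Rightarrow> bool" where
  "is_prime P \<longleftrightarrow> is_ideal P \<and> 1 \<notin> P \<and> (\<forall>a b. a * b \<in> P \<longrightarrow> a \<in> P \<or> b \<in> P)"

lemma is_ideal_zero: "is_ideal I \<Longrightarrow> 0 \<in> I"
  and is_ideal_add: "is_ideal I \<Longrightarrow> a \<in> I \<Longrightarrow> b \<in> I \<Longrightarrow> a + b \<in> I"
  and is_ideal_mult: "is_ideal I \<Longrightarrow> b \<in> I \<Longrightarrow> a * b \<in> I"
  and is_ideal_mult': "is_ideal I \<Longrightarrow> b \<in> I \<Longrightarrow> b * a \<in> I"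
  unfolding is_ideal_def by (auto simp: mult.commute)

lemma is_ideal_uminus: "is_ideal I \<Longrightarrow> a \<in> I \<Longrightarrow> - a \<in> I"
  using is_ideal_mult[of I a "- 1"] by simp

lemma is_prime_ideal: "is_prime P \<Longrightarrow> is_ideal P"
  by (simp add: is_prime_def)

lemma is_prime_kernel:
  fixes h :: "'a::comm_ring_1 \<Rightarrow> 'b::idom"
  assumes "comm_ring_hom h"
  shows "is_prime {a. h a = 0}"
proof -
  interpret h: comm_ring_hom h by fact
  show ?thesis by (auto simp: is_prime_def is_ideal_def h.hom_add h.hom_mult)
qed

lemma comm_ring_hom_Fract: "comm_ring_hom (\<lambda>a :: 'a::idom. Fract a 1)"
  by (rule comm_ring_homI) (simp_all add: One_fract_def)

text \<open>A homomorphism to a field stands for a point of the spectrum, its kernel being the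
  prime. The localization at this prime is the set \<open>loc UNIV\<close> inside the fraction
  field, so that the local rings at all primes share one type.\<close>

locale residue_map = comm_ring_hom ev for ev :: "'a::idom \<Rightarrow> 'l::field"
begin

definition loc :: "'a set \<Rightarrow> 'a fract set" where
  "loc I = {Fract a g | a g. a \<in> I \<and> ev g \<noteq> 0}"

definition res :: "'a fract \<Rightarrow> 'l" where
  "res x = (THE y. \<exists>a g. x = Fract a g \<and> ev g \<noteq> 0 \<and> y = ev a / ev g)"

lemma ev_nonzero: "ev g \<noteq> 0 \<Longrightarrow> g \<noteq> 0"
  by auto

lemma res_Fract:
  assumes "ev g \<noteq> 0"
  shows "res (Fract a g) = ev a / ev g"
  unfolding res_def
proof (rule the_equality)
  show "\<exists>a' g'. Fract a g = Fract a' g' \<and> ev g' \<noteq> 0 \<and> ev a / ev g = ev a' / ev g'"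
    using assms by blast
  fix y assume "\<exists>a' g'. Fract a g = Fract a' g' \<and> ev g' \<noteq> 0 \<and> y = ev a' / ev g'"
  then obtain a' g' where y: "Fract a g = Fract a' g'" "ev g' \<noteq> 0" "y = ev a' / ev g'" by blast
  then have "a * g' = a' * g" using assms ev_nonzero by (simp add: eq_fract)
  then have "ev a * ev g' = ev a' * ev g" by (simp flip: hom_mult)
  then show "y = ev a / ev g" using y assms by (simp add: frac_eq_eq)
qed

lemma locI: "a \<in> I \<Longrightarrow> ev g \<noteq> 0 \<Longrightarrow> Fract a g \<in> loc I"
  by (auto simp: loc_def)

lemma Fract_one_in_loc: "a \<in> I \<Longrightarrow> Fract a 1 \<in> loc I"
  by (auto intro: locI)

lemma res_Fract_one: "res (Fract a 1) = ev a"
  by (simp add: res_Fract)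

lemma Fract_one_loc_iff:
  assumes "is_ideal I" "Fract a 1 \<in> loc I"
  shows "\<exists>g. ev g \<noteq> 0 \<and> g * a \<in> I"
proof -
  from assms(2) obtain c g where c: "Fract a 1 = Fract c g" "c \<in> I" "ev g \<noteq> 0" by (auto simp: loc_def)
  then have "a * g = c" using ev_nonzero by (simp add: eq_fract)
  then show ?thesis using c by (auto simp: mult.commute)
qed

sublocale local_subring "loc UNIV" res
proof
  show "1 \<in> loc UNIV" by (auto simp: One_fract_def intro: locI)
  show "res 1 = 1" by (simp add: One_fract_def res_Fract)
  fix x y assume "x \<in> loc UNIV" "y \<in> loc UNIV"
  then obtain a g c k where x: "x = Fract a g" "ev g \<noteq> 0" and y: "y = Fract c k" "ev k \<noteq> 0"
    by (auto simp: loc_def)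
  have nz: "g \<noteq> 0" "k \<noteq> 0" "ev (g * k) \<noteq> 0" using x y ev_nonzero by (auto simp: hom_mult)
  show "x + y \<in> loc UNIV" "x * y \<in> loc UNIV" "- x \<in> loc UNIV"
    using nz x y by (auto intro!: locI)
  show "res (x + y) = res x + res y" "res (x * y) = res x * res y"
    using nz x y by (simp_all add: res_Fract hom_add hom_mult field_simps)
next
  fix x assume "x \<in> loc UNIV" "res x \<noteq> 0"
  then obtain a g where x: "x = Fract a g" "ev g \<noteq> 0" by (auto simp: loc_def)
  then have "ev a \<noteq> 0" using \<open>res x \<noteq> 0\<close> by (auto simp: res_Fract)
  then show "inverse x \<in> loc UNIV" using x by (auto intro: locI)
qed

lemma loc_submodule:
  assumes I: "is_ideal I"
  shows "submodule (loc I)"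
  unfolding submodule_def
proof (intro conjI ballI)
  show "0 \<in> loc I" using is_ideal_zero[OF I] by (auto simp: Zero_fract_def intro: locI)
next
  fix x y assume "x \<in> loc I" "y \<in> loc I"
  then obtain a g c k where x: "x = Fract a g" "ev g \<noteq> 0" "a \<in> I" and y: "y = Fract c k" "ev k \<noteq> 0" "c \<in> I"
    by (auto simp: loc_def)
  have nz: "g \<noteq> 0" "k \<noteq> 0" "ev (g * k) \<noteq> 0" using x y ev_nonzero by (auto simp: hom_mult)
  then show "x + y \<in> loc I"
    using x y I by (auto intro!: locI is_ideal_add is_ideal_mult')
next
  fix x y assume "x \<in> loc UNIV" "y \<in> loc I"
  then obtain a g c k where x: "x = Fract a g" "ev g \<noteq> 0" and y: "y = Fract c k" "ev k \<noteq> 0" "c \<in> I"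
    by (auto simp: loc_def)
  then show "x * y \<in> loc I" using I by (auto intro!: locI is_ideal_mult simp: hom_mult)
qed

lemma loc_subset: "loc I \<subseteq> loc UNIV"
  by (auto simp: loc_def)

lemma res_loc:
  assumes "\<And>a. a \<in> I \<Longrightarrow> ev a = 0" "x \<in> loc I"
  shows "res x = 0"
  using assms by (auto simp: loc_def res_Fract)

text \<open>Together with \<open>common_annihilator\<close> this spreads results out from the local
  ring at a point to a neighbourhood: finitely many coefficients become polynomials, and finitely
  many local relations become true, after multiplication by one function that does not vanish at the
  point.\<close>

lemma common_denominator:
  assumes "finite E" "E \<subseteq> loc UNIV"
  shows "\<exists>g. ev g \<noteq> 0 \<and> (\<forall>e\<in>E. \<exists>a. Fract g 1 * e = Fract a 1)"
  using assms
proof (induction E rule: finite_induct)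
  case empty
  show ?case by (rule exI[of _ 1]) simp
next
  case (insert e E)
  then obtain g where g: "ev g \<noteq> 0" "\<forall>e\<in>E. \<exists>a. Fract g 1 * e = Fract a 1" by auto
  from insert.prems obtain c k where e: "e = Fract c k" "ev k \<noteq> 0" by (auto simp: loc_def)
  have "k \<noteq> 0" using e ev_nonzero by auto
  have "\<exists>a. Fract (g * k) 1 * e' = Fract a 1" if e': "e' \<in> insert e E" for e'
  proof (cases "e' = e")
    case True
    have "Fract (g * k) 1 * e = Fract (g * c) 1"
      using \<open>k \<noteq> 0\<close> by (simp add: e eq_fract)
    then show ?thesis using True by blast
  next
    case False
    then obtain a where a: "Fract g 1 * e' = Fract a 1" using e' g by auto
    have "Fract (g * k) 1 = Fract k 1 * Fract g 1" by (simp add: mult.commute)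
    then have "Fract (g * k) 1 * e' = Fract k 1 * (Fract g 1 * e')"
      by (simp only: mult.assoc)
    also have "\<dots> = Fract (k * a) 1" by (simp add: a)
    finally show ?thesis by blast
  qed
  then show ?case using g e by (intro exI[of _ "g * k"]) (simp add: hom_mult)
qed

lemma common_annihilator:
  assumes I: "is_ideal I" and "finite E" "\<And>a. a \<in> E \<Longrightarrow> Fract a 1 \<in> loc I"
  shows "\<exists>g. ev g \<noteq> 0 \<and> (\<forall>a\<in>E. g * a \<in> I)"
  using assms(2,3)
proof (induction E rule: finite_induct)
  case empty
  show ?case by (rule exI[of _ 1]) simp
next
  case (insert a E)
  then obtain g where g: "ev g \<noteq> 0" "\<forall>a\<in>E. g * a \<in> I" by auto
  obtain k where k: "ev k \<noteq> 0" "k * a \<in> I" using Fract_one_loc_iff[OF I] insert.prems by blast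
  have "(g * k) * e \<in> I" if "e \<in> insert a E" for e
  proof (cases "e = a")
    case True
    then show ?thesis using is_ideal_mult[OF I k(2), of g] by (simp add: mult.assoc)
  next
    case False
    then have "g * e \<in> I" using that g by auto
    then show ?thesis using is_ideal_mult[OF I, of "g * e" k] by (simp add: mult_ac)
  qed
  then show ?case using g k by (intro exI[of _ "g * k"]) (simp add: hom_mult)
qed

end

section \<open>Scalar extension\<close>

definition mpoly_map :: "('k::comm_ring_1 \<Rightarrow> 'l::comm_ring_1) \<Rightarrow> ('v, 'k) mpoly \<Rightarrow> ('v, 'l) mpoly" where
  "mpoly_map \<iota> = mpoly_eval (\<lambda>c. mpoly_const (\<iota> c)) mpoly_var"

context
  fixes \<iota> :: "'k::field \<Rightarrow> 'l::field"
  assumes \<iota>: "comm_ring_hom \<iota>"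
begin

interpretation \<iota>: comm_ring_hom \<iota> by (fact \<iota>)

lemma const_\<iota>: "comm_ring_hom (\<lambda>c. mpoly_const (\<iota> c) :: ('v, 'l) mpoly)"
  by (rule comm_ring_hom_comp[OF comm_ring_hom_const \<iota>])

lemma mpoly_map_hom: "comm_ring_hom (mpoly_map \<iota>)"
  unfolding mpoly_map_def by (rule mpoly_eval_hom[OF const_\<iota>])

lemma mpoly_map_const: "mpoly_map \<iota> (mpoly_const c) = mpoly_const (\<iota> c)"
  unfolding mpoly_map_def by (rule mpoly_eval_const[OF const_\<iota>])

lemma mpoly_map_var: "mpoly_map \<iota> (mpoly_var v) = mpoly_var v"
  unfolding mpoly_map_def by (rule mpoly_eval_var[OF const_\<iota>])

lemma mpoly_eval_map: "mpoly_eval (\<lambda>c. c) x (mpoly_map \<iota> p) = mpoly_eval \<iota> x p"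
  by (rule mpoly_hom_eqI[OF comm_ring_hom_comp[OF mpoly_eval_hom[OF comm_ring_hom_id] mpoly_map_hom]
        mpoly_eval_hom[OF \<iota>]])
    (simp_all add: mpoly_map_const mpoly_map_var mpoly_eval_const[OF comm_ring_hom_id]
      mpoly_eval_var[OF comm_ring_hom_id] mpoly_eval_const[OF \<iota>] mpoly_eval_var[OF \<iota>])

definition functional :: "('l \<Rightarrow> 'k) \<Rightarrow> bool" where
  "functional \<phi> \<longleftrightarrow> (\<forall>x y. \<phi> (x + y) = \<phi> x + \<phi> y) \<and> (\<forall>c x. \<phi> (\<iota> c * x) = c * \<phi> x)"

lemma functional_zero: "functional \<phi> \<Longrightarrow> \<phi> 0 = 0"
  unfolding functional_def using mult_zero_right[of "\<iota> 0"] mult_zero_left[of "\<phi> 0"] by metis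

lemma lookup_map_functional:
  "functional \<phi> \<Longrightarrow> Poly_Mapping.lookup (Poly_Mapping.map \<phi> p) m = \<phi> (Poly_Mapping.lookup p m)"
  by (simp add: Poly_Mapping.map.rep_eq when_def functional_zero)

lemma map_functional_add:
  "functional \<phi> \<Longrightarrow> Poly_Mapping.map \<phi> (p + q) = Poly_Mapping.map \<phi> p + Poly_Mapping.map \<phi> q"
  by (rule poly_mapping_eqI) (simp add: lookup_map_functional lookup_add functional_def)

lemma map_functional_single:
  "functional \<phi> \<Longrightarrow> Poly_Mapping.map \<phi> (Poly_Mapping.single m c) = Poly_Mapping.single m (\<phi> c)"
  by (rule poly_mapping_eqI) (simp add: lookup_map_functional lookup_single when_def functional_zero)

text \<open>Applied to the coefficients, a linear functional is linear over the polynomials with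
  coefficients in the small field, and so carries the extended ideal back into the original one. It
  is enough to check constants and variables, with arbitrary \<open>a\<close>.\<close>

lemma map_functional_mult:
  assumes \<phi>: "functional \<phi>"
  shows "Poly_Mapping.map \<phi> (a * mpoly_map \<iota> p) = Poly_Mapping.map \<phi> a * p"
proof -
  interpret h: comm_ring_hom "mpoly_map \<iota>" by (rule mpoly_map_hom)
  have c: "Poly_Mapping.map \<phi> (a * mpoly_const (\<iota> c)) = Poly_Mapping.map \<phi> a * mpoly_const c"
    for a :: "('v, 'l) mpoly" and c
    using \<phi> by (induction a rule: mpoly_monom_induct)
      (simp_all add: algebra_simps map_functional_add map_functional_single mpoly_const_def
        mult_single functional_def)
  have v: "Poly_Mapping.map \<phi> (a * mpoly_var v) = Poly_Mapping.map \<phi> a * mpoly_var v"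
    for a :: "('v, 'l) mpoly" and v
    using \<phi> by (induction a rule: mpoly_monom_induct)
      (simp_all add: distrib_right map_functional_add map_functional_single mpoly_var_def mult_single)
  show ?thesis
    by (induction p arbitrary: a rule: mpoly_induct)
      (simp_all add: c v mpoly_map_const mpoly_map_var h.hom_add h.hom_mult distrib_left
        map_functional_add[OF \<phi>] mult.assoc[symmetric])
qed

inductive_set extended_ideal :: "('v, 'k) mpoly set \<Rightarrow> ('v, 'l) mpoly set" for I where
  zero: "0 \<in> extended_ideal I"
| step: "y \<in> extended_ideal I \<Longrightarrow> p \<in> I \<Longrightarrow> y + a * mpoly_map \<iota> p \<in> extended_ideal I"

lemma extended_ideal_ideal: "is_ideal (extended_ideal I)"
  unfolding is_ideal_def
proof (intro conjI ballI allI)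
  show "0 \<in> extended_ideal I" by (rule zero)
  fix a x assume x: "x \<in> extended_ideal I"
  show "x + y \<in> extended_ideal I" if "y \<in> extended_ideal I" for y
    using that x by induction (simp_all add: add.assoc[symmetric] step)
  show "a * x \<in> extended_ideal I"
    using x by induction (simp_all add: zero distrib_left mult.assoc[symmetric] step)
qed

lemma map_in_extended_ideal: "p \<in> I \<Longrightarrow> mpoly_map \<iota> p \<in> extended_ideal I"
  using step[OF zero, of p I 1] by simp

lemma eval_extended_ideal:
  assumes "y \<in> extended_ideal I" "\<And>p. p \<in> I \<Longrightarrow> mpoly_eval \<iota> x p = 0"
  shows "mpoly_eval (\<lambda>c. c) x y = 0"
proof -
  interpret h: comm_ring_hom "mpoly_eval (\<lambda>c. c) x" by (rule mpoly_eval_hom[OF comm_ring_hom_id])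
  show ?thesis using assms(1)
    by induction (simp_all add: h.hom_add h.hom_mult mpoly_eval_map assms(2))
qed

lemma functional_extended_ideal:
  fixes I :: "('v, 'k) mpoly set"
  assumes \<phi>: "functional \<phi>" and I: "is_ideal I" and "y \<in> extended_ideal I"
  shows "Poly_Mapping.map \<phi> y \<in> I"
  using assms(3)
proof induction
  case zero
  have "Poly_Mapping.map \<phi> (0 :: ('v, 'l) mpoly) = 0"
    by (rule poly_mapping_eqI) (simp add: lookup_map_functional \<phi> functional_zero)
  then show ?case using is_ideal_zero[OF I] by simp
next
  case (step y p a)
  then show ?case
    by (simp add: map_functional_add[OF \<phi>] map_functional_mult[OF \<phi>] is_ideal_add[OF I] is_ideal_mult[OF I])
qed

text \<open>Faithful flatness of the scalar extension, at a point with coordinates in the large field: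
  a basis of the large field over the small one splits \<open>g\<close> into polynomials over the small field,
  and one of them does not vanish at the point.\<close>

lemma extended_ideal_descent:
  assumes I: "is_ideal I" and r: "g * mpoly_map \<iota> r \<in> extended_ideal I"
    and g: "mpoly_eval (\<lambda>c. c) x g \<noteq> 0"
  shows "\<exists>h. mpoly_eval \<iota> x h \<noteq> 0 \<and> h * r \<in> I"
proof -
  interpret V: vector_space "\<lambda>c v. \<iota> c * v"
    by unfold_locales (simp_all add: distrib_left distrib_right \<iota>.hom_add \<iota>.hom_mult mult.assoc)
  define E where "E = V.extend_basis {}"
  have E: "V.independent E" "\<And>v. v \<in> V.span E"
    using V.independent_extend_basis[OF V.independent_empty] V.span_extend_basis[OF V.independent_empty]
    by (simp_all add: E_def)
  define R where "R = V.representation E"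
  have fn: "functional (\<lambda>v. R v e)" for e
    unfolding functional_def R_def
    using V.representation_add[OF E(1) E(2) E(2)] V.representation_scale[OF E(1) E(2)] by simp
  define F where "F = (\<Union>m\<in>Poly_Mapping.keys g. {e. R (Poly_Mapping.lookup g m) e \<noteq> 0})"
  have F: "finite F" unfolding F_def R_def by (simp add: V.finite_representation)
  have rep: "(\<Sum>e\<in>F. \<iota> (R (Poly_Mapping.lookup g m) e) * e) = Poly_Mapping.lookup g m"
    if "m \<in> Poly_Mapping.keys g" for m
  proof -
    have "(\<Sum>e\<in>F. \<iota> (R (Poly_Mapping.lookup g m) e) * e)
        = (\<Sum>e | R (Poly_Mapping.lookup g m) e \<noteq> 0. \<iota> (R (Poly_Mapping.lookup g m) e) * e)"
      using that F by (intro sum.mono_neutral_right) (auto simp: F_def)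
    then show ?thesis unfolding R_def by (simp add: V.sum_nonzero_representation_eq[OF E(1) E(2)])
  qed
  define G where "G = (\<lambda>e. Poly_Mapping.map (\<lambda>v. R v e) g)"
  have keysG: "Poly_Mapping.keys (G e) \<subseteq> Poly_Mapping.keys g" for e
    unfolding G_def by (auto simp: in_keys_iff lookup_map_functional[OF fn] functional_zero[OF fn])
  have evG: "mpoly_eval \<iota> x (G e)
      = (\<Sum>m\<in>Poly_Mapping.keys g. \<iota> (R (Poly_Mapping.lookup g m) e) * monomial_eval x m)" for e
    by (subst mpoly_eval_superset[OF \<iota> finite_keys keysG])
      (simp add: G_def lookup_map_functional[OF fn])
  have "mpoly_eval (\<lambda>c. c) x g
      = (\<Sum>m\<in>Poly_Mapping.keys g. (\<Sum>e\<in>F. \<iota> (R (Poly_Mapping.lookup g m) e) * e) * monomial_eval x m)"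
    unfolding mpoly_eval_def by (intro sum.cong) (simp_all add: rep)
  also have "\<dots> = (\<Sum>e\<in>F. e * mpoly_eval \<iota> x (G e))"
    unfolding evG sum_distrib_left sum_distrib_right
    by (subst sum.swap) (simp add: mult_ac)
  finally have ev: "mpoly_eval (\<lambda>c. c) x g = (\<Sum>e\<in>F. e * mpoly_eval \<iota> x (G e))" .
  obtain e where e: "mpoly_eval \<iota> x (G e) \<noteq> 0"
  proof (rule ccontr)
    assume "\<not> thesis"
    then have "mpoly_eval \<iota> x (G e) = 0" for e using that by blast
    then show False using g ev by simp
  qed
  have "G e * r \<in> I"
    using functional_extended_ideal[OF fn I r, of e] by (simp add: G_def map_functional_mult[OF fn])
  with e show ?thesis by blast
qed

end

section \<open>The ideal of pairwise orthogonal vectors\<close>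

lemma bform_hom:
  assumes "comm_ring_hom h"
  shows "h (bform d \<beta> u v) = bform d (\<lambda>i j. h (\<beta> i j)) (\<lambda>i. h (u i)) (\<lambda>i. h (v i))"
proof -
  interpret h: comm_ring_hom h by fact
  show ?thesis by (simp add: bform_def h.hom_sum h.hom_mult)
qed

lemma sym_form_hom:
  assumes "comm_ring_hom h" "sym_form d \<beta> \<gamma>"
  shows "sym_form d (\<lambda>i j. h (\<beta> i j)) (\<lambda>i j. h (\<gamma> i j))"
proof -
  interpret h: comm_ring_hom h by fact
  interpret sym_form d \<beta> \<gamma> by fact
  show ?thesis
  proof
    show "h (\<beta> i j) = h (\<beta> j i)" if "i < d" "j < d" for i j using that sym by simp
    fix i l assume "i < d" "l < d"
    then have "h (\<Sum>j<d. \<beta> i j * \<gamma> j l) = h (if i = l then 1 else 0)" by (simp add: inverse)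
    then show "(\<Sum>j<d. h (\<beta> i j) * h (\<gamma> j l)) = (if i = l then 1 else 0)"
      by (simp add: h.hom_sum h.hom_mult split: if_splits)
  qed
qed

type_synonym 'k pt_poly = "(nat \<times> nat, 'k) mpoly"

definition gram :: "('k::field vec \<Rightarrow> 'k vec \<Rightarrow> 'k) \<Rightarrow> nat \<Rightarrow> nat \<Rightarrow> nat \<Rightarrow> 'k" where
  "gram B d i j = B (unit_vec d i) (unit_vec d j)"

definition column :: "nat \<Rightarrow> nat \<Rightarrow> 'k::field pt_poly" where
  "column j i = mpoly_var (i, j)"

definition poly_form :: "('k::field vec \<Rightarrow> 'k vec \<Rightarrow> 'k) \<Rightarrow> nat \<Rightarrow> (nat \<Rightarrow> 'k pt_poly) \<Rightarrow> (nat \<Rightarrow> 'k pt_poly) \<Rightarrow> 'k pt_poly" where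
  "poly_form B d = bform d (\<lambda>i j. mpoly_const (gram B d i j))"

text \<open>The ideal \<open>I(d,n)\<close> extended by the variables outside the generic matrix, so that the
  quotient can be taken in the ring of all polynomials.\<close>

definition restrict_vars :: "nat \<Rightarrow> nat \<Rightarrow> 'k::field pt_poly \<Rightarrow> 'k pt_poly" where
  "restrict_vars d n = mpoly_eval mpoly_const (\<lambda>v. if v \<in> {..<d} \<times> {..<n} then mpoly_var v else 0)"

definition relations :: "('k::field vec \<Rightarrow> 'k vec \<Rightarrow> 'k) \<Rightarrow> nat \<Rightarrow> nat \<Rightarrow> 'k pt_poly set" where
  "relations B d n = {p. restrict_vars d n p \<in> orth_ideal d n B}"

lemma restrict_vars_hom: "comm_ring_hom (restrict_vars d n :: 'k::field pt_poly \<Rightarrow> _)"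
  unfolding restrict_vars_def by (rule mpoly_eval_hom[OF comm_ring_hom_const])

lemma restrict_vars_const: "restrict_vars d n (mpoly_const c) = mpoly_const c"
  unfolding restrict_vars_def by (rule mpoly_eval_const[OF comm_ring_hom_const])

lemma restrict_vars_var:
  "restrict_vars d n (mpoly_var v) = (if v \<in> {..<d} \<times> {..<n} then mpoly_var v else 0)"
  unfolding restrict_vars_def by (rule mpoly_eval_var[OF comm_ring_hom_const])

lemma carrier_orth_poly_ring:
  "carrier (orth_poly_ring d n)
    = {p :: 'k::field pt_poly. \<forall>m \<in> Poly_Mapping.keys p. Poly_Mapping.keys m \<subseteq> {..<d} \<times> {..<n}}"
  by (simp add: orth_poly_ring_def mpoly_ring_def)

lemma orth_poly_ring_ops:
  "x \<otimes>\<^bsub>orth_poly_ring d n\<^esub> y = x * y" "x \<oplus>\<^bsub>orth_poly_ring d n\<^esub> y = x + y"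
  "\<zero>\<^bsub>orth_poly_ring d n\<^esub> = 0" "\<one>\<^bsub>orth_poly_ring d n\<^esub> = 1"
  by (simp_all add: orth_poly_ring_def mpoly_ring_def)

lemma orth_poly_cring: "cring (orth_poly_ring d n :: 'k::field pt_poly ring)"
  unfolding orth_poly_ring_def by (rule cring_mpoly_ring)

lemma const_in_carrier: "mpoly_const c \<in> carrier (orth_poly_ring d n)"
  by (auto simp: carrier_orth_poly_ring mpoly_const_def)

lemma var_in_carrier: "v \<in> {..<d} \<times> {..<n} \<Longrightarrow> mpoly_var v \<in> carrier (orth_poly_ring d n)"
  by (auto simp: carrier_orth_poly_ring mpoly_var_def)

lemma restrict_vars_carrier: "restrict_vars d n p \<in> carrier (orth_poly_ring d n :: 'k::field pt_poly ring)"
proof -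
  interpret h: comm_ring_hom "restrict_vars d n :: 'k pt_poly \<Rightarrow> _" by (rule restrict_vars_hom)
  interpret cring "orth_poly_ring d n :: 'k pt_poly ring" by (rule orth_poly_cring)
  show ?thesis
  proof (induction p rule: mpoly_induct)
    case (const c)
    then show ?case by (simp add: restrict_vars_const const_in_carrier)
  next
    case (var v)
    then show ?case using var_in_carrier[of v d n] zero_closed
      by (auto simp: restrict_vars_var orth_poly_ring_ops)
  next
    case (add p q)
    then show ?case using a_closed[of "restrict_vars d n p" "restrict_vars d n q"]
      by (simp add: h.hom_add orth_poly_ring_ops)
  next
    case (mult p q)
    then show ?case using m_closed[of "restrict_vars d n p" "restrict_vars d n q"]
      by (simp add: h.hom_mult orth_poly_ring_ops)
  qed
qed

lemma restrict_vars_id: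
  assumes "p \<in> carrier (orth_poly_ring d n)"
  shows "restrict_vars d n p = p"
proof -
  define x :: "nat \<times> nat \<Rightarrow> 'a pt_poly" where "x = (\<lambda>v. if v \<in> {..<d} \<times> {..<n} then mpoly_var v else 0)"
  have "restrict_vars d n p = mpoly_eval mpoly_const mpoly_var p"
    unfolding restrict_vars_def mpoly_eval_def monomial_eval_def
    using assms by (intro sum.cong prod.cong arg_cong2[of _ _ _ _ "(*)"] refl)
      (auto simp: carrier_orth_poly_ring)
  also have "\<dots> = p"
    using mpoly_eval_unique[OF comm_ring_hom_id, of p] by simp
  finally show ?thesis .
qed

lemma extend_form_columns:
  assumes "j < n" "k < n"
  shows "extend_form d B (col (generic_matrix d n) j) (col (generic_matrix d n) k)
    = poly_form B d (column j) (column k)"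
  using assms unfolding extend_form_def poly_form_def bform_def gram_def column_def generic_matrix_def
  by (intro sum.cong) auto

lemma orth_ideal_alt:
  "orth_ideal d n B = Idl\<^bsub>orth_poly_ring d n\<^esub> {poly_form B d (column j) (column k) | j k. j < k \<and> k < n}"
proof -
  have "{extend_form d B (col (generic_matrix d n) j) (col (generic_matrix d n) k) | j k. j < k \<and> k < n}
    = {poly_form B d (column j) (column k) | j k. j < k \<and> k < n}"
    using extend_form_columns[where B = B and d = d and n = n] by (smt (verit) Collect_cong order_less_trans)
  then show ?thesis by (simp add: orth_ideal_def)
qed

lemma restrict_vars_poly_form:
  assumes "j < n" "k < n"
  shows "restrict_vars d n (poly_form B d (column j) (column k)) = poly_form B d (column j) (column k)"
  unfolding poly_form_def bform_hom[OF restrict_vars_hom] restrict_vars_const using assms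
  by (intro bform_cong) (simp_all add: column_def restrict_vars_var)

lemma generators_in_carrier:
  "{poly_form B d (column j) (column k) | j k. j < k \<and> k < n} \<subseteq> carrier (orth_poly_ring d n)"
  by clarify (metis order_less_trans restrict_vars_poly_form restrict_vars_carrier)

lemma orth_ideal_ideal: "ideal (orth_ideal d n B) (orth_poly_ring d n)"
proof -
  interpret cring "orth_poly_ring d n :: 'a pt_poly ring" by (rule orth_poly_cring)
  show ?thesis unfolding orth_ideal_alt by (rule genideal_ideal[OF generators_in_carrier])
qed

lemma relations_ideal: "is_ideal (relations B d n)"
proof -
  interpret h: comm_ring_hom "restrict_vars d n :: 'a pt_poly \<Rightarrow> _" by (rule restrict_vars_hom)
  interpret I: ideal "orth_ideal d n B" "orth_poly_ring d n" by (rule orth_ideal_ideal)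
  show ?thesis
    unfolding is_ideal_def relations_def
    using additive_subgroup.zero_closed[OF I.additive_subgroup_axioms]
      additive_subgroup.a_closed[OF I.additive_subgroup_axioms] I.I_l_closed[OF _ restrict_vars_carrier]
    by (auto simp: h.hom_add h.hom_mult orth_poly_ring_ops)
qed

lemma sym_poly_form:
  assumes "sym_form d (gram B d) \<gamma>"
  shows "sym_form d (\<lambda>i j. mpoly_const (gram B d i j) :: 'k::field pt_poly) (\<lambda>i j. mpoly_const (\<gamma> i j))"
  by (rule sym_form_hom[OF comm_ring_hom_const assms])

lemma poly_form_in_relations:
  assumes "sym_form d (gram B d) \<gamma>" "j < n" "k < n" "j \<noteq> k"
  shows "poly_form B d (column j) (column k) \<in> relations B d n"
proof -
  interpret cring "orth_poly_ring d n :: 'a pt_poly ring" by (rule orth_poly_cring)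
  have *: "poly_form B d (column j) (column k) \<in> relations B d n" if "j < k" "k < n" for j k
    using that genideal_self[OF generators_in_carrier[of B d n]]
    by (auto simp: relations_def restrict_vars_poly_form orth_ideal_alt)
  have "poly_form B d (column j) (column k) = poly_form B d (column k) (column j)"
    unfolding poly_form_def by (rule sym_form.b_commute[OF sym_poly_form[OF assms(1)]])
  then show ?thesis using *[of j k] *[of k j] assms by (cases "j < k") auto
qed

lemma var_in_relations:
  assumes "v \<notin> {..<d} \<times> {..<n}"
  shows "mpoly_var v \<in> relations B d n"
proof -
  interpret I: ideal "orth_ideal d n B" "orth_poly_ring d n" by (rule orth_ideal_ideal)
  show ?thesis using assms additive_subgroup.zero_closed[OF I.additive_subgroup_axioms] by (simp add: relations_def restrict_vars_var orth_poly_ring_ops)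
qed

text \<open>The universal property of the scheme, from which its points, lines and retractions are
  obtained. A homomorphism that kills the outer variables is unchanged by
  \<open>restrict_vars\<close>, and its kernel in the polynomial ring of the statement is an ideal
  containing the generators.\<close>

lemma hom_relations_zero:
  fixes h :: "'k::field pt_poly \<Rightarrow> 'b::comm_ring_1"
  assumes h: "comm_ring_hom h"
    and var: "\<And>v. v \<notin> {..<d} \<times> {..<n} \<Longrightarrow> h (mpoly_var v) = 0"
    and gen: "\<And>j k. j < n \<Longrightarrow> k < n \<Longrightarrow> j \<noteq> k \<Longrightarrow> h (poly_form B d (column j) (column k)) = 0"
    and p: "p \<in> relations B d n"
  shows "h p = 0"
proof -
  interpret h: comm_ring_hom h by fact
  interpret cring "orth_poly_ring d n :: 'k pt_poly ring" by (rule orth_poly_cring)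
  let ?S = "orth_poly_ring d n :: 'k pt_poly ring"
  let ?Z = "{p \<in> carrier ?S. h p = 0}"
  have "ideal ?Z ?S"
  proof (rule idealI[OF ring_axioms])
    show "subgroup ?Z (add_monoid ?S)"
    proof (rule add.subgroupI)
      fix p assume p: "p \<in> ?Z"
      have "\<ominus>\<^bsub>?S\<^esub> p = - p"
        using p by (intro minus_equality) (simp_all add: orth_poly_ring_ops carrier_orth_poly_ring)
      then show "\<ominus>\<^bsub>?S\<^esub> p \<in> ?Z"
        using p a_inv_closed[of p] by (simp add: h.hom_uminus)
    next
      have "\<zero>\<^bsub>?S\<^esub> \<in> ?Z"
        using zero_closed by (simp add: orth_poly_ring_ops)
      then show "?Z \<noteq> {}" by blast
    next
      fix p q assume "p \<in> ?Z"
        "q \<in> ?Z"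
      then show "p \<oplus>\<^bsub>?S\<^esub> q \<in> ?Z"
        using a_closed[of p q] by (simp add: orth_poly_ring_ops h.hom_add)
    qed auto
    fix p q :: "'k pt_poly"
    assume "p \<in> ?Z" "q \<in> carrier ?S"
    then show "q \<otimes>\<^bsub>?S\<^esub> p \<in> ?Z"
      "p \<otimes>\<^bsub>?S\<^esub> q \<in> ?Z"
      using m_closed[of p q] m_closed[of q p] by (simp_all add: orth_poly_ring_ops h.hom_mult)
  qed
  moreover have "{poly_form B d (column j) (column k) | j k. j < k \<and> k < n}
      \<subseteq> ?Z"
    using generators_in_carrier[of B d n] gen by fastforce
  ultimately have "orth_ideal d n B \<subseteq> ?Z"
    unfolding orth_ideal_alt by (rule genideal_minimal)
  then have "h (restrict_vars d n p) = 0" using p by (auto simp: relations_def)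
  moreover have "h (restrict_vars d n p) = h p"
    by (rule mpoly_hom_eqI[OF comm_ring_hom_comp[OF h restrict_vars_hom] h])
      (simp_all add: restrict_vars_const restrict_vars_var var)
  ultimately show ?thesis by simp
qed

text \<open>On the open set where \<open>f\<close> does not vanish the vectors indexed by \<open>JN\<close> are non-isotropic,
  those indexed by \<open>JB\<close> are isotropic and linearly independent, and those indexed by \<open>JD\<close> depend on
  them.\<close>

definition good :: "('k::field vec \<Rightarrow> 'k vec \<Rightarrow> 'k) \<Rightarrow> nat \<Rightarrow> nat \<Rightarrow> 'k pt_poly \<Rightarrow> bool" where
  "good B d n f \<longleftrightarrow> (\<exists>JN JB JD \<zeta> c.
     JN \<union> JB \<union> JD = {..<n} \<and> JN \<inter> JB = {} \<and> JN \<inter> JD = {} \<and> JB \<inter> JD = {} \<and>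
     (\<forall>j\<in>JN. poly_form B d (column j) (column j) dvd f) \<and>
     (\<forall>j\<in>JB. f * poly_form B d (column j) (column j) \<in> relations B d n) \<and>
     (\<forall>i\<in>JB. \<forall>l\<in>JB. poly_form B d (column i) (\<zeta> l) = (if i = l then f else 0)) \<and>
     (\<forall>j\<in>JD. \<forall>a<d. f * column j a - (\<Sum>i\<in>JB. c j i * column i a) \<in> relations B d n))"

text \<open>A point of the scheme with values in a field. In the final application this is the
  residue field of an arbitrary prime, so the coordinates \<open>point j i\<close> need not come
  from the ground field.\<close>

locale orth_point = ev: residue_map ev for ev :: "'k::field pt_poly \<Rightarrow> 'l::field" +
  fixes B :: "'k vec \<Rightarrow> 'k vec \<Rightarrow> 'k" and d n :: nat and \<gamma> :: "nat \<Rightarrow> nat \<Rightarrow> 'k"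
  assumes form: "sym_form d (gram B d) \<gamma>" and two: "(2::'k) \<noteq> 0"
    and ev0: "\<And>p. p \<in> relations B d n \<Longrightarrow> ev p = 0"
begin

lemma ev: "comm_ring_hom ev"
  by (rule ev.comm_ring_hom_axioms)

definition point_const :: "'k \<Rightarrow> 'l" where "point_const c = ev (mpoly_const c)"
definition point :: "nat \<Rightarrow> nat \<Rightarrow> 'l" where "point j i = ev (mpoly_var (i, j))"
definition point_gram :: "nat \<Rightarrow> nat \<Rightarrow> 'l" where "point_gram i j = point_const (gram B d i j)"

lemma point_const_hom: "comm_ring_hom point_const"
  unfolding point_const_def by (rule comm_ring_hom_comp[OF ev comm_ring_hom_const])

lemma two_point: "(2::'l) \<noteq> 0"
proof -
  interpret h: comm_ring_hom point_const by (rule point_const_hom)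
  have "point_const 2 \<noteq> 0"
    using h.hom_mult[of 2 "inverse 2"] two by auto
  then show ?thesis using h.hom_add[of 1 1] by simp
qed

lemma point_form: "sym_form d point_gram (\<lambda>i j. point_const (\<gamma> i j))"
  unfolding point_gram_def by (rule sym_form_hom[OF point_const_hom form])

lemma ev_poly_form:
  "ev (poly_form B d u v) = bform d point_gram (\<lambda>i. ev (u i)) (\<lambda>i. ev (v i))"
  unfolding poly_form_def bform_hom[OF ev] by (simp add: point_gram_def[abs_def] point_const_def)

lemma ev_column: "(\<lambda>i. ev (column j i)) = point j"
  by (rule ext) (simp add: column_def point_def)

lemma ev_alt: "ev p = mpoly_eval point_const (\<lambda>(i, j). point j i) p"
  unfolding mpoly_eval_unique[OF ev, of p] by (simp add: point_const_def[abs_def] point_def case_prod_unfold)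

lemma point_orth:
  assumes "j < n" "k < n" "j \<noteq> k"
  shows "bform d point_gram (point j) (point k) = 0"
  using ev0[OF poly_form_in_relations[OF form assms]] by (simp add: ev_poly_form ev_column)

text \<open>The retraction turns into a homomorphism \<open>\<phi>\<close> to a field that kills the
  relations and agrees with the embedding \<open>emb\<close> modulo \<open>?J\<close>. A nilpotent
  \<open>r\<close> has \<open>\<phi> r = 0\<close>, so \<open>emb r\<close> lies in
  \<open>?J\<close>. This is a statement over the residue field, and
  \<open>extended_ideal_descent\<close> brings it back to the ground field.\<close>

lemma good_locally_reduced:
  assumes f: "good B d n f" "ev f \<noteq> 0" and r: "r ^ N \<in> relations B d n"
  shows "\<exists>h. ev h \<noteq> 0 \<and> h * r \<in> relations B d n"
proof -
  obtain JN JB JD \<zeta> c where J: "JN \<union> JB \<union> JD = {..<n}"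
    and disj: "JN \<inter> JB = {}" "JN \<inter> JD = {}" "JB \<inter> JD = {}"
    and 1: "\<forall>j\<in>JN. poly_form B d (column j) (column j) dvd f"
    and 2: "\<forall>j\<in>JB. f * poly_form B d (column j) (column j) \<in> relations B d n"
    and 3: "\<forall>i\<in>JB. \<forall>l\<in>JB. poly_form B d (column i) (\<zeta> l) = (if i = l then f else 0)"
    and 4: "\<forall>j\<in>JD. \<forall>a<d. f * column j a - (\<Sum>i\<in>JB. c j i * column i a) \<in> relations B d n"
    using f(1) unfolding good_def by (elim exE conjE)
  note JN = 1[rule_format] and JB = 2[rule_format] and \<zeta> = 3[rule_format] and c = 4[rule_format]
  have "finite (JN \<union> JB \<union> JD)" unfolding J by simp
  then have fin: "finite JN" "finite JB" "finite JD" by simp_all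
  have n: "j < n" if "j \<in> JN \<union> JB \<union> JD" for j using that J by auto
  define K where "K = relations B d n"
  have K: "is_ideal K" unfolding K_def by (rule relations_ideal)
  let ?\<iota> = point_const
  let ?bl = "bform d point_gram"
  define evL :: "'l pt_poly \<Rightarrow> 'l" where "evL = mpoly_eval (\<lambda>c. c) (\<lambda>(i, j). point j i)"
  have evL: "comm_ring_hom evL" unfolding evL_def by (rule mpoly_eval_hom[OF comm_ring_hom_id])
  interpret evL: residue_map evL unfolding residue_map_def by (rule evL)
  have evL_map: "evL (mpoly_map ?\<iota> p) = ev p" for p
    unfolding evL_def mpoly_eval_map[OF point_const_hom] by (rule ev_alt[symmetric])
  define KL where "KL = extended_ideal ?\<iota> K"
  have KL: "is_ideal KL" unfolding KL_def by (rule extended_ideal_ideal[OF point_const_hom])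
  have evL0: "evL y = 0" if "y \<in> KL" for y
    using that unfolding KL_def evL_def
    by (rule eval_extended_ideal[OF point_const_hom]) (simp add: ev_alt[symmetric] ev0 K_def)
  define emb :: "'k pt_poly \<Rightarrow> 'l pt_poly fract" where "emb p = Fraction_Field.Fract (mpoly_map ?\<iota> p) 1" for p
  have emb: "comm_ring_hom emb" unfolding emb_def by (rule comm_ring_hom_comp[OF comm_ring_hom_Fract mpoly_map_hom[OF point_const_hom]])
  interpret emb: comm_ring_hom emb by (rule emb)
  define cst :: "'l \<Rightarrow> 'l pt_poly fract" where "cst a = Fraction_Field.Fract (mpoly_const a) 1" for a
  have cst: "comm_ring_hom cst" unfolding cst_def by (rule comm_ring_hom_comp[OF comm_ring_hom_Fract comm_ring_hom_const])
  interpret cst: comm_ring_hom cst by (rule cst)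
  let ?A = "evL.loc UNIV" and ?J = "evL.loc KL"
  define \<beta> where "\<beta> i j = cst (point_gram i j)" for i j
  have emb_const: "emb (mpoly_const a) = cst (?\<iota> a)" for a
    by (simp add: emb_def cst_def mpoly_map_const[OF point_const_hom])
  have embA: "emb p \<in> ?A" and cstA: "cst a \<in> ?A" for p a
    unfolding emb_def cst_def by (auto intro: evL.Fract_one_in_loc)
  have res_emb: "evL.res (emb p) = ev p" for p
    by (simp add: emb_def evL.res_Fract_one evL_map)
  have res_cst: "evL.res (cst a) = a" for a
  proof -
    have "evL (mpoly_const a) = a" by (simp add: evL_def mpoly_eval_const[OF comm_ring_hom_id])
    then show ?thesis by (simp add: cst_def evL.res_Fract_one)
  qed
  have embJ: "emb p \<in> ?J" if "p \<in> K" for p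
    unfolding emb_def KL_def using that
    by (intro evL.Fract_one_in_loc map_in_extended_ideal[OF point_const_hom])
  interpret L: local_pair ?A evL.res d \<beta> "\<lambda>i j. cst (?\<iota> (\<gamma> i j))" ?J
  proof -
    have "sym_form d \<beta> (\<lambda>i j. cst (?\<iota> (\<gamma> i j)))"
      unfolding \<beta>_def by (rule sym_form_hom[OF cst point_form])
    then interpret sym_form d \<beta> "\<lambda>i j. cst (?\<iota> (\<gamma> i j))" .
    show "local_pair ?A evL.res d \<beta> (\<lambda>i j. cst (?\<iota> (\<gamma> i j))) ?J"
    proof (unfold_locales)
      show "\<beta> i j \<in> ?A" for i j unfolding \<beta>_def by (rule cstA)
      show "?J \<subseteq> ?A" by (rule evL.loc_subset)
      show "evL.submodule ?J" by (rule evL.loc_submodule[OF KL])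
      show "evL.res x = 0" if "x \<in> ?J" for x using evL0 that by (rule evL.res_loc)
    qed
  qed
  have emb_form: "emb (poly_form B d u v) = L.b (\<lambda>i. emb (u i)) (\<lambda>i. emb (v i))" for u v
    unfolding poly_form_def bform_hom[OF emb] by (simp add: emb_const \<beta>_def[abs_def] point_gram_def)
  have res_\<beta>: "(\<lambda>i j. evL.res (\<beta> i j)) = point_gram" by (simp add: \<beta>_def res_cst)
  define X where "X j i = emb (column j i)" for j i
  have XA: "L.vec_in ?A (X j)" for j by (simp add: L.vec_in_def X_def embA)
  have resX: "(\<lambda>i. evL.res (X j i)) = point j" for j
    by (simp add: X_def res_emb ev_column)
  have XX: "emb (poly_form B d (column j) (column k)) = L.b (X j) (X k)" for j k
    by (simp add: emb_form X_def[abs_def])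
  have res_XX: "evL.res (L.b (X j) (X k)) = ?bl (point j) (point k)" for j k
    by (simp add: L.res_b[OF XA XA] res_\<beta> resX)
  \<comment> \<open>a totally isotropic system dual to the isotropic basis, with constant coefficients\<close>
  obtain g z where "\<And>l. z l = (\<lambda>a. ev (\<zeta> l a) / ev f - (\<Sum>i\<in>JB. g l i * point i a))"
    and z: "\<And>i k. i \<in> JB \<Longrightarrow> k \<in> JB \<Longrightarrow> ?bl (point i) (z k) = (if i = k then 1 else 0)"
    and zz: "\<And>i k. i \<in> JB \<Longrightarrow> k \<in> JB \<Longrightarrow> ?bl (z i) (z k) = 0"
  proof (rule isotropic_dual[OF point_form two_point fin(2), of point "\<lambda>l a. ev (\<zeta> l a) / ev f"])
    show "?bl (point i) (point k) = 0" if "i \<in> JB" "k \<in> JB" for i k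
    proof (cases "i = k")
      case True
      have "ev f * ev (poly_form B d (column i) (column i)) = 0"
        using ev0[OF JB[OF that(1)]] by (simp add: ev.hom_mult)
      then show ?thesis using f True by (simp add: ev_poly_form ev_column)
    next
      case False
      then show ?thesis using that n by (intro point_orth) auto
    qed
    show "?bl (point i) (\<lambda>a. ev (\<zeta> k a) / ev f) = (if i = k then 1 else 0)" if "i \<in> JB" "k \<in> JB" for i k
    proof -
      have "?bl (point i) (\<lambda>a. ev (\<zeta> k a)) = (if i = k then ev f else 0)"
        using arg_cong[OF \<zeta>[OF that], of ev] by (simp add: ev_poly_form ev_column split: if_splits)
      then show ?thesis
        using f by (simp add: divide_inverse bform_scale_right')
    qed
  qed blast
  \<comment> \<open>Against the vectors \<open>X i\<close> of the local ring the constants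
    \<open>z\<close> are dual only in the residue field. The matrix \<open>P\<close> repairs this,
    and combinations of totally isotropic constants remain totally isotropic.\<close>
  define Z0 where "Z0 l a = cst (z l a)" for l a
  have Z0A: "L.vec_in ?A (Z0 l)" for l by (simp add: L.vec_in_def Z0_def cstA)
  have resXZ: "evL.res (L.b (X i) (Z0 l)) = (if i = l then 1 else 0)" if "i \<in> JB" "l \<in> JB" for i l
    using that by (simp add: L.res_b[OF XA Z0A] res_\<beta> resX Z0_def res_cst z)
  obtain P where "\<forall>l\<in>JB. \<forall>k\<in>JB. P l k \<in> ?A"
    "\<forall>i\<in>JB. \<forall>l\<in>JB. L.b (X i) (\<lambda>e. \<Sum>k\<in>JB. P l k * Z0 k e) = (if i = l then 1 else 0)"
    using L.biorthogonalize[OF fin(2), of X Z0, OF XA Z0A resXZ] by blast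
  note P = this[rule_format]
  define Z where "Z l e = (\<Sum>k\<in>JB. P l k * Z0 k e)" for l e
  have ZA: "L.vec_in ?A (Z l)" if "l \<in> JB" for l
    unfolding L.vec_in_def Z_def using that P(1) Z0A
    by (intro allI impI evL.sum_closed evL.mult_closed) (auto simp: L.vec_in_def)
  have ZZ0: "L.b (Z0 i) (Z0 k) = 0" if "i \<in> JB" "k \<in> JB" for i k
    using arg_cong[OF zz[OF that], of cst] by (simp add: bform_hom[OF cst] \<beta>_def[abs_def] Z0_def[abs_def])
  have ZZ: "L.b (Z i) (Z k) = 0" if "i \<in> JB" "k \<in> JB" for i k
    unfolding Z_def[abs_def] bform_linear using that ZZ0 by (intro sum.neutral ballI) (simp add: sum.neutral)
  have embf: "emb f \<noteq> 0" "inverse (emb f) \<in> ?A"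
    using f(2) res_emb[of f] evL.res_zero evL.inverse_closed[OF embA, of f] by auto
  have divf: "x \<in> ?J" if "emb f * x \<in> ?J" for x
    using L.J_closed(3)[OF embf(2) that] embf(1) by (simp add: mult.assoc[symmetric])
  define C where "C j i = inverse (emb f) * emb (c j i)" for j i
  have "\<exists>X'. (\<forall>j\<in>JN \<union> JB \<union> JD. L.vec_in ?J (\<lambda>i. X' j i - X j i))
    \<and> (\<forall>j\<in>JN \<union> JB \<union> JD. \<forall>k\<in>JN \<union> JB \<union> JD. j \<noteq> k \<longrightarrow> L.b (X' j) (X' k) = 0)"
  proof (rule L.orthogonal_retraction[OF fin disj two_point XA ZA, where C = C])
    show "L.b (X j) (X k) \<in> ?J" if "j \<in> JN \<union> JB \<union> JD" "k \<in> JN \<union> JB \<union> JD" "j \<noteq> k" for j k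
      unfolding XX[symmetric] K_def using n that by (intro embJ, unfold K_def, intro poly_form_in_relations[OF form]) auto
    show "evL.res (L.b (X j) (X j)) \<noteq> 0" if "j \<in> JN" for j
    proof -
      have "poly_form B d (column j) (column j) dvd f" using JN that by blast
      then obtain e where "f = poly_form B d (column j) (column j) * e" by (rule dvdE)
      then show ?thesis using f(2) by (auto simp: ev.hom_mult XX[symmetric] res_emb)
    qed
    show "L.b (X j) (X j) \<in> ?J" if "j \<in> JB" for j
      using embJ[of "f * poly_form B d (column j) (column j)"] JB[OF that]
      by (rule_tac divf) (simp add: emb.hom_mult XX K_def)
    show "L.b (X i) (Z l) = (if i = l then 1 else 0)" if "i \<in> JB" "l \<in> JB" for i l
      using P(2)[OF that] unfolding Z_def[abs_def] .
    show "C j i \<in> ?A" for j i unfolding C_def using embf embA by (intro evL.mult_closed)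
    show "L.vec_in ?J (\<lambda>a. X j a - (\<Sum>i\<in>JB. C j i * X i a))" if "j \<in> JD" for j
      unfolding L.vec_in_def
    proof (intro allI impI, rule divf)
      fix a assume "a < d"
      have "emb f * (X j a - (\<Sum>i\<in>JB. C j i * X i a)) = emb (f * column j a - (\<Sum>i\<in>JB. c j i * column i a))"
      proof -
        have "emb f * (C j i * X i a) = emb (c j i * column i a)" for i
          using embf(1) by (simp add: emb.hom_mult C_def X_def)
        then have "emb f * (\<Sum>i\<in>JB. C j i * X i a) = emb (\<Sum>i\<in>JB. c j i * column i a)"
          by (simp only: emb.hom_sum sum_distrib_left)
        then show ?thesis
          by (simp only: emb.hom_mult emb.hom_minus X_def right_diff_distrib)
      qed
      also have "\<dots> \<in> ?J" using c[OF that \<open>a < d\<close>] by (intro embJ) (simp add: K_def)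
      finally show "emb f * (X j a - (\<Sum>i\<in>JB. C j i * X i a)) \<in> ?J" .
    qed
  qed (use ZZ in auto)
  then obtain X' where 5: "\<forall>j\<in>{..<n}. \<forall>a<d. X' j a - X j a \<in> ?J"
    and 6: "\<forall>j\<in>{..<n}. \<forall>k\<in>{..<n}. j \<noteq> k \<longrightarrow> L.b (X' j) (X' k) = 0"
    unfolding J L.vec_in_def by (elim exE conjE)
  have X': "X' j a - X j a \<in> ?J" if "j < n" "a < d" for j a using 5 that by simp
  have X'0: "L.b (X' j) (X' k) = 0" if "j < n" "k < n" "j \<noteq> k" for j k using 6 that by simp
  \<comment> \<open>Pullback of functions along the retraction: the coordinates go to the entries of
    the corrected vectors, the variables outside the generic matrix to 0.\<close>
  define \<phi> where "\<phi> = mpoly_eval (\<lambda>a. cst (?\<iota> a)) (\<lambda>(i, j). if i < d \<and> j < n then X' j i else 0)"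
  have ci: "comm_ring_hom (\<lambda>a. cst (?\<iota> a))" by (rule comm_ring_hom_comp[OF cst point_const_hom])
  have \<phi>: "comm_ring_hom \<phi>" unfolding \<phi>_def by (rule mpoly_eval_hom[OF ci])
  interpret \<phi>: comm_ring_hom \<phi> by (rule \<phi>)
  have \<phi>_const: "\<phi> (mpoly_const a) = cst (?\<iota> a)" for a
    unfolding \<phi>_def by (rule mpoly_eval_const[OF ci])
  have \<phi>_var: "\<phi> (mpoly_var (i, j)) = (if i < d \<and> j < n then X' j i else 0)" for i j
    unfolding \<phi>_def mpoly_eval_var[OF ci] by simp
  have \<phi>0: "\<phi> p = 0" if "p \<in> K" for p
    using that[unfolded K_def]
  proof (rule hom_relations_zero[OF \<phi>, rotated 2])
    show "\<phi> (mpoly_var v) = 0" if "v \<notin> {..<d} \<times> {..<n}" for v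
      using that by (cases v) (auto simp: \<phi>_var)
    fix j k assume jk: "j < n" "k < n" "j \<noteq> k"
    have "\<phi> (poly_form B d (column j) (column k)) = L.b (X' j) (X' k)"
      unfolding poly_form_def bform_hom[OF \<phi>] using jk
      by (simp add: \<phi>_const \<beta>_def[abs_def] point_gram_def) (intro bform_cong, simp_all add: column_def \<phi>_var)
    then show "\<phi> (poly_form B d (column j) (column k)) = 0" using X'0 jk by simp
  qed
  have \<phi>J: "\<phi> p - emb p \<in> ?J" for p
  proof (induction p rule: mpoly_induct)
    case (const a)
    then show ?case by (simp add: \<phi>_const emb_const L.J_closed)
  next
    case (var v)
    obtain i j where v: "v = (i, j)" by (cases v)
    show ?case
    proof (cases "i < d \<and> j < n")
      case True
      then show ?thesis using X'[of j i] by (simp add: v \<phi>_var X_def column_def)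
    next
      case False
      then have "mpoly_var v \<in> K" unfolding K_def v by (intro var_in_relations) auto
      from L.J_closed(5)[OF embJ[OF this]] show ?thesis using False by (auto simp: v \<phi>_var)
    qed
  next
    case (add p q)
    have "\<phi> (p + q) - emb (p + q) = (\<phi> p - emb p) + (\<phi> q - emb q)"
      by (simp add: \<phi>.hom_add emb.hom_add)
    then show ?case using L.J_closed(2)[OF add] by simp
  next
    case (mult p q)
    have "\<phi> q - emb q + emb q \<in> ?A" using evL.add_closed[OF L.J_A[OF mult(2)] embA] .
    then have "\<phi> q \<in> ?A" by simp
    then have "(\<phi> p - emb p) * \<phi> q + emb p * (\<phi> q - emb q) \<in> ?J"
      using mult embA by (intro L.J_closed(2) L.J_closed(3)[OF embA] L.J_closed(4))
    then show ?case by (simp add: \<phi>.hom_mult emb.hom_mult algebra_simps)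
  qed
  have "\<phi> r ^ N = 0" using \<phi>0[of "r ^ N"] r by (simp add: \<phi>.hom_power K_def)
  then have "\<phi> r = 0" by simp
  then have "emb r \<in> ?J" using L.J_closed(5)[OF \<phi>J[of r]] by simp
  then obtain g where g: "evL g \<noteq> 0" "g * mpoly_map ?\<iota> r \<in> KL"
    using evL.Fract_one_loc_iff[OF KL] unfolding emb_def by blast
  show ?thesis
    using extended_ideal_descent[OF point_const_hom K g(2)[unfolded KL_def] g(1)[unfolded evL_def]]
    unfolding ev_alt[symmetric] K_def .
qed

end

section \<open>Good neighbourhoods of minimal primes\<close>

context orth_point
begin

text \<open>Along a line \<open>x + \<epsilon> w\<close> inside the scheme all functions of the minimal prime vanish.\<close>

lemma point_rigid:
  assumes min: "\<And>P. is_prime P \<Longrightarrow> relations B d n \<subseteq> P \<Longrightarrow> P \<subseteq> {p. ev p = 0} \<Longrightarrow> {p. ev p = 0} \<subseteq> P"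
    and w: "\<And>j k. j \<in> {..<n} \<Longrightarrow> k \<in> {..<n} \<Longrightarrow> j \<noteq> k \<Longrightarrow>
        bform d (point_gram) (point j) (w k) + bform d (point_gram) (w j) (point k) = 0
        \<and> bform d (point_gram) (w j) (w k) = 0"
    and i: "i \<in> {..<n}" "bform d (point_gram) (point i) (point i) = 0"
  shows "bform d (point_gram) (point i) (w i) = 0
    \<and> bform d (point_gram) (w i) (w i) = 0"
proof -
  let ?x = "point" and ?bl = "bform d (point_gram)"
  interpret L: sym_form d "point_gram" "\<lambda>i j. point_const (\<gamma> i j)"
    by (rule point_form)
  have pC: "comm_ring_hom (\<lambda>a :: 'l. [:a:])"
    by (rule comm_ring_homI) (simp_all add: one_pCons)
  have ci: "comm_ring_hom (\<lambda>a. [:point_const a:])"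
    by (rule comm_ring_hom_comp[OF pC point_const_hom])
  define \<phi> where "\<phi> = mpoly_eval (\<lambda>a. [:point_const a:])
    (\<lambda>(i, j). if i < d \<and> j < n then [:?x j i, w j i:] else 0)"
  have \<phi>: "comm_ring_hom \<phi>" unfolding \<phi>_def by (rule mpoly_eval_hom[OF ci])
  have \<phi>_const: "\<phi> (mpoly_const a) = [:point_const a:]" for a
    unfolding \<phi>_def by (rule mpoly_eval_const[OF ci])
  have \<phi>_var: "\<phi> (mpoly_var (i, j)) = (if i < d \<and> j < n then [:?x j i, w j i:] else 0)" for i j
    unfolding \<phi>_def mpoly_eval_var[OF ci] by simp
  have \<phi>_form: "\<phi> (poly_form B d (column j) (column k))
      = [:?bl (?x j) (?x k), ?bl (?x j) (w k) + ?bl (w j) (?x k), ?bl (w j) (w k):]" if "j < n" "k < n" for j k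
  proof -
    define h where "h = (\<lambda>a :: 'l. [:a:])"
    have h: "comm_ring_hom h" unfolding h_def by (rule pC)
    let ?t = "[:0, 1:] :: 'l poly"
    let ?bh = "bform d (\<lambda>i j. h (point_gram i j))"
    have lin: "[:a, c:] = h a + ?t * h c" for a c :: 'l by (simp add: h_def)
    have "\<phi> (poly_form B d (column j) (column k))
        = ?bh (\<lambda>i. h (?x j i) + ?t * h (w j i)) (\<lambda>i. h (?x k i) + ?t * h (w k i))"
      unfolding poly_form_def bform_hom[OF \<phi>] \<phi>_const using that
      by (simp only: point_gram_def[abs_def] h_def)
        (intro bform_cong; simp add: column_def \<phi>_var)
    also have "\<dots> = h (?bl (?x j) (?x k)) + ?t * h (?bl (?x j) (w k)) + ?t * h (?bl (w j) (?x k))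
        + ?t * ?t * h (?bl (w j) (w k))"
      by (simp only: bform_linear bform_hom[OF h] distrib_left ac_simps)
    also have "\<dots> = [:?bl (?x j) (?x k), ?bl (?x j) (w k) + ?bl (w j) (?x k), ?bl (w j) (w k):]"
      by (simp add: h_def)
    finally show ?thesis .
  qed
  \<comment> \<open>The functions vanishing on the line form a prime, because polynomials in the
    line parameter over a field are a domain. At parameter 0 the map \<open>\<phi>\<close> becomes
    \<open>ev\<close>, so this prime lies below the minimal one and equals it.\<close>
  let ?P = "{p. \<phi> p = 0}"
  have p0: "comm_ring_hom (\<lambda>q :: 'l poly. poly q 0)"
    by (rule comm_ring_homI) simp_all
  have ev_\<phi>: "poly (\<phi> p) 0 = ev p" for p
  proof (rule mpoly_hom_eqI[OF comm_ring_hom_comp[OF p0 \<phi>] ev])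
    show "poly (\<phi> (mpoly_const c)) 0 = ev (mpoly_const c)" for c
      by (simp add: \<phi>_const point_const_def)
    fix v :: "nat \<times> nat"
    obtain i j where v: "v = (i, j)" by (cases v)
    show "poly (\<phi> (mpoly_var v)) 0 = ev (mpoly_var v)"
    proof (cases "i < d \<and> j < n")
      case True
      then show ?thesis by (simp add: v \<phi>_var point_def)
    next
      case False
      then have "ev (mpoly_var v) = 0" by (intro ev0 var_in_relations) (auto simp: v)
      then show ?thesis using False by (auto simp: v \<phi>_var)
    qed
  qed
  have "{p. ev p = 0} \<subseteq> ?P"
  proof (rule min)
    show "is_prime ?P" by (rule is_prime_kernel[OF \<phi>])
    show "?P \<subseteq> {p. ev p = 0}" by (auto simp flip: ev_\<phi>)
    show "relations B d n \<subseteq> ?P"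
    proof
      fix p assume "p \<in> relations B d n"
      then have "\<phi> p = 0"
      proof (rule hom_relations_zero[OF \<phi>, rotated 2])
        show "\<phi> (mpoly_var v) = 0" if "v \<notin> {..<d} \<times> {..<n}" for v
          using that by (cases v) (auto simp: \<phi>_var)
        show "\<phi> (poly_form B d (column j) (column k)) = 0" if "j < n" "k < n" "j \<noteq> k" for j k
          using that w[of j k] by (simp add: \<phi>_form point_orth)
      qed
      then show "p \<in> ?P" by simp
    qed
  qed
  moreover have "ev (poly_form B d (column i) (column i)) = 0"
    using i by (simp add: ev_poly_form ev_column)
  ultimately have "\<phi> (poly_form B d (column i) (column i)) = 0" by blast
  then have 0: "?bl (?x i) (w i) + ?bl (w i) (?x i) = 0" "?bl (w i) (w i) = 0"
    using i by (simp_all add: \<phi>_form)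
  then have "2 * ?bl (?x i) (w i) = 0" by (simp only: L.b_commute[of "w i" "?x i"] mult_2)
  then show ?thesis using 0 two_point by simp
qed

text \<open>\<open>point_rigid\<close> supplies the hypothesis of
  \<open>rigid_configuration\<close>, whose output feeds \<open>isotropic_rigidity\<close>; the
  resulting congruences are then spread out to a neighbourhood. The work is done in the local ring
  over the ground field: by \<open>surj\<close> the residue map is onto, so the dual system
  lifts.\<close>

lemma minimal_prime_good:
  assumes min: "\<And>P. is_prime P \<Longrightarrow> relations B d n \<subseteq> P \<Longrightarrow> P \<subseteq> {p. ev p = 0} \<Longrightarrow> {p. ev p = 0} \<subseteq> P"
    and surj: "\<And>y. \<exists>a g. ev g \<noteq> 0 \<and> y = ev a / ev g"
  shows "\<exists>f. ev f \<noteq> 0 \<and> good B d n f"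
proof -
  let ?x = "point" and ?bl = "bform d (point_gram)"
  define K where "K = relations B d n"
  have K: "is_ideal K" unfolding K_def by (rule relations_ideal)
  define emb where "emb = (\<lambda>p :: 'k pt_poly. Fraction_Field.Fract p 1)"
  have emb: "comm_ring_hom emb" unfolding emb_def by (rule comm_ring_hom_Fract)
  interpret emb: comm_ring_hom emb by (rule emb)
  have emb_inj: "p = q" if "emb p = emb q" for p q
    using that by (simp add: emb_def eq_fract)
  let ?A = "ev.loc UNIV" and ?J = "ev.loc K"
  have embA: "emb p \<in> ?A" and embJ: "p \<in> K \<Longrightarrow> emb p \<in> ?J" for p
    unfolding emb_def by (auto intro: ev.Fract_one_in_loc)
  have res_emb: "ev.res (emb p) = ev p" for p by (simp add: emb_def ev.res_Fract_one)
  define \<beta> where "\<beta> = (\<lambda>i j. emb (mpoly_const (gram B d i j)))"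
  define \<gamma>' where "\<gamma>' = (\<lambda>i j. emb (mpoly_const (\<gamma> i j)))"
  interpret L: local_pair ?A ev.res d \<beta> \<gamma>' ?J
  proof -
    have "sym_form d \<beta> \<gamma>'"
      unfolding \<beta>_def \<gamma>'_def by (rule sym_form_hom[OF emb sym_poly_form[OF form]])
    then interpret sym_form d \<beta> \<gamma>' .
    show "local_pair ?A ev.res d \<beta> \<gamma>' ?J"
    proof (unfold_locales)
      show "\<beta> i j \<in> ?A" for i j unfolding \<beta>_def by (rule embA)
      show "?J \<subseteq> ?A" by (rule ev.loc_subset)
      show "ev.submodule ?J" by (rule ev.loc_submodule[OF K])
      show "ev.res x = 0" if "x \<in> ?J" for x using ev0[folded K_def] that by (rule ev.res_loc)
    qed
  qed
  have emb_form: "emb (poly_form B d u v) = L.b (\<lambda>i. emb (u i)) (\<lambda>i. emb (v i))" for u v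
    unfolding poly_form_def bform_hom[OF emb] \<beta>_def ..
  have res_\<beta>: "(\<lambda>i j. ev.res (\<beta> i j)) = point_gram"
    by (simp add: \<beta>_def res_emb point_gram_def[abs_def] point_const_def)
  define X where "X = (\<lambda>j i. emb (column j i))"
  have XA: "L.vec_in ?A (X j)" for j by (simp add: L.vec_in_def X_def embA)
  have resX: "(\<lambda>i. ev.res (X j i)) = ?x j" for j
    by (simp add: X_def res_emb ev_column)
  have XX: "emb (poly_form B d (column j) (column k)) = L.b (X j) (X k)" for j k
    by (simp add: emb_form X_def)
  obtain JN JB JD z where J: "JN \<union> JB \<union> JD = {..<n}" and disj: "JN \<inter> JB = {}" "JN \<inter> JD = {}" "JB \<inter> JD = {}"
    and qN: "\<And>j. j \<in> JN \<Longrightarrow> ?bl (?x j) (?x j) \<noteq> 0" and qB: "\<And>j. j \<in> JB \<Longrightarrow> ?bl (?x j) (?x j) = 0"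
    and xz: "\<And>i l. i \<in> JB \<Longrightarrow> l \<in> JB \<Longrightarrow> ?bl (?x i) (z l) = (if i = l then 1 else 0)"
    and complete: "\<And>v a. JB \<union> JD \<noteq> {} \<Longrightarrow> a < d \<Longrightarrow> v a = (\<Sum>j\<in>JN. ?bl v (?x j) / ?bl (?x j) (?x j) * ?x j a)
        + (\<Sum>i\<in>JB. ?bl v (z i) * ?x i a) + (\<Sum>i\<in>JB. ?bl v (?x i) * z i a)"
    and rank: "\<And>i. i \<in> JB \<Longrightarrow> \<exists>D. \<forall>l\<in>JB.
        (\<Sum>j\<in>JD. \<Sum>k\<in>JD - {j}. D j k * (?bl (?x j) (z l) * ?bl (?x k) (z l))) = (if l = i then 1 else 0)"
  proof (rule rigid_configuration[OF point_form two_point, of "{..<n}" ?x])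
    show "finite {..<n}" by simp
    show "?bl (?x j) (?x k) = 0" if "j \<in> {..<n}" "k \<in> {..<n}" "j \<noteq> k" for j k
      using that by (intro point_orth) auto
    fix w i
    assume "\<And>j k. j \<in> {..<n} \<Longrightarrow> k \<in> {..<n} \<Longrightarrow> j \<noteq> k \<Longrightarrow>
        ?bl (?x j) (w k) + ?bl (w j) (?x k) = 0 \<and> ?bl (w j) (w k) = 0"
      "i \<in> {..<n}" "?bl (?x i) (?x i) = 0"
    then show "?bl (?x i) (w i) = 0 \<and> ?bl (w i) (w i) = 0" by (intro point_rigid[OF min, of w i])
  next
    fix JN JB JD z
    assume "JN \<union> JB \<union> JD = {..<n}" "JN \<inter> JB = {}" "JN \<inter> JD = {}" "JB \<inter> JD = {}"
      "\<And>j. j \<in> JN \<Longrightarrow> ?bl (?x j) (?x j) \<noteq> 0" "\<And>j. j \<in> JB \<Longrightarrow> ?bl (?x j) (?x j) = 0"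
      "\<And>i l. i \<in> JB \<Longrightarrow> l \<in> JB \<Longrightarrow> ?bl (?x i) (z l) = (if i = l then 1 else 0)"
      "\<And>v a. JB \<union> JD \<noteq> {} \<Longrightarrow> a < d \<Longrightarrow> v a = (\<Sum>j\<in>JN. ?bl v (?x j) / ?bl (?x j) (?x j) * ?x j a)
        + (\<Sum>i\<in>JB. ?bl v (z i) * ?x i a) + (\<Sum>i\<in>JB. ?bl v (?x i) * z i a)"
      "\<And>i. i \<in> JB \<Longrightarrow> \<exists>D. \<forall>l\<in>JB.
        (\<Sum>j\<in>JD. \<Sum>k\<in>JD - {j}. D j k * (?bl (?x j) (z l) * ?bl (?x k) (z l))) = (if l = i then 1 else 0)"
    then show thesis by (rule that)
  qed
  have "finite (JN \<union> JB \<union> JD)" unfolding J by simp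
  then have fin: "finite JN" "finite JB" "finite JD" by simp_all
  have n: "j < n" if "j \<in> JN \<union> JB \<union> JD" for j using that J by auto
  have surjA: "\<exists>a\<in>?A. ev.res a = y" for y
  proof -
    obtain a g where g: "ev g \<noteq> 0" "y = ev a / ev g" using surj by blast
    then have "ev.res (Fraction_Field.Fract a g) = y" "Fraction_Field.Fract a g \<in> ?A"
      by (auto simp: ev.res_Fract intro: ev.locI)
    then show ?thesis by blast
  qed
  then obtain lift where lift: "\<And>y. lift y \<in> ?A" "\<And>y. ev.res (lift y) = y" by metis
  define Z0 where "Z0 = (\<lambda>l a. lift (z l a))"
  have Z0A: "L.vec_in ?A (Z0 l)" for l by (simp add: L.vec_in_def Z0_def lift)
  have resXZ: "ev.res (L.b (X i) (Z0 l)) = (if i = l then 1 else 0)" if "i \<in> JB" "l \<in> JB" for i l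
    using that by (subst L.res_b[OF XA Z0A]) (simp add: res_\<beta> resX Z0_def lift xz)
  obtain P where "\<forall>l\<in>JB. \<forall>k\<in>JB. P l k \<in> ?A"
    "\<forall>i\<in>JB. \<forall>l\<in>JB. L.b (X i) (\<lambda>e. \<Sum>k\<in>JB. P l k * Z0 k e) = (if i = l then 1 else 0)"
    using L.biorthogonalize[OF fin(2), of X Z0, OF XA Z0A resXZ] by blast
  note P = this[rule_format]
  \<comment> \<open>The pairing matrix is already the identity in the residue field, so
    \<open>P\<close> has residue the identity and \<open>Z\<close> still lifts \<open>z\<close>.
    Thus the residues of \<open>C\<close> are the coefficients in \<open>rank\<close>.\<close>
  have resP: "ev.res (P l i) = (if i = l then 1 else 0)" if "i \<in> JB" "l \<in> JB" for i l
  proof -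
    have "(\<Sum>k\<in>JB. P l k * L.b (X i) (Z0 k)) = (if i = l then 1 else 0)"
      using P(2)[OF that] by (simp only: bform_linear)
    then have "(if i = l then 1 else 0) = ev.res (\<Sum>k\<in>JB. P l k * L.b (X i) (Z0 k))"
      by (simp add: ev.res_zero ev.res_one)
    also have "\<dots> = (\<Sum>k\<in>JB. ev.res (P l k) * (if i = k then 1 else 0))"
      using that P(1) L.b_closed[OF XA Z0A] by (subst ev.res_sum) (auto simp: ev.res_mult ev.mult_closed resXZ intro!: sum.cong)
    also have "\<dots> = ev.res (P l i)" using that fin by (simp add: mult_delta_right sum.delta')
    finally show ?thesis by simp
  qed
  \<comment> \<open>The default 0 outside \<open>JB\<close> makes \<open>ZA'\<close> and
    \<open>CA\<close> hold without conditions on the indices.\<close>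
  define Z where "Z = (\<lambda>l e. if l \<in> JB then (\<Sum>k\<in>JB. P l k * Z0 k e) else 0)"
  have ZA': "Z l e \<in> ?A" for l e
    using P(1) by (auto simp: Z_def Z0_def lift ev.zero_closed intro!: ev.sum_closed ev.mult_closed)
  have ZA: "L.vec_in ?A (Z l)" for l by (simp add: L.vec_in_def ZA')
  have XZ: "L.b (X i) (Z l) = (if i = l then 1 else 0)" if "i \<in> JB" "l \<in> JB" for i l
    using P(2)[OF that] that by (simp add: Z_def)
  have resZ: "(\<lambda>e. ev.res (Z l e)) = z l" if "l \<in> JB" for l
  proof
    fix e
    have "ev.res (Z l e) = (\<Sum>k\<in>JB. ev.res (P l k) * z k e)"
      using that P(1) by (simp add: Z_def) (subst ev.res_sum, auto simp: ev.res_mult ev.mult_closed Z0_def lift)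
    also have "\<dots> = (\<Sum>k\<in>JB. (if k = l then 1 else 0) * z k e)"
      using that by (intro sum.cong) (auto simp: resP)
    also have "\<dots> = z l e" using that fin by (simp add: mult_delta_left sum.delta)
    finally show "ev.res (Z l e) = z l e" .
  qed
  define C where "C = (\<lambda>j i. L.b (X j) (Z i))"
  have CA: "C j i \<in> ?A" for j i by (simp add: C_def L.b_closed XA ZA)
  have resC: "ev.res (C j i) = ?bl (?x j) (z i)" if "i \<in> JB" for j i
    using that by (simp add: C_def L.res_b[OF XA ZA] res_\<beta> resX resZ)
  have res_XX: "ev.res (L.b (X j) (X k)) = ?bl (?x j) (?x k)" for j k
    by (simp add: L.res_b[OF XA XA] res_\<beta> resX)
  have rigid: "(\<forall>i\<in>JB. L.b (X i) (X i) \<in> ?J)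
    \<and> (\<forall>j\<in>JD. L.vec_in ?J (\<lambda>a. X j a - (\<Sum>i\<in>JB. C j i * X i a)))"
  \<comment> \<open>Completeness is available only if some vector is isotropic; otherwise both
    claims are vacuous.\<close>
  proof (cases "JB \<union> JD = {}")
    case False
    have orth: "L.b (X j) (X k) \<in> ?J" if "j \<in> JN \<union> JB \<union> JD" "k \<in> JN \<union> JB \<union> JD" "j \<noteq> k" for j k
      unfolding XX[symmetric] using n that
      by (intro embJ) (simp add: K_def poly_form_in_relations[OF form])
    have qN': "ev.res (L.b (X j) (X j)) \<noteq> 0" if "j \<in> JN" for j using that by (simp add: res_XX qN)
    have qB': "ev.res (L.b (X j) (X j)) = 0" if "j \<in> JB" for j using that by (simp add: res_XX qB)
    have complete': "v a = (\<Sum>j\<in>JN. bform d (\<lambda>i j. ev.res (\<beta> i j)) v (\<lambda>i. ev.res (X j i))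
          / bform d (\<lambda>i j. ev.res (\<beta> i j)) (\<lambda>i. ev.res (X j i)) (\<lambda>i. ev.res (X j i)) * ev.res (X j a))
        + (\<Sum>i\<in>JB. bform d (\<lambda>i j. ev.res (\<beta> i j)) v (\<lambda>e. ev.res (Z i e)) * ev.res (X i a))
        + (\<Sum>i\<in>JB. bform d (\<lambda>i j. ev.res (\<beta> i j)) v (\<lambda>e. ev.res (X i e)) * ev.res (Z i a))"
      if "a < d" for v a
    proof -
      have "ev.res (X j a) = ?x j a" for j using fun_cong[OF resX] .
      moreover have "ev.res (Z j a) = z j a" if "j \<in> JB" for j using fun_cong[OF resZ[OF that]] .
      ultimately show ?thesis
        unfolding res_\<beta> resX by (subst complete[OF False \<open>a < d\<close>, of v]) (simp add: resZ)
    qed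
    have rank': "\<exists>D. \<forall>l\<in>JB. (\<Sum>j\<in>JD. \<Sum>k\<in>JD - {j}. D j k * (ev.res (L.b (X j) (Z l)) * ev.res (L.b (X k) (Z l))))
        = (if l = i then 1 else 0)" if "i \<in> JB" for i
      using rank[OF that] by (simp add: resC[unfolded C_def])
    show ?thesis
      unfolding C_def
      using L.isotropic_rigidity[OF fin disj surjA XA ZA orth qN' qB' XZ complete' rank'] by blast
  qed auto
  define E where "E = (\<lambda>(l, a). Z l a) ` (JB \<times> {..<d}) \<union> (\<lambda>(j, i). C j i) ` (JD \<times> JB)"
  have "finite E" "E \<subseteq> ?A" using fin by (auto simp: E_def ZA' CA)
  then obtain g1 where g1: "ev g1 \<noteq> 0" "\<And>e. e \<in> E \<Longrightarrow> \<exists>a. emb g1 * e = emb a"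
    using ev.common_denominator[of E] unfolding emb_def by blast
  define num where "num = (\<lambda>e. SOME a. emb g1 * e = emb a)"
  have num: "emb (num e) = emb g1 * e" if "e \<in> E" for e
    using someI_ex[OF g1(2)[OF that]] by (simp add: num_def)
  have numZ: "emb (num (Z l a)) = emb g1 * Z l a" if "l \<in> JB" "a < d" for l a
    using that by (intro num) (force simp: E_def)
  have numC: "emb (num (C j i)) = emb g1 * C j i" if "j \<in> JD" "i \<in> JB" for j i
    using that by (intro num) (force simp: E_def)
  let ?q = "\<lambda>j. poly_form B d (column j) (column j)"
  let ?u = "\<lambda>j a. g1 * column j a - (\<Sum>i\<in>JB. num (C j i) * column i a)"
  define E' where "E' = ?q ` JB \<union> (\<lambda>(j, a). ?u j a) ` (JD \<times> {..<d})"
  have "finite E'" using fin by (simp add: E'_def)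
  moreover have "Fraction_Field.Fract e 1 \<in> ?J" if e: "e \<in> E'" for e
  proof -
    consider i where "i \<in> JB" "e = ?q i" | j a where "j \<in> JD" "a < d" "e = ?u j a"
      using e by (auto simp: E'_def)
    then have "emb e \<in> ?J"
    proof cases
      case 1
      then show ?thesis using rigid by (simp add: XX)
    next
      case 2
      have "emb (\<Sum>i\<in>JB. num (C j i) * column i a) = emb g1 * (\<Sum>i\<in>JB. C j i * X i a)"
        using 2 by (simp add: emb.hom_sum emb.hom_mult numC X_def sum_distrib_left mult.assoc)
      then have "emb e = emb g1 * (X j a - (\<Sum>i\<in>JB. C j i * X i a))"
        by (simp add: 2 emb.hom_minus emb.hom_mult X_def right_diff_distrib)
      moreover have "X j a - (\<Sum>i\<in>JB. C j i * X i a) \<in> ?J" using rigid 2 by (simp add: L.vec_in_def)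
      ultimately show ?thesis using L.J_closed(3)[OF embA] by simp
    qed
    then show ?thesis by (simp add: emb_def)
  qed
  ultimately obtain g2 where g2: "ev g2 \<noteq> 0" "\<And>e. e \<in> E' \<Longrightarrow> g2 * e \<in> K"
    using ev.common_annihilator[OF K, of E'] by blast
  \<comment> \<open>In \<open>f\<close> the factor \<open>g1\<close> clears the denominators of
    \<open>Z\<close> and \<open>C\<close>, \<open>g2\<close> turns the local congruences into
    members of \<open>K\<close>, and the product makes the columns in \<open>JN\<close>
    non-isotropic wherever \<open>f\<close> does not vanish.\<close>
  define s where "s = g2 * (\<Prod>j\<in>JN. ?q j)"
  define f where "f = s * g1"
  have evq: "ev (?q j) \<noteq> 0" if "j \<in> JN" for j
    using qN[OF that] by (simp add: ev_poly_form ev_column)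
  then have "ev f \<noteq> 0"
    using fin g1(1) g2(1) by (simp add: f_def s_def ev.hom_mult ev.hom_prod)
  moreover have "good B d n f"
    unfolding good_def
  proof (intro exI conjI)
    show "JN \<union> JB \<union> JD = {..<n}" "JN \<inter> JB = {}" "JN \<inter> JD = {}" "JB \<inter> JD = {}"
      by (fact J disj)+
    show "\<forall>j\<in>JN. ?q j dvd f"
    proof
      fix j assume "j \<in> JN"
      then have "?q j dvd (\<Prod>j\<in>JN. ?q j)" using fin by (intro dvd_prodI)
      then show "?q j dvd f" unfolding f_def s_def by (intro dvd_mult2[OF dvd_mult])
    qed
    have sK: "s * (c * e) \<in> K" if "e \<in> E'" for e c
    proof -
      have "s * (c * e) = ((\<Prod>j\<in>JN. ?q j) * c) * (g2 * e)" unfolding s_def by (simp only: mult_ac)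
      then show ?thesis using is_ideal_mult[OF K g2(2)[OF that]] by (simp only:)
    qed
    show "\<forall>j\<in>JB. f * ?q j \<in> relations B d n"
      using sK[of _ g1] by (auto simp: f_def K_def E'_def mult.assoc)
    show "\<forall>i\<in>JB. \<forall>l\<in>JB. poly_form B d (column i) (\<lambda>a. s * num (Z l a)) = (if i = l then f else 0)"
    proof (intro ballI)
      fix i l assume il: "i \<in> JB" "l \<in> JB"
      have "emb (poly_form B d (column i) (\<lambda>a. s * num (Z l a))) = L.b (X i) (\<lambda>a. (emb s * emb g1) * Z l a)"
        unfolding emb_form using il
        by (intro bform_cong) (simp_all add: X_def emb.hom_mult numZ mult.assoc)
      also have "\<dots> = emb (if i = l then f else 0)"
        using il by (simp add: bform_scale_right XZ f_def emb.hom_mult)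
      finally show "poly_form B d (column i) (\<lambda>a. s * num (Z l a)) = (if i = l then f else 0)"
        by (rule emb_inj)
    qed
    show "\<forall>j\<in>JD. \<forall>a<d. f * column j a - (\<Sum>i\<in>JB. (s * num (C j i)) * column i a) \<in> relations B d n"
    proof (intro ballI allI impI)
      fix j a assume "j \<in> JD" "a < d"
      then have "s * (1 * ?u j a) \<in> K" by (intro sK) (force simp: E'_def)
      then show "f * column j a - (\<Sum>i\<in>JB. (s * num (C j i)) * column i a) \<in> relations B d n"
        by (simp add: K_def f_def right_diff_distrib sum_distrib_left mult.assoc)
    qed
  qed
  ultimately show ?thesis by blast
qed

end

section \<open>Generic reducedness through a presentation\<close>

text \<open>Zorn's lemma applied to complements: the union of a chain of complements of primes is
  the complement of their intersection, and the intersection of a chain of primes is prime.\<close>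

lemma minimal_prime_exists:
  assumes P: "is_prime P" "K \<subseteq> P"
  obtains Q where "is_prime Q" "K \<subseteq> Q" "Q \<subseteq> P" "\<And>Q'. is_prime Q' \<Longrightarrow> K \<subseteq> Q' \<Longrightarrow> Q' \<subseteq> Q \<Longrightarrow> Q \<subseteq> Q'"
proof -
  define A where "A = (\<lambda>Q. - Q) ` {Q. is_prime Q \<and> K \<subseteq> Q \<and> Q \<subseteq> P}"
  have "\<exists>M\<in>A. \<forall>X\<in>A. M \<subseteq> X \<longrightarrow> X = M"
  proof (rule subset_Zorn_nonempty)
    show "A \<noteq> {}" using P by (auto simp: A_def)
    fix \<C> assume ne: "\<C> \<noteq> {}" and chain: "subset.chain A \<C>"
    define Q where "Q = - \<Union>\<C>"
    have cp: "is_prime (- X)" "K \<subseteq> - X" "- X \<subseteq> P" if "X \<in> \<C>" for X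
      using that chain unfolding subset.chain_def A_def by auto
    have Q: "a \<in> Q \<longleftrightarrow> (\<forall>X\<in>\<C>. a \<in> - X)" for a by (auto simp: Q_def)
    have "is_ideal Q"
      unfolding is_ideal_def
    proof (intro conjI ballI allI)
      note I = cp(1)[THEN is_prime_ideal]
      show "0 \<in> Q" using is_ideal_zero[OF I] by (simp add: Q)
      show "a + b \<in> Q" if "a \<in> Q" "b \<in> Q" for a b
        using is_ideal_add[OF I, of _ a b] that by (simp add: Q)
      show "a * b \<in> Q" if "b \<in> Q" for a b
        using is_ideal_mult[OF I, of _ b a] that by (simp add: Q)
    qed
    moreover have "1 \<notin> Q" using ne cp(1) unfolding Q is_prime_def by blast
    moreover have "a \<in> Q \<or> b \<in> Q" if ab: "a * b \<in> Q" for a b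
    proof (rule ccontr)
      assume "\<not> (a \<in> Q \<or> b \<in> Q)"
      then obtain X Y where XY: "X \<in> \<C>" "Y \<in> \<C>" "a \<in> X" "b \<in> Y" by (auto simp: Q_def)
      then have "X \<subseteq> Y \<or> Y \<subseteq> X" using chain unfolding subset.chain_def by blast
      then obtain Z where Z: "Z \<in> \<C>" "a \<in> Z" "b \<in> Z" using XY by blast
      have "a * b \<in> - Z" using ab Z(1) unfolding Q by blast
      then show False using cp(1)[OF Z(1)] Z unfolding is_prime_def by blast
    qed
    ultimately have "is_prime Q" by (simp add: is_prime_def)
    moreover have "K \<subseteq> Q" using cp(2) by (auto simp: Q_def)
    moreover have "Q \<subseteq> P" using ne cp(3) by (auto simp: Q_def)
    ultimately show "\<Union>\<C> \<in> A" by (auto simp: A_def Q_def intro!: image_eqI[of _ _ "- \<Union>\<C>"])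
  qed
  then obtain Q where Q: "is_prime Q" "K \<subseteq> Q" "Q \<subseteq> P" and max: "\<forall>X\<in>A. - Q \<subseteq> X \<longrightarrow> X = - Q"
    by (auto simp: A_def)
  have "Q \<subseteq> Q'" if "is_prime Q'" "K \<subseteq> Q'" "Q' \<subseteq> Q" for Q'
  proof -
    have "- Q' \<in> A" using that Q(3) by (auto simp: A_def)
    then have "- Q' = - Q" using max that(3) by blast
    then show ?thesis by blast
  qed
  with Q that show ?thesis by blast
qed

text \<open>A record-based ring as a quotient of a type-class ring. Primes and fractions of
  \<open>R\<close> are handled through representatives, and equality in \<open>R\<close> becomes
  membership of a difference in \<open>K\<close>.\<close>

locale presentation = R: cring R for R :: "('r, 'm) ring_scheme" (structure) +
  fixes \<pi> :: "'a::comm_ring_1 \<Rightarrow> 'r"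
  assumes closed: "\<pi> p \<in> carrier R" and surj: "x \<in> carrier R \<Longrightarrow> \<exists>p. x = \<pi> p"
    and one: "\<pi> 1 = \<one>" and add: "\<pi> (p + q) = \<pi> p \<oplus> \<pi> q" and mult: "\<pi> (p * q) = \<pi> p \<otimes> \<pi> q"
begin

definition K :: "'a set" where "K = {p. \<pi> p = \<zero>}"

lemma zero: "\<pi> 0 = \<zero>"
  using add[of 0 0] closed[of 0] R.add.l_cancel_one[of "\<pi> 0" "\<pi> 0"] by simp

lemma uminus: "\<pi> (- p) = \<ominus> \<pi> p"
  using add[of "- p" p] closed by (intro R.minus_equality[symmetric]) (simp_all add: zero)

lemma diff: "\<pi> (p - q) = \<pi> p \<ominus> \<pi> q"
  using add[of p "- q"] by (simp add: uminus R.minus_eq)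

lemma eq_iff: "\<pi> p = \<pi> q \<longleftrightarrow> p - q \<in> K"
proof
  assume "p - q \<in> K"
  then have "\<pi> (p - q) = \<zero>" by (simp add: K_def)
  then show "\<pi> p = \<pi> q" using add[of "p - q" q] closed by simp
next
  assume "\<pi> p = \<pi> q"
  then show "p - q \<in> K" by (simp add: K_def diff closed R.minus_eq R.r_neg)
qed

lemma K_ideal: "is_ideal K"
  by (simp add: is_ideal_def K_def zero add mult closed)

lemma prime_preimage:
  assumes "primeideal P R"
  shows "is_prime (\<pi> -` P)" "K \<subseteq> \<pi> -` P"
proof -
  interpret P: primeideal P R by fact
  have 0: "\<zero> \<in> P" and a: "x \<oplus> y \<in> P" if "x \<in> P" "y \<in> P" for x y
    using that P.additive_subgroup_axioms
    by (auto intro: additive_subgroup.zero_closed additive_subgroup.a_closed)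
  have z: "\<zero> \<in> P" by (rule additive_subgroup.zero_closed[OF P.additive_subgroup_axioms])
  have "\<one> \<notin> P" using P.one_imp_carrier P.I_notcarr by auto
  then show "is_prime (\<pi> -` P)"
    using z a P.I_l_closed[OF _ closed] P.I_prime[OF closed closed]
    by (auto simp: is_prime_def is_ideal_def zero one add mult)
  show "K \<subseteq> \<pi> -` P" using z by (auto simp: K_def)
qed

lemma image_mem_iff:
  assumes "is_ideal Q" "K \<subseteq> Q"
  shows "\<pi> p \<in> \<pi> ` Q \<longleftrightarrow> p \<in> Q"
proof
  assume "\<pi> p \<in> \<pi> ` Q"
  then obtain q where "q \<in> Q" "p - q \<in> Q" using assms(2) by (auto simp: eq_iff)
  then have "(p - q) + q \<in> Q" using is_ideal_add[OF assms(1)] by blast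
  then show "p \<in> Q" by simp
qed simp

lemma prime_image:
  assumes Q: "is_prime Q" "K \<subseteq> Q"
  shows "primeideal (\<pi> ` Q) R"
proof -
  note I = is_prime_ideal[OF Q(1)]
  note mem = image_mem_iff[OF I Q(2)]
  have c: "\<pi> ` Q \<subseteq> carrier R" using closed by auto
  have "ideal (\<pi> ` Q) R"
  proof (rule idealI[OF R.ring_axioms])
    show "subgroup (\<pi> ` Q) (add_monoid R)"
    proof (rule R.add.subgroupI[OF c])
      show "\<pi> ` Q \<noteq> {}" using is_ideal_zero[OF I] by blast
      show "\<ominus> x \<in> \<pi> ` Q" if "x \<in> \<pi> ` Q" for x
        using that is_ideal_uminus[OF I] by (auto simp flip: uminus)
      show "x \<oplus> y \<in> \<pi> ` Q" if "x \<in> \<pi> ` Q" "y \<in> \<pi> ` Q" for x y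
        using that is_ideal_add[OF I] by (auto simp flip: add)
    qed
    fix x y assume "x \<in> \<pi> ` Q" "y \<in> carrier R"
    then obtain p q where "p \<in> Q" "x = \<pi> p" "y = \<pi> q" using surj by blast
    then show "y \<otimes> x \<in> \<pi> ` Q" "x \<otimes> y \<in> \<pi> ` Q"
      using is_ideal_mult[OF I] is_ideal_mult'[OF I] by (auto simp flip: mult)
  qed
  then show ?thesis
  proof (rule primeidealI[OF _ R.cring_axioms])
    have "\<pi> 1 \<notin> \<pi> ` Q" using Q by (simp add: mem is_prime_def)
    then show "carrier R \<noteq> \<pi> ` Q" using closed by blast
    fix x y assume "x \<in> carrier R" "y \<in> carrier R" "x \<otimes> y \<in> \<pi> ` Q"
    then obtain p q where pq: "x = \<pi> p" "y = \<pi> q" using surj by blast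
    then have "p * q \<in> Q" using \<open>x \<otimes> y \<in> \<pi> ` Q\<close> mem[of "p * q"] by (simp add: mult)
    with pq show "x \<in> \<pi> ` Q \<or> y \<in> \<pi> ` Q" using Q(1) by (auto simp: is_prime_def)
  qed
qed

section \<open>Stalks in terms of representatives\<close>

context
  fixes P assumes P: "primeideal P R"
begin

abbreviation "M \<equiv> carrier R - P"
abbreviation "N \<equiv> - (\<pi> -` P)"

lemma N_mult: "s \<in> N \<Longrightarrow> t \<in> N \<Longrightarrow> s * t \<in> N" and N_one: "1 \<in> N"
  using prime_preimage(1)[OF P] unfolding is_prime_def by auto

definition same_fraction :: "'a \<Rightarrow> 'a \<Rightarrow> 'a \<Rightarrow> 'a \<Rightarrow> bool" where
  "same_fraction p s q t \<longleftrightarrow> (\<exists>u\<in>N. u * (p * t - q * s) \<in> K)"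

lemma same_fraction_refl: "same_fraction p s p s"
  using N_one is_ideal_zero[OF K_ideal] by (auto simp: same_fraction_def mult.commute intro: bexI[of _ 1])

lemma same_fraction_sym:
  assumes "same_fraction p s q t"
  shows "same_fraction q t p s"
proof -
  obtain u where u: "u \<in> N" "u * (p * t - q * s) \<in> K" using assms by (auto simp: same_fraction_def)
  from is_ideal_uminus[OF K_ideal u(2)] have "u * (q * s - p * t) \<in> K" by (simp add: algebra_simps)
  with u(1) show ?thesis by (auto simp: same_fraction_def)
qed

lemma same_fraction_trans:
  assumes "same_fraction p s q t" "same_fraction q t r w" "t \<in> N"
  shows "same_fraction p s r w"
proof -
  obtain u v where u: "u \<in> N" "u * (p * t - q * s) \<in> K" and v: "v \<in> N" "v * (q * w - r * t) \<in> K"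
    using assms by (auto simp: same_fraction_def)
  have "(v * w) * (u * (p * t - q * s)) + (u * s) * (v * (q * w - r * t)) \<in> K"
    by (intro is_ideal_add[OF K_ideal] is_ideal_mult[OF K_ideal] u v)
  also have "(v * w) * (u * (p * t - q * s)) + (u * s) * (v * (q * w - r * t)) = (u * v * t) * (p * w - r * s)"
    by (simp add: algebra_simps)
  finally have "(u * v * t) * (p * w - r * s) \<in> K" .
  moreover have "u * v * t \<in> N" by (intro N_mult u v assms(3))
  ultimately show ?thesis unfolding same_fraction_def by (rule bexI)
qed

lemma same_fraction_mult:
  assumes "same_fraction p s p' s'" "same_fraction q t q' t'"
  shows "same_fraction (p * q) (s * t) (p' * q') (s' * t')"
proof -
  obtain u v where u: "u \<in> N" "u * (p * s' - p' * s) \<in> K" and v: "v \<in> N" "v * (q * t' - q' * t) \<in> K"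
    using assms by (auto simp: same_fraction_def)
  have "(v * q * t') * (u * (p * s' - p' * s)) + (u * p' * s) * (v * (q * t' - q' * t)) \<in> K"
    by (intro is_ideal_add[OF K_ideal] is_ideal_mult[OF K_ideal] u v)
  also have "(v * q * t') * (u * (p * s' - p' * s)) + (u * p' * s) * (v * (q * t' - q' * t))
      = (u * v) * ((p * q) * (s' * t') - (p' * q') * (s * t))"
    by (simp add: algebra_simps)
  finally have "(u * v) * ((p * q) * (s' * t') - (p' * q') * (s * t)) \<in> K" .
  moreover have "u * v \<in> N" by (intro N_mult u v)
  ultimately show ?thesis unfolding same_fraction_def by (rule bexI)
qed

lemma mem_fraction:
  "(\<pi> q, \<pi> t) \<in> fraction R M (\<pi> p) (\<pi> s) \<longleftrightarrow> t \<in> N \<and> same_fraction p s q t"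
proof -
  have "u \<otimes> ((\<pi> p \<otimes> \<pi> t) \<ominus> (\<pi> q \<otimes> \<pi> s)) = \<zero> \<longleftrightarrow> (\<exists>v. u = \<pi> v \<and> v * (p * t - q * s) \<in> K)"
    if "u \<in> carrier R" for u
    using surj[OF that] by (auto simp: K_def mult diff)
  then have "(\<exists>u\<in>M. u \<otimes> ((\<pi> p \<otimes> \<pi> t) \<ominus> (\<pi> q \<otimes> \<pi> s)) = \<zero>) \<longleftrightarrow> same_fraction p s q t"
    unfolding same_fraction_def using closed by (auto 0 3)
  then show ?thesis
    unfolding fraction_def using closed by simp
qed

lemma fraction_eq:
  assumes "s \<in> N" "t \<in> N"
  shows "fraction R M (\<pi> p) (\<pi> s) = fraction R M (\<pi> q) (\<pi> t) \<longleftrightarrow> same_fraction p s q t"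
proof
  assume "fraction R M (\<pi> p) (\<pi> s) = fraction R M (\<pi> q) (\<pi> t)"
  moreover have "(\<pi> q, \<pi> t) \<in> fraction R M (\<pi> q) (\<pi> t)"
    using assms by (simp add: mem_fraction same_fraction_refl)
  ultimately have "(\<pi> q, \<pi> t) \<in> fraction R M (\<pi> p) (\<pi> s)" by simp
  then show "same_fraction p s q t" unfolding mem_fraction by simp
next
  assume *: "same_fraction p s q t"
  have "(x, y) \<in> fraction R M (\<pi> p) (\<pi> s) \<longleftrightarrow> (x, y) \<in> fraction R M (\<pi> q) (\<pi> t)" for x y
  proof (cases "x \<in> carrier R \<and> y \<in> carrier R")
    case True
    then obtain r w where "x = \<pi> r" "y = \<pi> w" using surj by blast
    then show ?thesis
      using * same_fraction_trans[OF same_fraction_sym[OF *], of r w] same_fraction_trans[OF *, of r w] assms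
      by (auto simp: mem_fraction)
  qed (auto simp: fraction_def)
  then show "fraction R M (\<pi> p) (\<pi> s) = fraction R M (\<pi> q) (\<pi> t)" by auto
qed

text \<open>Multiplication in \<open>localization\<close> is a union over all representatives of
  both factors. All the sets in this union are the same fraction, so one choice of representatives
  computes it.\<close>

lemma fraction_mult:
  assumes "s \<in> N" "t \<in> N"
  shows "fraction R M (\<pi> p) (\<pi> s) \<otimes>\<^bsub>localization R M\<^esub> fraction R M (\<pi> q) (\<pi> t)
    = fraction R M (\<pi> (p * q)) (\<pi> (s * t))"
proof -
  let ?X = "fraction R M (\<pi> p) (\<pi> s)" and ?Y = "fraction R M (\<pi> q) (\<pi> t)"
  have eq: "fraction R M (a \<otimes> b) (x \<otimes> y) = fraction R M (\<pi> (p * q)) (\<pi> (s * t))"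
    if ax: "(a, x) \<in> ?X" and bY: "(b, y) \<in> ?Y" for a x b y
  proof -
    have "a \<in> carrier R" "x \<in> carrier R" "b \<in> carrier R" "y \<in> carrier R"
      using ax bY by (simp_all add: fraction_def)
    then obtain p' s' q' t' where e: "a = \<pi> p'" "x = \<pi> s'" "b = \<pi> q'" "y = \<pi> t'"
      using surj by metis
    have st: "s' \<in> N" "t' \<in> N" and pq: "same_fraction p s p' s'" "same_fraction q t q' t'"
      using ax bY unfolding e mem_fraction by simp_all
    have "same_fraction (p' * q') (s' * t') (p * q) (s * t)"
      by (rule same_fraction_sym[OF same_fraction_mult[OF pq]])
    then show ?thesis
      unfolding e mult[symmetric] by (simp only: fraction_eq[OF N_mult[OF st] N_mult[OF assms]])
  qed
  have "(\<pi> p, \<pi> s) \<in> ?X" "(\<pi> q, \<pi> t) \<in> ?Y"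
    using assms by (simp_all add: mem_fraction same_fraction_refl)
  then have "(\<Union>(a, x)\<in>?X. \<Union>(b, y)\<in>?Y. fraction R M (a \<otimes> b) (x \<otimes> y)) = fraction R M (\<pi> (p * q)) (\<pi> (s * t))"
  proof (intro equalityI subsetI)
    fix w assume "w \<in> (\<Union>(a, x)\<in>?X. \<Union>(b, y)\<in>?Y. fraction R M (a \<otimes> b) (x \<otimes> y))"
    then obtain a x b y where "(a, x) \<in> ?X" "(b, y) \<in> ?Y" "w \<in> fraction R M (a \<otimes> b) (x \<otimes> y)"
      by (elim UN_E) (auto split: prod.splits)
    then show "w \<in> fraction R M (\<pi> (p * q)) (\<pi> (s * t))" by (simp only: eq)
  next
    fix w assume "w \<in> fraction R M (\<pi> (p * q)) (\<pi> (s * t))"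
    then have "w \<in> fraction R M (\<pi> p \<otimes> \<pi> q) (\<pi> s \<otimes> \<pi> t)" by (simp only: mult)
    then show "w \<in> (\<Union>(a, x)\<in>?X. \<Union>(b, y)\<in>?Y. fraction R M (a \<otimes> b) (x \<otimes> y))"
      using \<open>(\<pi> p, \<pi> s) \<in> ?X\<close> \<open>(\<pi> q, \<pi> t) \<in> ?Y\<close> by (intro UN_I[of "(\<pi> p, \<pi> s)"] UN_I[of "(\<pi> q, \<pi> t)"]) auto
  qed
  then show ?thesis by (simp add: localization_def)
qed

lemma fraction_power:
  assumes "s \<in> N"
  shows "fraction R M (\<pi> p) (\<pi> s) [^]\<^bsub>localization R M\<^esub> (k::nat) = fraction R M (\<pi> (p ^ k)) (\<pi> (s ^ k))"
proof (induction k)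
  case 0
  then show ?case by (simp add: nat_pow_def localization_def one)
next
  case (Suc k)
  have "s ^ k \<in> N" by (induction k) (use assms N_one N_mult in auto)
  have "fraction R M (\<pi> p) (\<pi> s) [^]\<^bsub>localization R M\<^esub> Suc k
      = fraction R M (\<pi> p) (\<pi> s) [^]\<^bsub>localization R M\<^esub> k \<otimes>\<^bsub>localization R M\<^esub> fraction R M (\<pi> p) (\<pi> s)"
    by (simp add: nat_pow_def)
  also have "\<dots> = fraction R M (\<pi> (p ^ k * p)) (\<pi> (s ^ k * s))"
    unfolding Suc by (rule fraction_mult[OF \<open>s ^ k \<in> N\<close> assms])
  finally show ?case by (simp add: mult.commute)
qed

text \<open>If the power \<open>k\<close> of p/s is zero, then \<open>u * p ^ k\<close> lies in
  \<open>K\<close> for some \<open>u\<close> off the prime, so \<open>(u * p) ^ k\<close> does too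
  for positive \<open>k\<close>, and the hypothesis applies to \<open>u * p\<close>. For
  \<open>k = 0\<close> the element \<open>u\<close> itself lies in \<open>K\<close>.\<close>

lemma reduced_stalk:
  assumes red: "\<And>r k. r ^ k \<in> K \<Longrightarrow> \<exists>h. \<pi> h \<notin> P \<and> h * r \<in> K"
  shows "reduced_ring (Spec_stalk R P)"
  unfolding reduced_ring_def Spec_stalk_def
proof (intro ballI allI impI)
  fix X k assume "X \<in> carrier (localization R M)"
    and Xk: "X [^]\<^bsub>localization R M\<^esub> (k::nat) = \<zero>\<^bsub>localization R M\<^esub>"
  then obtain x y where xy: "X = fraction R M x y" "x \<in> carrier R" "y \<in> M"
    by (auto simp: localization_def)
  obtain p where p: "x = \<pi> p" using surj[OF xy(2)] ..
  obtain s where s': "y = \<pi> s" using surj[of y] xy(3) by blast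
  have X: "X = fraction R M (\<pi> p) (\<pi> s)" and s: "s \<in> N" using xy by (simp_all add: p s')
  have zero': "\<zero>\<^bsub>localization R M\<^esub> = fraction R M (\<pi> 0) (\<pi> 1)"
    by (simp add: localization_def zero one)
  have sk: "s ^ k \<in> N" by (induction k) (use s N_one N_mult in auto)
  have "same_fraction (p ^ k) (s ^ k) 0 1"
    using Xk unfolding X fraction_power[OF s] zero' by (simp only: fraction_eq[OF sk N_one])
  then obtain u where u: "u \<in> N" "u * p ^ k \<in> K" by (auto simp: same_fraction_def)
  have "\<exists>h. \<pi> h \<notin> P \<and> h * (u * p) \<in> K"
  proof (cases "k = 0")
    case True
    then have "1 * (u * p) \<in> K" using u is_ideal_mult'[OF K_ideal, of u p] by simp
    then show ?thesis using N_one by auto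
  next
    case False
    have "(u * p) ^ k = u ^ (k - 1) * (u * p ^ k)"
      using False by (cases k) (simp_all add: power_mult_distrib algebra_simps)
    then show ?thesis using red[of "u * p" k] is_ideal_mult[OF K_ideal u(2)] by simp
  qed
  then obtain h where "h \<in> N" "h * (u * p) \<in> K" by auto
  then have "same_fraction p s 0 1"
    unfolding same_fraction_def using N_mult[OF _ u(1), of h] by (intro bexI[of _ "h * u"]) (simp_all add: mult.assoc)
  then show "X = \<zero>\<^bsub>localization R M\<^esub>" by (simp add: X zero' fraction_eq[OF s N_one])
qed

end

text \<open>The open set where some member of \<open>G\<close> does not vanish contains all minimal
  primes. It is dense, because each prime contains a minimal one, and an open set that contains a
  prime contains every smaller prime.\<close>

lemma generically_reduced:
  assumes G: "\<And>P. is_prime P \<Longrightarrow> K \<subseteq> P \<Longrightarrow> (\<And>Q. is_prime Q \<Longrightarrow> K \<subseteq> Q \<Longrightarrow> Q \<subseteq> P \<Longrightarrow> P \<subseteq> Q) \<Longrightarrow> \<exists>f\<in>G. f \<notin> P"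
    and red: "\<And>P f r k. is_prime P \<Longrightarrow> K \<subseteq> P \<Longrightarrow> f \<in> G \<Longrightarrow> f \<notin> P \<Longrightarrow> r ^ k \<in> K \<Longrightarrow> \<exists>h. h \<notin> P \<and> h * r \<in> K"
  shows "Spec_generically_reduced R"
proof -
  define U where "U = Spec R - vanishing_locus R (\<pi> ` G)"
  have U: "P \<in> U \<longleftrightarrow> primeideal P R \<and> (\<exists>f\<in>G. \<pi> f \<notin> P)" for P
    by (auto simp: U_def Spec_def vanishing_locus_def)
  have "openin (zariski R) U"
    unfolding openin_zariski U_def using closed by (intro exI[of _ "\<pi> ` G"]) auto
  moreover have "Abstract_Topology.closure_of (zariski R) U = topspace (zariski R)"
  proof
    show "Abstract_Topology.closure_of (zariski R) U \<subseteq> topspace (zariski R)"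
      by (rule closure_of_subset_topspace)
    show "topspace (zariski R) \<subseteq> Abstract_Topology.closure_of (zariski R) U"
    proof
      fix P assume P: "P \<in> topspace (zariski R)"
      then have pP: "primeideal P R" by (simp add: topspace_zariski Spec_def)
      note pre = prime_preimage[OF pP]
      have "\<exists>y\<in>U. y \<in> T" if T: "P \<in> T" "openin (zariski R) T" for T
      proof -
        obtain E where E: "T = Spec R - vanishing_locus R E" using T(2) by (auto simp: openin_zariski)
        obtain e where e: "e \<in> E" "e \<notin> P" using T(1) unfolding E Spec_def vanishing_locus_def by blast
        obtain Q where Q: "is_prime Q" "K \<subseteq> Q" "Q \<subseteq> \<pi> -` P"
          and min: "\<And>Q'. is_prime Q' \<Longrightarrow> K \<subseteq> Q' \<Longrightarrow> Q' \<subseteq> Q \<Longrightarrow> Q \<subseteq> Q'"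
          using minimal_prime_exists[OF pre] by blast
        obtain f where f: "f \<in> G" "f \<notin> Q" using G[OF Q(1,2) min] by blast
        have pQ: "primeideal (\<pi> ` Q) R" by (rule prime_image[OF Q(1,2)])
        have "\<pi> f \<notin> \<pi> ` Q" using f image_mem_iff[OF is_prime_ideal[OF Q(1)] Q(2)] by blast
        then have "\<pi> ` Q \<in> U" using f pQ by (auto simp: U)
        moreover have "e \<notin> \<pi> ` Q" using e Q(3) by blast
        then have "\<pi> ` Q \<in> T" using pQ e by (auto simp: E Spec_def vanishing_locus_def)
        ultimately show ?thesis by blast
      qed
      with P show "P \<in> Abstract_Topology.closure_of (zariski R) U" by (auto simp: in_closure_of)
    qed
  qed
  moreover have "Spec_reduced_on R U"
    unfolding Spec_reduced_on_def
  proof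
    fix P assume "P \<in> U"
    then obtain f where P: "primeideal P R" and f: "f \<in> G" "f \<notin> \<pi> -` P" by (auto simp: U)
    show "reduced_ring (Spec_stalk R P)"
      using red[OF prime_preimage[OF P] f] by (intro reduced_stalk[OF P]) auto
  qed
  ultimately show ?thesis unfolding Spec_generically_reduced_def by blast
qed

end

section \<open>The residue field of a critical prime as a type\<close>

text \<open>Everything that is needed about one prime, with the form and the dimensions quantified
  inside, so that a constant chosen with reference to this property depends on the type
  \<open>'k\<close> alone.\<close>

definition well_behaved :: "'k::field pt_poly set \<Rightarrow> bool" where
  "well_behaved P \<longleftrightarrow> ((2::'k) \<noteq> 0 \<longrightarrow> (\<forall>B d n \<gamma>. sym_form d (gram B d) \<gamma> \<longrightarrow> relations B d n \<subseteq> P \<longrightarrow>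
     ((\<forall>Q. is_prime Q \<longrightarrow> relations B d n \<subseteq> Q \<longrightarrow> Q \<subseteq> P \<longrightarrow> P \<subseteq> Q) \<longrightarrow> (\<exists>f. f \<notin> P \<and> good B d n f)) \<and>
     (\<forall>f r k. good B d n f \<longrightarrow> f \<notin> P \<longrightarrow> r ^ k \<in> relations B d n \<longrightarrow>
        (\<exists>h. h \<notin> P \<and> h * r \<in> relations B d n))))"

text \<open>A type cannot depend on a prime that is fixed in a proof, but it can depend on a global
  constant. So the constant is chosen to be a counterexample to the claim that all primes are well
  behaved, if there is one; refuting this one counterexample proves the claim.\<close>

definition critical_prime :: "'k::field pt_poly set" where
  "critical_prime = (SOME P. is_prime P \<and> (well_behaved P \<longrightarrow> (\<forall>Q :: 'k pt_poly set. is_prime Q \<longrightarrow> well_behaved Q)))"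

lemma is_prime_zero: "is_prime {0 :: 'a::idom}"
  by (auto simp: is_prime_def is_ideal_def)

lemma critical_prime:
  shows "is_prime (critical_prime :: 'k::field pt_poly set)"
    and "well_behaved (critical_prime :: 'k::field pt_poly set) \<Longrightarrow> is_prime (Q :: 'k pt_poly set) \<Longrightarrow> well_behaved Q"
proof -
  have "\<exists>P :: 'k pt_poly set. is_prime P \<and> (well_behaved P \<longrightarrow> (\<forall>Q :: 'k pt_poly set. is_prime Q \<longrightarrow> well_behaved Q))"
  proof (cases "\<forall>Q :: 'k pt_poly set. is_prime Q \<longrightarrow> well_behaved Q")
    case True
    then show ?thesis using is_prime_zero by (intro exI[of _ "{0}"]) simp
  next
    case False
    then show ?thesis by blast
  qed
  note * = someI_ex[OF this, folded critical_prime_def]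
  from * show "is_prime (critical_prime :: 'k pt_poly set)" by (rule conjunct1)
  show "well_behaved Q" if "well_behaved (critical_prime :: 'k pt_poly set)" "is_prime Q" for Q :: "'k pt_poly set"
    using * that by simp
qed

lemmas critical_ideal = is_prime_ideal[OF critical_prime(1)]

definition residue_rel :: "'k::field pt_poly \<Rightarrow> 'k pt_poly \<Rightarrow> bool" where
  "residue_rel p q \<longleftrightarrow> p - q \<in> critical_prime"

lemma equivp_residue_rel: "equivp (residue_rel :: 'k::field pt_poly \<Rightarrow> _)"
proof (rule equivpI)
  show "reflp (residue_rel :: 'k pt_poly \<Rightarrow> _)"
    by (rule reflpI) (simp add: residue_rel_def is_ideal_zero[OF critical_ideal])
  show "symp (residue_rel :: 'k pt_poly \<Rightarrow> _)"
    using is_ideal_uminus[OF critical_ideal] by (intro sympI) (fastforce simp: residue_rel_def)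
  show "transp (residue_rel :: 'k pt_poly \<Rightarrow> _)"
  proof (rule transpI)
    fix p q r :: "'k pt_poly" assume "residue_rel p q" "residue_rel q r"
    then have "(p - q) + (q - r) \<in> critical_prime"
      unfolding residue_rel_def by (rule is_ideal_add[OF critical_ideal])
    then show "residue_rel p r" by (simp add: residue_rel_def)
  qed
qed

quotient_type (overloaded) 'k residue_ring = "'k::field pt_poly" / residue_rel
  by (rule equivp_residue_rel)

instantiation residue_ring :: (field) comm_ring_1
begin

lift_definition zero_residue_ring :: "'a residue_ring" is 0 .
lift_definition one_residue_ring :: "'a residue_ring" is 1 .

lift_definition plus_residue_ring :: "'a residue_ring \<Rightarrow> 'a residue_ring \<Rightarrow> 'a residue_ring" is "(+)"
proof -
  fix p p' q q' :: "'a pt_poly" assume "residue_rel p p'" "residue_rel q q'"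
  then have "(p - p') + (q - q') \<in> critical_prime"
    unfolding residue_rel_def by (rule is_ideal_add[OF critical_ideal])
  then show "residue_rel (p + q) (p' + q')" by (simp add: residue_rel_def algebra_simps)
qed

lift_definition uminus_residue_ring :: "'a residue_ring \<Rightarrow> 'a residue_ring" is uminus
proof -
  fix p p' :: "'a pt_poly" assume "residue_rel p p'"
  then have "- (p - p') \<in> critical_prime"
    unfolding residue_rel_def by (rule is_ideal_uminus[OF critical_ideal])
  then show "residue_rel (- p) (- p')" by (simp add: residue_rel_def)
qed

definition minus_residue_ring :: "'a residue_ring \<Rightarrow> 'a residue_ring \<Rightarrow> 'a residue_ring" where
  "x - y = x + - (y :: 'a residue_ring)"

lift_definition times_residue_ring :: "'a residue_ring \<Rightarrow> 'a residue_ring \<Rightarrow> 'a residue_ring" is "(*)"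
proof -
  fix p p' q q' :: "'a pt_poly" assume "residue_rel p p'" "residue_rel q q'"
  then have "q * (p - p') + p' * (q - q') \<in> critical_prime"
    unfolding residue_rel_def by (intro is_ideal_add[OF critical_ideal] is_ideal_mult[OF critical_ideal])
  then show "residue_rel (p * q) (p' * q')" by (simp add: residue_rel_def algebra_simps)
qed

instance
proof
  fix x y z :: "'a residue_ring"
  have refl: "residue_rel p p" for p :: "'a pt_poly"
    by (simp add: residue_rel_def is_ideal_zero[OF critical_ideal])
  show "x * y * z = x * (y * z)" by transfer (simp add: refl mult.assoc)
  show "x * y = y * x" by transfer (simp add: refl mult.commute)
  show "1 * x = x" by transfer (simp add: refl)
  show "x + y + z = x + (y + z)" by transfer (simp add: refl add.assoc)
  show "x + y = y + x" by transfer (simp add: refl add.commute)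
  show "0 + x = x" by transfer (simp add: refl)
  show "- x + x = 0" by transfer (simp add: refl)
  show "x - y = x + - y" by (rule minus_residue_ring_def)
  show "(x + y) * z = x * z + y * z" by transfer (simp add: refl distrib_right)
  show "(0 :: 'a residue_ring) \<noteq> 1"
  proof transfer
    show "\<not> residue_rel 0 (1 :: 'a pt_poly)"
      using critical_prime(1) is_ideal_uminus[OF critical_ideal, of "- 1 :: 'a pt_poly"]
      by (auto simp: residue_rel_def is_prime_def)
  qed
qed

end

instance residue_ring :: (field) idom
proof
  fix x y :: "'a residue_ring" assume "x \<noteq> 0" "y \<noteq> 0"
  then show "x * y \<noteq> 0"
    by transfer (use critical_prime(1) in \<open>auto simp: residue_rel_def is_prime_def\<close>)
qed

definition residue :: "'k::field pt_poly \<Rightarrow> 'k residue_ring fract" where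
  "residue p = Fraction_Field.Fract (abs_residue_ring p) 1"

lemma residue_eq_0_iff: "residue p = 0 \<longleftrightarrow> p \<in> critical_prime"
proof -
  have "residue p = 0 \<longleftrightarrow> abs_residue_ring p = 0"
    by (simp add: residue_def Zero_fract_def eq_fract)
  also have "\<dots> \<longleftrightarrow> p \<in> critical_prime" by transfer (simp add: residue_rel_def)
  finally show ?thesis .
qed

lemma residue_map_residue: "residue_map residue"
proof -
  have "comm_ring_hom (abs_residue_ring :: 'a pt_poly \<Rightarrow> _)"
    by (rule comm_ring_homI)
      (simp_all add: one_residue_ring.abs_eq plus_residue_ring.abs_eq times_residue_ring.abs_eq)
  from comm_ring_hom_comp[OF comm_ring_hom_Fract this] show ?thesis
    unfolding residue_map_def residue_def .
qed

lemma residue_surj: "\<exists>a g. residue g \<noteq> 0 \<and> y = residue a / residue g"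
proof -
  obtain u v where y: "y = Fraction_Field.Fract u v" "v \<noteq> 0" by (cases y)
  have "\<exists>a. x = abs_residue_ring a" for x :: "'a residue_ring"
    by (induct x rule: residue_ring.abs_induct) blast
  then obtain a g where ag: "u = abs_residue_ring a" "v = abs_residue_ring g" by blast
  have "residue g \<noteq> 0" using y(2) by (simp add: residue_def ag Zero_fract_def eq_fract)
  moreover have "y = residue a / residue g" using y by (simp add: residue_def ag)
  ultimately show ?thesis by blast
qed

lemma prime_well_behaved:
  assumes "is_prime (P :: 'k::field pt_poly set)"
  shows "well_behaved P"
proof (rule critical_prime(2)[OF _ assms])
  have ker: "{p. residue p = 0} = (critical_prime :: 'k pt_poly set)" by (simp add: residue_eq_0_iff)
  show "well_behaved (critical_prime :: 'k pt_poly set)"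
    unfolding well_behaved_def
  proof (intro impI allI conjI)
    fix B :: "'k vec \<Rightarrow> 'k vec \<Rightarrow> 'k" and d n \<gamma>
    assume two: "(2::'k) \<noteq> 0" and form: "sym_form d (gram B d) \<gamma>"
      and sub: "relations B d n \<subseteq> critical_prime"
    interpret orth_point "residue :: 'k pt_poly \<Rightarrow> _" B d n \<gamma>
      by (rule orth_point.intro[OF residue_map_residue orth_point_axioms.intro])
        (use form two sub in \<open>auto simp: residue_eq_0_iff\<close>)
    {
      assume "\<forall>Q. is_prime Q \<longrightarrow> relations B d n \<subseteq> Q \<longrightarrow> Q \<subseteq> critical_prime \<longrightarrow> critical_prime \<subseteq> Q"
      then show "\<exists>f. f \<notin> critical_prime \<and> good B d n f"
        using minimal_prime_good[OF _ residue_surj] unfolding ker residue_eq_0_iff by blast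
    }
    fix f r k assume "good B d n f" "f \<notin> critical_prime" "r ^ k \<in> relations B d n"
    then show "\<exists>h. h \<notin> critical_prime \<and> h * r \<in> relations B d n"
      using good_locally_reduced unfolding residue_eq_0_iff by blast
  qed
qed

section \<open>Non-degenerate forms\<close>

lemma form_expand_left:
  assumes B: "bilinear_form_on d B" and w: "w \<in> carrier_vec d"
  shows "B (vec d u) w = (\<Sum>i<d. u i * B (unit_vec d i) w)"
proof -
  have add: "B (x + y) w = B x w + B y w" if "x \<in> carrier_vec d" "y \<in> carrier_vec d" for x y
    using B w that unfolding bilinear_form_on_def by blast
  have scale: "B (c \<cdot>\<^sub>v x) w = c * B x w" if "x \<in> carrier_vec d" for x c
    using B w that unfolding bilinear_form_on_def by blast
  have "B (vec d (\<lambda>i. if i < k then u i else 0)) w = (\<Sum>i<k. u i * B (unit_vec d i) w)" if "k \<le> d" for k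
    using that
  proof (induction k)
    case 0
    have "vec d (\<lambda>i. if i < 0 then u i else 0) = 0 \<cdot>\<^sub>v vec d u" by (intro eq_vecI) auto
    then show ?case using scale[of "vec d u" 0] by simp
  next
    case (Suc k)
    have "vec d (\<lambda>i. if i < Suc k then u i else 0)
        = vec d (\<lambda>i. if i < k then u i else 0) + u k \<cdot>\<^sub>v unit_vec d k"
      using Suc.prems by (intro eq_vecI) (auto simp: less_Suc_eq)
    then show ?case using Suc add scale by simp
  qed
  from this[of d] have "B (vec d (\<lambda>i. if i < d then u i else 0)) w = (\<Sum>i<d. u i * B (unit_vec d i) w)" by simp
  moreover have "vec d (\<lambda>i. if i < d then u i else 0) = vec d u" by (intro eq_vecI) auto
  ultimately show ?thesis by simp
qed

text \<open>A linear relation \<open>h\<close> between the rows of the Gram matrix makes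
  \<open>vec d h\<close> orthogonal to every vector, hence zero. The rows are therefore independent
  and \<open>matrix_right_inverse\<close> applies.\<close>

lemma gram_sym_form:
  assumes B: "bilinear_form_on d B" "symmetric_form_on d B" "nondegenerate_form_on d B"
  obtains \<gamma> where "sym_form d (gram B d) \<gamma>"
proof -
  have gram_sym: "gram B d i j = gram B d j i" for i j
    using B(2) unfolding symmetric_form_on_def gram_def by simp
  have right: "B u (vec d v) = (\<Sum>j<d. v j * B u (unit_vec d j))" if "u \<in> carrier_vec d" for u v
  proof -
    have "B u (vec d v) = B (vec d v) u"
      using B(2) that unfolding symmetric_form_on_def by simp
    also have "\<dots> = (\<Sum>j<d. v j * B (unit_vec d j) u)" by (rule form_expand_left[OF B(1) that])
    also have "\<dots> = (\<Sum>j<d. v j * B u (unit_vec d j))"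
      using B(2) that unfolding symmetric_form_on_def by (intro sum.cong) simp_all
    finally show ?thesis .
  qed
  have "\<exists>p. \<forall>l\<in>{..<d}. \<forall>i\<in>{..<d}. (\<Sum>j<d. gram B d i j * p l j) = (if i = l then 1 else 0)"
  proof (rule matrix_right_inverse)
    fix h assume h: "\<And>j. j \<in> {..<d} \<Longrightarrow> (\<Sum>i<d. h i * gram B d i j) = 0"
    have "B (vec d h) v = 0" if v: "v \<in> carrier_vec d" for v
    proof -
      have "vec d (($) v) = v" using v by (intro eq_vecI) auto
      then have "B (vec d h) v = (\<Sum>i<d. h i * B (unit_vec d i) (vec d (($) v)))"
        using form_expand_left[OF B(1) v] by simp
      also have "\<dots> = (\<Sum>i<d. h i * (\<Sum>j<d. gram B d i j * v $ j))"
        by (intro sum.cong) (simp_all add: right gram_def mult.commute)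
      also have "\<dots> = (\<Sum>j<d. (\<Sum>i<d. h i * gram B d i j) * v $ j)"
        unfolding sum_distrib_left sum_distrib_right by (subst sum.swap) (simp add: mult.assoc)
      also have "\<dots> = 0" by (simp add: h)
      finally show ?thesis .
    qed
    then have "vec d h = 0\<^sub>v d" using B(3) unfolding nondegenerate_form_on_def by simp
    then show "\<forall>i\<in>{..<d}. h i = 0" by (metis index_vec index_zero_vec(1) lessThan_iff)
  qed simp_all
  then obtain p where p: "\<And>i l. i < d \<Longrightarrow> l < d \<Longrightarrow> (\<Sum>j<d. gram B d i j * p l j) = (if i = l then 1 else 0)"
    by (auto simp: Ball_def)
  show ?thesis
    by (rule that[of "\<lambda>j l. p l j"]) (unfold_locales, use gram_sym p in auto)
qed

lemma two_nonzero_of_char: "CHAR('k::field) \<noteq> 2 \<Longrightarrow> (2::'k) \<noteq> 0"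
proof
  assume "CHAR('k) \<noteq> 2" "(2::'k) = 0"
  then have "of_nat 2 = (0::'k)" by simp
  then have "CHAR('k) dvd 2" by (simp only: of_nat_eq_0_iff_char_dvd)
  then have "CHAR('k) = 1 \<or> CHAR('k) = 2" using prime_nat_iff two_is_prime_nat by blast
  then show False using \<open>CHAR('k) \<noteq> 2\<close> by simp
qed

text \<open>\<open>restrict_vars\<close> retracts the ring of all polynomials onto the polynomial
  ring of the statement, so following it by the coset map remains surjective; the kernel is
  \<open>relations B d n\<close> by construction.\<close>

lemma orth_presentation:
  "presentation (orth_coordinate_ring d n B) (\<lambda>p. orth_ideal d n B +>\<^bsub>orth_poly_ring d n\<^esub> restrict_vars d n p)"
  (is "presentation ?R ?\<pi>")
  and orth_presentation_kernel:
  "presentation.K (orth_coordinate_ring d n B) (\<lambda>p. orth_ideal d n B +>\<^bsub>orth_poly_ring d n\<^esub> restrict_vars d n p)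
    = relations B d n"
proof -
  interpret S: cring "orth_poly_ring d n :: 'a pt_poly ring" by (rule orth_poly_cring)
  interpret I: ideal "orth_ideal d n B" "orth_poly_ring d n" by (rule orth_ideal_ideal)
  interpret h: comm_ring_hom "restrict_vars d n :: 'a pt_poly \<Rightarrow> _" by (rule restrict_vars_hom)
  interpret Q: cring ?R
    unfolding orth_coordinate_ring_def by (rule I.quotient_is_cring[OF orth_poly_cring])
  note hom = I.rcos_ring_hom
  show pres: "presentation ?R ?\<pi>"
  proof
    fix p q :: "'a pt_poly" and x
    show "?\<pi> p \<in> carrier ?R"
      unfolding orth_coordinate_ring_def by (rule ring_hom_closed[OF hom restrict_vars_carrier])
    show "?\<pi> 1 = \<one>\<^bsub>?R\<^esub>"
      unfolding orth_coordinate_ring_def using ring_hom_one[OF hom] by (simp add: orth_poly_ring_ops)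
    show "?\<pi> (p + q) = ?\<pi> p \<oplus>\<^bsub>?R\<^esub> ?\<pi> q"
      unfolding orth_coordinate_ring_def
      using ring_hom_add[OF hom restrict_vars_carrier[of d n p] restrict_vars_carrier[of d n q]]
      by (simp add: orth_poly_ring_ops h.hom_add)
    show "?\<pi> (p * q) = ?\<pi> p \<otimes>\<^bsub>?R\<^esub> ?\<pi> q"
      unfolding orth_coordinate_ring_def
      using ring_hom_mult[OF hom restrict_vars_carrier[of d n p] restrict_vars_carrier[of d n q]]
      by (simp add: orth_poly_ring_ops h.hom_mult)
    assume "x \<in> carrier ?R"
    then have "x \<in> a_rcosets\<^bsub>orth_poly_ring d n\<^esub> (orth_ideal d n B)"
      by (simp add: orth_coordinate_ring_def FactRing_def)
    then obtain p where "p \<in> carrier (orth_poly_ring d n)" "x = orth_ideal d n B +>\<^bsub>orth_poly_ring d n\<^esub> p"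
      unfolding A_RCOSETS_def' by blast
    then show "\<exists>p. x = ?\<pi> p" using restrict_vars_id[of p d n] by (intro exI[of _ p]) simp
  qed
  have "\<zero>\<^bsub>?R\<^esub> = orth_ideal d n B" by (simp add: orth_coordinate_ring_def FactRing_def)
  moreover have "orth_ideal d n B +>\<^bsub>orth_poly_ring d n\<^esub> x = orth_ideal d n B \<longleftrightarrow> x \<in> orth_ideal d n B"
    if "x \<in> carrier (orth_poly_ring d n)" for x
    using I.a_rcos_const[of x] I.a_rcos_self[OF that] by auto
  ultimately show "presentation.K ?R ?\<pi> = relations B d n"
    by (simp add: presentation.K_def[OF pres] relations_def restrict_vars_carrier)
qed

theorem theorem7:
  fixes B :: "'k::field vec \<Rightarrow> 'k vec \<Rightarrow> 'k" and d n :: nat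
  assumes "CHAR('k) \<noteq> 2"
    and "d \<ge> 1" and "n \<ge> 2"
    and "bilinear_form_on d B" and "symmetric_form_on d B" and "nondegenerate_form_on d B"
  shows "Spec_generically_reduced (orth_coordinate_ring d n B)"
proof -
  obtain \<gamma> where form: "sym_form d (gram B d) \<gamma>" using gram_sym_form assms(4-6) by blast
  have two: "(2::'k) \<noteq> 0" using two_nonzero_of_char assms(1) by blast
  interpret presentation "orth_coordinate_ring d n B"
    "\<lambda>p. orth_ideal d n B +>\<^bsub>orth_poly_ring d n\<^esub> restrict_vars d n p"
    by (rule orth_presentation)
  have K: "K = relations B d n" by (rule orth_presentation_kernel)
  have wb: "((\<forall>Q. is_prime Q \<longrightarrow> relations B d n \<subseteq> Q \<longrightarrow> Q \<subseteq> P \<longrightarrow> P \<subseteq> Q) \<longrightarrow> (\<exists>f. f \<notin> P \<and> good B d n f)) \<and>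
     (\<forall>f r k. good B d n f \<longrightarrow> f \<notin> P \<longrightarrow> r ^ k \<in> relations B d n \<longrightarrow>
        (\<exists>h. h \<notin> P \<and> h * r \<in> relations B d n))"
    if "is_prime P" "relations B d n \<subseteq> P" for P
    using prime_well_behaved[OF that(1)] two form that(2) unfolding well_behaved_def by blast
  show ?thesis
  proof (rule generically_reduced[of "{f. good B d n f}"])
    show "\<exists>f\<in>{f. good B d n f}. f \<notin> P"
      if "is_prime P" "K \<subseteq> P" "\<And>Q. is_prime Q \<Longrightarrow> K \<subseteq> Q \<Longrightarrow> Q \<subseteq> P \<Longrightarrow> P \<subseteq> Q" for P
      using wb[of P] that unfolding K by blast
    show "\<exists>h. h \<notin> P \<and> h * r \<in> K"
      if "is_prime P" "K \<subseteq> P" "f \<in> {f. good B d n f}" "f \<notin> P" "r ^ k \<in> K" for P f r k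
      using wb[of P] that unfolding K by blast
  qed
qed

end
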